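(* Let $n\ge 2$ and let $\mathcal{C}$ and $\overline{\mathcal{C}}$ be two algebraic space curves in $\mathbb{C}^n$, neither of which has an infinity point of the form $(0:m_2:\cdots:m_n:0)$. Then $\mathcal{C}$ and $\overline{\mathcal{C}}$ have a similar asymptotic behavior if and only if the Hausdorff distance $d_H(\mathcal{C},\overline{\mathcal{C}})$ between them is finite.
   Context: Curves. An algebraic space curve $\mathcal{C}\subset\mathbb{C}^n$ is a one-dimensional algebraic set defined by finitely many real polynomials $f_1,\dots,f_s\in\mathbb{R}[x_1,\dots,x_n]$ (a curve given by a real rational parametrization is the curve so defined by its implicit equations). All complex points of the curve are considered. $\mathcal{C}^*\subset\mathbb{P}^n(\mathbb{C})$ denotes the corresponding projective curve (the projective closure of $\mathcal{C}$, with $x_{n+1}$ the homogenizing variable), and the infinity points of $\mathcal{C}$ are the points of $\mathcal{C}^*$ with $x_{n+1}=0$. It is assumed that no infinity point has the form $(0:m_2:\cdots:m_n:0)$, so all infinity points are of the form $(1:m_2:\cdots:m_n:0)$. Infinity branches. Let $F_i$ be the homogenization of $f_i$ and $g_i(x_2,\dots,x_{n+1})=F_i(1,x_2,\dots,x_{n+1})$. Let $P=(1:m_2:\cdots:m_n:0)$ be an infinity point. There are finitely many tuples $\varphi=(\varphi_2(t),\dots,\varphi_n(t))$ of Puiseux series over $\mathbb{C}$ with $g_i(\varphi_2(t),\dots,\varphi_n(t),t)=0$ for all $i$ and $\varphi_j(0)=m_j$; they have the form $\varphi_j(t)=m_j+\sum_{i\ge1}a_{i,j}t^{N_{i,j}/N_j}$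 with $a_{i,j}\ne0$, $N_j,N_{i,j}\in\mathbb{N}$, $0<N_{1,j}<N_{2,j}<\cdots$ (the sum may be finite or empty), $N_j$ being the ramification index (least common denominator of the exponents) of $\varphi_j$, and they converge near $t=0$. Let $N=\mathrm{lcm}(N_2,\dots,N_n)$ and let $c_1,\dots,c_N$ be the $N$ complex roots of $x^N=1$. The conjugates of $\varphi$ give the series $$r_{\alpha,j}(z)=m_jz+\sum_{i\ge1}a_{i,j}\,c_\alpha^{N_{i,j}N/N_j}\,z^{1-N_{i,j}/N_j},\qquad \alpha=1,\dots,N,\ j=2,\dots,n.$$ The infinity branch of $\mathcal{C}$ associated to $P$ and to the conjugacy class of $\varphi$ is $B=\bigcup_{\alpha=1}^N L_\alpha$, where $L_\alpha=\{(z,r_{\alpha,2}(z),\dots,r_{\alpha,n}(z))\in\mathbb{C}^n: z\in\mathbb{C},\ |z|>M\}$ and $M>0$ is a real number, fixed for the branch, such that all these series converge for $|z|>M$ and $L_\alpha\subset\mathcal{C}$. The sets $L_\alpha$ are the leaves of $B$. Fractional powers of $z$ are computed with one fixed determination of $\log z$ (e.g. the principal one), the same for all series. Divergence. Two leaves given by $(z,r_2(z),\dots,r_n(z))$ and $(z,\overline r_2(z),\dots,\overline r_n(z))$ diverge if $\lim_{z\to\infty}\|(r_2(z),\dots,r_n(z))-(\overline r_2(z),\dots,\overline r_n(z))\|=\infty$, for any norm on $\mathbb{C}^{n-1}$. Two infinity branches $B$ and $\overline B$ diverge if every leaf of $B$ diverges from every leaf of $\overline B$; otherwise they are non-divergent.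 Similar asymptotic behavior. $\mathcal{C}$ and $\overline{\mathcal{C}}$ have a similar asymptotic behavior if for every infinity branch $B\subseteq\mathcal{C}$ there exists an infinity branch $\overline B\subseteq\overline{\mathcal{C}}$ non-divergent with $B$, and reciprocally (with the roles of the two curves exchanged). Hausdorff distance. With $d$ the usual unitary (Hermitian Euclidean) distance on $\mathbb{C}^n$ and $d(p,\mathcal{C})=\min\{d(p,q):q\in\mathcal{C}\}$, $$d_H(\mathcal{C},\overline{\mathcal{C}})=\max\Big\{\sup_{p\in\mathcal{C}}d(p,\overline{\mathcal{C}}),\ \sup_{\overline p\in\overline{\mathcal{C}}}d(\overline p,\mathcal{C})\Big\}\in[0,\infty].$$ *)

theory Defs
  imports "HOL-Analysis.Analysis" "HOL-Library.Poly_Mapping"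
    "HOL-Computational_Algebra.Formal_Power_Series"
begin

text \<open>
  The coordinates of the affine space \<open>complex ^ 'n\<close> are indexed by a finite linear order \<open>'n\<close>;
  the first one, written \<open>x\<^sub>1\<close> below, has the least index. Projective space is described by
  homogeneous coordinates in \<open>complex ^ 'n option\<close>, where the index \<open>None\<close> belongs to the
  homogenizing variable.
\<close>

definition first_index :: "'n::{finite,linorder}" where
  "first_index = Min UNIV"


section \<open>Polynomials in several variables\<close>

type_synonym ('v, 'a) mpoly = "('v \<Rightarrow>\<^sub>0 nat) \<Rightarrow>\<^sub>0 'a"

text \<open>Value at the point \<open>x\<close> over a ring extension given by the embedding \<open>h\<close> of the coefficients.\<close>

definition mpoly_eval ::
  "('a::zero \<Rightarrow> 'b::comm_semiring_1) \<Rightarrow> ('v::finite, 'a) mpoly \<Rightarrow> ('v \<Rightarrow> 'b) \<Rightarrow> 'b" where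
  "mpoly_eval h f x =
     (\<Sum>m\<in>Poly_Mapping.keys f.
        h (Poly_Mapping.lookup f m) * (\<Prod>i\<in>UNIV. x i ^ Poly_Mapping.lookup m i))"

definition monom_degree :: "('v::finite \<Rightarrow>\<^sub>0 nat) \<Rightarrow> nat" where
  "monom_degree m = (\<Sum>i\<in>UNIV. Poly_Mapping.lookup m i)"

definition total_degree :: "('v::finite, 'a::zero) mpoly \<Rightarrow> nat" where
  "total_degree f = Max (insert 0 (monom_degree ` Poly_Mapping.keys f))"

definition homogeneous :: "('v::finite, 'a::zero) mpoly \<Rightarrow> bool" where
  "homogeneous f \<longleftrightarrow> (\<exists>d. \<forall>m\<in>Poly_Mapping.keys f. monom_degree m = d)"

lift_definition homogenize_monom :: "nat \<Rightarrow> ('v::finite \<Rightarrow>\<^sub>0 nat) \<Rightarrow> ('v option \<Rightarrow>\<^sub>0 nat)"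
  is "\<lambda>d m. case_option (d - (\<Sum>i\<in>UNIV. m i)) m"
  by simp

definition homogenize :: "('v::finite, 'a::comm_monoid_add) mpoly \<Rightarrow> ('v option, 'a) mpoly" where
  "homogenize f =
     (\<Sum>m\<in>Poly_Mapping.keys f.
        Poly_Mapping.single (homogenize_monom (total_degree f) m) (Poly_Mapping.lookup f m))"


section \<open>Algebraic sets and curves\<close>

definition algebraic_set :: "(complex ^ 'n::finite) set \<Rightarrow> bool" where
  "algebraic_set V \<longleftrightarrow>
     (\<exists>S :: ('n, complex) mpoly set. V = {x. \<forall>f\<in>S. mpoly_eval id f (($) x) = 0})"

definition irreducible_algebraic_set :: "(complex ^ 'n::finite) set \<Rightarrow> bool" where
  "irreducible_algebraic_set V \<longleftrightarrow>
     algebraic_set V \<and> V \<noteq> {} \<and>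
     (\<forall>A B. algebraic_set A \<longrightarrow> algebraic_set B \<longrightarrow> V = A \<union> B \<longrightarrow> V = A \<or> V = B)"

text \<open>
  The Krull dimension, i.e. the supremum of the lengths \<open>k\<close> of the chains
  \<open>Z\<^sub>0 \<subset> \<dots> \<subset> Z\<^sub>k\<close> of irreducible algebraic subsets; the empty set gets dimension 0 here.
\<close>

definition algebraic_dimension :: "(complex ^ 'n::finite) set \<Rightarrow> enat" where
  "algebraic_dimension V =
     (SUP Zs \<in> {Zs. Zs \<noteq> [] \<and> sorted_wrt (\<subset>) Zs \<and>
                    (\<forall>Z\<in>set Zs. irreducible_algebraic_set Z \<and> Z \<subseteq> V)}. enat (length Zs - 1))"

text \<open>The complex points of the set defined by the real polynomials in \<open>F\<close>.\<close>

definition zero_locus :: "('n::finite, real) mpoly set \<Rightarrow> (complex ^ 'n) set" where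
  "zero_locus F = {x. \<forall>f\<in>F. mpoly_eval of_real f (($) x) = 0}"

definition defines_space_curve :: "('n::finite, real) mpoly set \<Rightarrow> bool" where
  "defines_space_curve F \<longleftrightarrow> finite F \<and> algebraic_dimension (zero_locus F) = 1"


section \<open>Infinity points\<close>

text \<open>
  The projective closure is the Zariski closure of \<open>{(p : 1). p \<in> C}\<close>. It is represented by the
  set of all homogeneous coordinate vectors of its points.
\<close>

definition projective_closure :: "(complex ^ 'n::finite) set \<Rightarrow> (complex ^ 'n option) set" where
  "projective_closure C =
     {x. x \<noteq> 0 \<and>
         (\<forall>H :: ('n option, complex) mpoly. homogeneous H \<longrightarrow>
            (\<forall>p\<in>C. mpoly_eval id H (case_option 1 (($) p)) = 0) \<longrightarrow>
            mpoly_eval id H (($) x) = 0)}"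

definition infinity_points :: "(complex ^ 'n::finite) set \<Rightarrow> (complex ^ 'n option) set" where
  "infinity_points C = {x \<in> projective_closure C. x $ None = 0}"

definition no_infinity_point_with_x1_zero ::
  "(complex ^ 'n::{finite,linorder}) set \<Rightarrow> bool" where
  "no_infinity_point_with_x1_zero C \<longleftrightarrow> (\<forall>x\<in>infinity_points C. x $ Some first_index \<noteq> 0)"


section \<open>Puiseux series\<close>

text \<open>
  A Puiseux series \<open>\<Sum>q. a q * t\<^sup>q\<close> without negative exponents is given by its coefficient
  function \<open>a\<close>, which lives on the rational exponents.
\<close>

definition puiseux_series :: "(rat \<Rightarrow> complex) \<Rightarrow> bool" where
  "puiseux_series a \<longleftrightarrow> (\<exists>K::nat. K > 0 \<and> (\<forall>q. a q \<noteq> 0 \<longrightarrow> q \<ge> 0 \<and> of_nat K * q \<in> \<int>))"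

definition ramification_index :: "(rat \<Rightarrow> complex) \<Rightarrow> nat" where
  "ramification_index a = (LEAST K. K > 0 \<and> (\<forall>q. a q \<noteq> 0 \<longrightarrow> of_nat K * q \<in> \<int>))"

definition common_ramification :: "('n::finite \<Rightarrow> rat \<Rightarrow> complex) \<Rightarrow> nat" where
  "common_ramification \<phi> = Lcm (ramification_index ` (\<phi> ` UNIV))"

text \<open>The power series in \<open>s\<close> obtained from the Puiseux series \<open>a\<close> by the substitution \<open>t = s ^ N\<close>.\<close>

definition puiseux_fps :: "nat \<Rightarrow> (rat \<Rightarrow> complex) \<Rightarrow> complex fps" where
  "puiseux_fps N a = Abs_fps (\<lambda>k. a (of_nat k / of_nat N))"

text \<open>
  Solutions \<open>(1 : \<phi>\<^sub>2 : \<dots> : \<phi>\<^sub>n : t)\<close> of the homogenized equations. The tuple \<open>\<phi>\<close> has a first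
  component as well, the constant series 1, which stands for the dehomogenization \<open>x\<^sub>1 = 1\<close> and
  whose ramification index is 1. The equations are evaluated in \<open>complex fps\<close>, with \<open>t = s ^ N\<close>.
\<close>

definition puiseux_solution ::
  "('n::{finite,linorder}, real) mpoly set \<Rightarrow> ('n \<Rightarrow> rat \<Rightarrow> complex) \<Rightarrow> bool" where
  "puiseux_solution F \<phi> \<longleftrightarrow>
     \<phi> first_index = (\<lambda>q. if q = 0 then 1 else 0) \<and>
     (\<forall>j. puiseux_series (\<phi> j)) \<and>
     (\<chi> i. case i of None \<Rightarrow> 0 | Some j \<Rightarrow> \<phi> j 0) \<in> infinity_points (zero_locus F) \<and>
     (let N = common_ramification \<phi> in
        \<forall>f\<in>F. mpoly_eval (\<lambda>c. fps_const (of_real c)) (homogenize f)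
                 (case_option (fps_X ^ N) (\<lambda>j. puiseux_fps N (\<phi> j))) = 0)"


section \<open>Infinity branches\<close>

text \<open>
  The \<open>k\<close>-th term of \<open>r\<^sub>j(z) = z * \<phi>\<^sub>j(1 / z)\<close>, conjugated by the root of unity \<open>c\<close>: the exponent
  \<open>N\<^sub>i\<^sub>j / N\<^sub>j\<close> is written \<open>k / N\<close>, so that \<open>N\<^sub>i\<^sub>j * N / N\<^sub>j = k\<close>. The power of \<open>z\<close> is the one
  given by the principal logarithm.
\<close>

definition leaf_term ::
  "('n::finite \<Rightarrow> rat \<Rightarrow> complex) \<Rightarrow> complex \<Rightarrow> 'n \<Rightarrow> complex \<Rightarrow> nat \<Rightarrow> complex" where
  "leaf_term \<phi> c j z k =
     (let N = common_ramification \<phi> in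
        \<phi> j (of_nat k / of_nat N) * c ^ k * z powr (1 - of_nat k / of_nat N))"

text \<open>
  The point \<open>(z, r\<^sub>2(z), \<dots>, r\<^sub>n(z))\<close>; for \<open>z \<noteq> 0\<close> its first coordinate is \<open>z\<close> because the first
  component of \<open>\<phi>\<close> is the series 1.
\<close>

definition leaf_point ::
  "('n::finite \<Rightarrow> rat \<Rightarrow> complex) \<Rightarrow> complex \<Rightarrow> complex \<Rightarrow> complex ^ 'n" where
  "leaf_point \<phi> c z = (\<chi> j. suminf (leaf_term \<phi> c j z))"

definition conjugation_roots :: "('n::finite \<Rightarrow> rat \<Rightarrow> complex) \<Rightarrow> complex set" where
  "conjugation_roots \<phi> = {c. c ^ common_ramification \<phi> = 1}"

text \<open>
  A branch is given by a representative \<open>\<phi>\<close> of a conjugacy class of solutions and by the bound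
  \<open>M\<close>; conjugate representatives have the same leaves.
\<close>

type_synonym 'n branch = "('n \<Rightarrow> rat \<Rightarrow> complex) \<times> real"

definition leaf :: "'n::finite branch \<Rightarrow> complex \<Rightarrow> (complex ^ 'n) set" where
  "leaf B c = leaf_point (fst B) c ` {z. norm z > snd B}"

definition branch_points :: "'n::finite branch \<Rightarrow> (complex ^ 'n) set" where
  "branch_points B = (\<Union>c\<in>conjugation_roots (fst B). leaf B c)"

definition infinity_branch ::
  "('n::{finite,linorder}, real) mpoly set \<Rightarrow> 'n branch \<Rightarrow> bool" where
  "infinity_branch F B \<longleftrightarrow>
     puiseux_solution F (fst B) \<and> snd B > 0 \<and>
     (\<forall>c\<in>conjugation_roots (fst B). \<forall>z. norm z > snd B \<longrightarrow>
        (\<forall>j. summable (leaf_term (fst B) c j z))) \<and>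
     branch_points B \<subseteq> zero_locus F"


section \<open>Divergence and similar asymptotic behavior\<close>

text \<open>
  The first coordinates of the two leaves agree, hence the norm of \<open>complex ^ 'n\<close> measures the
  difference of the other \<open>n - 1\<close> coordinates.
\<close>

definition leaves_diverge ::
  "'n::finite branch \<Rightarrow> complex \<Rightarrow> 'n branch \<Rightarrow> complex \<Rightarrow> bool" where
  "leaves_diverge B c B' c' \<longleftrightarrow>
     filterlim (\<lambda>z. norm (leaf_point (fst B) c z - leaf_point (fst B') c' z)) at_top at_infinity"

definition branches_diverge :: "'n::finite branch \<Rightarrow> 'n branch \<Rightarrow> bool" where
  "branches_diverge B B' \<longleftrightarrow>
     (\<forall>c\<in>conjugation_roots (fst B). \<forall>c'\<in>conjugation_roots (fst B'). leaves_diverge B c B' c')"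

definition similar_asymptotic_behavior ::
  "('n::{finite,linorder}, real) mpoly set \<Rightarrow> ('n, real) mpoly set \<Rightarrow> bool" where
  "similar_asymptotic_behavior F G \<longleftrightarrow>
     (\<forall>B. infinity_branch F B \<longrightarrow> (\<exists>B'. infinity_branch G B' \<and> \<not> branches_diverge B B')) \<and>
     (\<forall>B'. infinity_branch G B' \<longrightarrow> (\<exists>B. infinity_branch F B \<and> \<not> branches_diverge B' B))"


section \<open>Hausdorff distance\<close>

text \<open>
  For nonempty closed sets in \<open>complex ^ 'n\<close>, such as curves, the infimum in \<^const>\<open>infdist\<close> is a
  minimum.
\<close>

definition hausdorff_distance :: "'a::metric_space set \<Rightarrow> 'a set \<Rightarrow> ennreal" where
  "hausdorff_distance C D =
     max (SUP p\<in>C. ennreal (infdist p D)) (SUP p\<in>D. ennreal (infdist p C))"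

end

theory Submission
  imports Defs
    "HOL-Complex_Analysis.Complex_Analysis"
    "HOL-Computational_Algebra.Fundamental_Theorem_Algebra"
begin

text \<open>
Why the theorem holds. Outside a bounded set each curve is covered by finitely many leaves, and
two leaves stay at bounded distance from each other as soon as they do not diverge.

\<^emph>\<open>Covering.\<close> The absence of infinity points with \<open>x\<^sub>1 = 0\<close> has two consequences for a curve \<open>C\<close>. By
compactness of the unit sphere, \<open>\<bar>p\<bar>\<close> grows at most linearly with \<open>\<bar>x\<^sub>1(p)\<bar>\<close> on \<open>C\<close>
(\<open>linear_growth\<close>). By the Nullstellensatz, applied to the cone over \<open>C\<close> intersected with
\<open>x\<^sub>0 = x\<^sub>1 = 0\<close>, the coordinate ring of \<open>C\<close> is a finite module over the polynomials in \<open>x\<^sub>1\<close>;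
counting monomials then yields for every other coordinate \<open>x\<^sub>j\<close> a nonzero polynomial \<open>P\<^sub>j\<close> in two variables with
\<open>P\<^sub>j(x\<^sub>1, x\<^sub>j) = 0\<close> on \<open>C\<close> (\<open>coordinate_relation\<close>). Puiseux's theorem at infinity
(\<open>puiseux_roots_exist\<close>) describes the roots of \<open>P\<^sub>j(z, -)\<close> for large \<open>z = t\<^sup>-\<^sup>N\<close> by finitely many
functions meromorphic in \<open>t\<close> at 0. It is proved analytically: after splitting off common
factors with the derivative, the roots form a covering over a half-plane of logarithms
\<open>w\<close> of \<open>z\<close>, hence are holomorphic functions of \<open>w\<close>, and since there are finitely many of them they are
periodic. On a tuple of such functions, one for each coordinate, every defining equation vanishes either
identically or at no small \<open>t \<noteq> 0\<close>. Tuples on which all equations vanish give infinity branches, and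
the others do not meet \<open>C\<close> near infinity
(\<open>finitely_many_branches_cover\<close>).

\<^emph>\<open>Asymptotics.\<close> A leaf with parameter \<open>z\<close> is a finite sum of terms \<open>a\<^sub>k z\<close> to the power \<open>1 - k/L\<close>
with \<open>k < L\<close> up to a bounded error (\<open>leaf_point_expansion\<close>). Hence two
leaves either diverge or have the same coefficients for all positive exponents, and then their distance is
bounded. If this holds for one pair of leaves of two branches, conjugating both
simultaneously gives a partner for every leaf (\<open>nondivergent_branch_stays_near\<close>).

\<^emph>\<open>Conclusion.\<close> If the asymptotic behavior is similar, then the finitely many leaves that cover \<open>C\<close> near infinity
stay within bounded distance of the other curve, and the rest of \<open>C\<close> is bounded. Conversely, suppose that the
distance is finite, and walk along a leaf of \<open>C\<close> at \<open>z = 1, 2, 3, \<dots>\<close>. Nearby points of the other curve lie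
on its finitely many covering leaves, so one of these is hit infinitely often. Its
first coordinates are within bounded distance of \<open>z\<close>, and a leaf moves only by a bounded amount when its parameter does
(\<open>leaf_point_near\<close>). So this leaf does not diverge from the given one.
\<close>

section \<open>Linear dependence\<close>

text \<open>
Gaussian elimination, one equation at a time. The linear dependence obtained here is used twice:
in the Nullstellensatz for polynomials with a common finite support, and
for the monomials in two coordinates of a curve.
\<close>

lemma homogeneous_system_nontrivial:
  fixes M :: "'i \<Rightarrow> 't \<Rightarrow> 'a::field"
  assumes "finite T" "finite I" "card T < card I"
  shows "\<exists>c. (\<exists>i\<in>I. c i \<noteq> 0) \<and> (\<forall>t\<in>T. (\<Sum>i\<in>I. c i * M i t) = 0)"
  using assms
proof (induction T arbitrary: I M rule: finite_induct)
  case empty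
  then obtain i where "i \<in> I" by fastforce
  then show ?case by (intro exI[of _ "\<lambda>_. 1"]) auto
next
  case (insert t T)
  show ?case
  proof (cases "\<forall>i\<in>I. M i t = 0")
    case True
    have "card T < card I" using insert by simp
    with insert.IH[of I M] insert.prems obtain c where
      "\<exists>i\<in>I. c i \<noteq> 0" "\<forall>t\<in>T. (\<Sum>i\<in>I. c i * M i t) = 0" by auto
    with True show ?thesis by (intro exI[of _ c]) auto
  next
    case False
    then obtain k where k: "k \<in> I" "M k t \<noteq> 0" by blast
    \<comment> \<open>Eliminate the unknown \<open>k\<close> with the equation \<open>t\<close>.\<close>
    define M' where "M' i s = M i s - M i t / M k t * M k s" for i s
    have "card T < card (I - {k})" using insert k by simp
    then obtain c where c: "\<exists>i\<in>I - {k}. c i \<noteq> 0" "\<forall>s\<in>T. (\<Sum>i\<in>I - {k}. c i * M' i s) = 0"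
      using insert.IH[of "I - {k}" M'] insert.prems by auto
    define c' where "c' i = (if i = k then - (\<Sum>i\<in>I - {k}. c i * M i t / M k t) else c i)" for i
    have sum: "(\<Sum>i\<in>I. c' i * M i s) = (\<Sum>i\<in>I - {k}. c i * M' i s)" for s
    proof -
      have "(\<Sum>i\<in>I. c' i * M i s) = c' k * M k s + (\<Sum>i\<in>I - {k}. c' i * M i s)"
        using k insert.prems by (intro sum.remove) auto
      also have "(\<Sum>i\<in>I - {k}. c' i * M i s) = (\<Sum>i\<in>I - {k}. c i * M i s)"
        by (intro sum.cong) (auto simp: c'_def)
      finally show ?thesis
        by (simp add: c'_def M'_def right_diff_distrib sum_subtractf sum_distrib_right mult.assoc)
    qed
    show ?thesis
    proof (intro exI[of _ c'] conjI ballI)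
      show "\<exists>i\<in>I. c' i \<noteq> 0" using c(1) by (auto simp: c'_def)
      fix s assume "s \<in> insert t T"
      then show "(\<Sum>i\<in>I. c' i * M i s) = 0"
        unfolding sum using c(2) k(2) by (auto simp: M'_def)
    qed
  qed
qed

section \<open>Values of polynomials in several variables\<close>

definition monom_eval :: "('v::finite \<Rightarrow> complex) \<Rightarrow> ('v \<Rightarrow>\<^sub>0 nat) \<Rightarrow> complex" where
  "monom_eval x m = (\<Prod>i\<in>UNIV. x i ^ Poly_Mapping.lookup m i)"

text \<open>
Evaluation of complex polynomials as a constant of its own, so that its ring laws are stable
rewrite rules; \<open>mpoly_eval\<close> carries the embedding \<open>id\<close>, which the simplifier would unfold.
\<close>

definition ceval :: "('v::finite, complex) mpoly \<Rightarrow> ('v \<Rightarrow> complex) \<Rightarrow> complex" where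
  "ceval f x = (\<Sum>m\<in>Poly_Mapping.keys f. Poly_Mapping.lookup f m * monom_eval x m)"

lemma mpoly_eval_id: "mpoly_eval id f x = ceval f x"
  by (simp add: mpoly_eval_def ceval_def monom_eval_def)

lemma monom_eval_add: "monom_eval x (m + n) = monom_eval x m * monom_eval x n"
  by (simp add: monom_eval_def lookup_add power_add prod.distrib)

lemma monom_eval_zero [simp]: "monom_eval x 0 = 1"
  by (simp add: monom_eval_def)

lemma monom_eval_var [simp]: "monom_eval x (Poly_Mapping.single i 1) = x i"
proof -
  have "monom_eval x (Poly_Mapping.single i 1) = (\<Prod>j\<in>UNIV. if j = i then x j else 1)"
    unfolding monom_eval_def by (intro prod.cong) (auto simp: lookup_single when_def)
  then show ?thesis by simp
qed

lemma monom_eval_scale: "monom_eval (\<lambda>i. l * x i) m = l ^ monom_degree m * monom_eval x m"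
  by (simp add: monom_eval_def monom_degree_def power_mult_distrib prod.distrib power_sum)

lemma ceval_superset:
  assumes "finite S" "Poly_Mapping.keys f \<subseteq> S"
  shows "ceval f x = (\<Sum>m\<in>S. Poly_Mapping.lookup f m * monom_eval x m)"
  unfolding ceval_def
  using assms by (intro sum.mono_neutral_left) (auto simp: in_keys_iff)

lemma ceval_add: "ceval (f + g) x = ceval f x + ceval g x"
proof -
  let ?S = "Poly_Mapping.keys f \<union> Poly_Mapping.keys g"
  have "ceval (f + g) x = (\<Sum>m\<in>?S. Poly_Mapping.lookup (f + g) m * monom_eval x m)"
    by (rule ceval_superset) (use keys_add[of f g] in auto)
  also have "\<dots> = (\<Sum>m\<in>?S. Poly_Mapping.lookup f m * monom_eval x m) + (\<Sum>m\<in>?S. Poly_Mapping.lookup g m * monom_eval x m)"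
    by (simp add: lookup_add distrib_right sum.distrib)
  finally show ?thesis by (simp add: ceval_superset[symmetric])
qed

lemma ceval_zero [simp]: "ceval 0 x = 0"
  by (simp add: ceval_def)

lemma ceval_single: "ceval (Poly_Mapping.single m c) x = c * monom_eval x m"
  by (subst ceval_superset[of "{m}"]) auto

lemma ceval_sum: "ceval (\<Sum>i\<in>I. f i) x = (\<Sum>i\<in>I. ceval (f i) x)"
  by (induction I rule: infinite_finite_induct) (simp_all add: ceval_add)

lemma poly_mapping_sum_singles:
  "f = (\<Sum>m\<in>Poly_Mapping.keys f. Poly_Mapping.single m (Poly_Mapping.lookup f m))"
  by (rule poly_mapping_eqI) (auto simp: lookup_sum lookup_single when_def in_keys_iff)

lemma ceval_mult: "ceval (f * g) x = ceval f x * ceval g x"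
proof -
  let ?F = "Poly_Mapping.keys f" and ?G = "Poly_Mapping.keys g"
  have "f * g = (\<Sum>m\<in>?F. Poly_Mapping.single m (Poly_Mapping.lookup f m)) *
      (\<Sum>n\<in>?G. Poly_Mapping.single n (Poly_Mapping.lookup g n))"
    using poly_mapping_sum_singles[of f] poly_mapping_sum_singles[of g] by simp
  also have "\<dots> = (\<Sum>m\<in>?F. \<Sum>n\<in>?G. Poly_Mapping.single (m + n) (Poly_Mapping.lookup f m * Poly_Mapping.lookup g n))"
    by (simp add: sum_product mult_single)
  finally have "ceval (f * g) x = (\<Sum>m\<in>?F. \<Sum>n\<in>?G. Poly_Mapping.lookup f m * Poly_Mapping.lookup g n * monom_eval x (m + n))"
    by (simp add: ceval_sum ceval_single)
  also have "\<dots> = ceval f x * ceval g x"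
    by (simp add: ceval_def sum_product monom_eval_add mult_ac)
  finally show ?thesis .
qed

lemma ceval_one [simp]: "ceval 1 x = 1"
  using ceval_single[of 0 1 x] by simp

lemma ceval_power: "ceval (f ^ k) x = ceval f x ^ k"
  by (induction k) (simp_all add: ceval_mult)

definition pvar :: "'v \<Rightarrow> ('v::finite, complex) mpoly" where
  "pvar i = Poly_Mapping.single (Poly_Mapping.single i 1) 1"

definition pconst :: "complex \<Rightarrow> ('v::finite, complex) mpoly" where
  "pconst c = Poly_Mapping.single 0 c"

lemma ceval_pvar [simp]: "ceval (pvar i) x = x i"
  by (simp add: pvar_def ceval_single del: One_nat_def)

lemma pconst_0 [simp]: "pconst 0 = 0" and pconst_1 [simp]: "pconst 1 = 1"
  and pconst_add: "pconst (a + b) = pconst a + pconst b"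
  and pconst_mult: "pconst (a * b) = pconst a * pconst b"
  and pconst_uminus: "pconst (- a) = - pconst a"
  by (simp_all add: pconst_def single_add mult_single single_uminus)

section \<open>The Nullstellensatz over the complex numbers\<close>

definition ideal_set :: "'a::comm_ring_1 set \<Rightarrow> bool" where
  "ideal_set J \<longleftrightarrow> 0 \<in> J \<and> (\<forall>a\<in>J. \<forall>b\<in>J. a + b \<in> J) \<and> (\<forall>a\<in>J. \<forall>r. r * a \<in> J)"

lemma ideal_set_diff: "ideal_set J \<Longrightarrow> a \<in> J \<Longrightarrow> b \<in> J \<Longrightarrow> a - b \<in> J"
  unfolding ideal_set_def by (metis mult_minus1 uminus_add_conv_diff add.commute)

lemma ideal_set_sum: "ideal_set J \<Longrightarrow> (\<And>i. i \<in> I \<Longrightarrow> f i \<in> J) \<Longrightarrow> sum f I \<in> J"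
  by (induction I rule: infinite_finite_induct) (auto simp: ideal_set_def)

text \<open>
Zorn's lemma gives an ideal \<open>Q\<close> that is maximal among those which contain \<open>J\<close> and avoid the powers
of \<open>y\<close>. By maximality, every element outside \<open>Q\<close> divides a power of \<open>y\<close> modulo \<open>Q\<close>; multiplying two
such relations shows that \<open>Q\<close> is prime.
\<close>

lemma prime_ideal_avoiding_powers:
  fixes y :: "'a::comm_ring_1"
  assumes J: "ideal_set J" and y: "\<And>k. y ^ k \<notin> J"
  obtains Q where "ideal_set Q" "J \<subseteq> Q" "\<And>k. y ^ k \<notin> Q"
    and "\<And>a. a \<notin> Q \<Longrightarrow> \<exists>k r. y ^ k - r * a \<in> Q"
    and "\<And>a b. a * b \<in> Q \<Longrightarrow> a \<in> Q \<or> b \<in> Q"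
proof -
  define \<A> where "\<A> = {Q. ideal_set Q \<and> J \<subseteq> Q \<and> (\<forall>k. y ^ k \<notin> Q)}"
  have "\<exists>M\<in>\<A>. \<forall>X\<in>\<A>. M \<subseteq> X \<longrightarrow> X = M"
  proof (rule subset_Zorn_nonempty)
    show "\<A> \<noteq> {}" using assms by (auto simp: \<A>_def)
    fix \<C> assume ne: "\<C> \<noteq> {}" and ch: "subset.chain \<A> \<C>"
    have sub: "X \<in> \<A>" if "X \<in> \<C>" for X using ch that by (auto simp: subset_chain_def)
    have tot: "X \<subseteq> Y \<or> Y \<subseteq> X" if "X \<in> \<C>" "Y \<in> \<C>" for X Y
      using ch that by (auto simp: subset_chain_def)
    have "ideal_set (\<Union>\<C>)"
      unfolding ideal_set_def
    proof (intro conjI ballI allI)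
      show "0 \<in> \<Union>\<C>" using ne sub by (auto simp: \<A>_def ideal_set_def)
      show "r * a \<in> \<Union>\<C>" if "a \<in> \<Union>\<C>" for a r
        using that sub by (fastforce simp: \<A>_def ideal_set_def)
      fix a b assume "a \<in> \<Union>\<C>" "b \<in> \<Union>\<C>"
      then obtain X Y where XY: "X \<in> \<C>" "Y \<in> \<C>" "a \<in> X" "b \<in> Y" by blast
      then have "a + b \<in> X \<or> a + b \<in> Y"
        using tot[OF XY(1,2)] sub[OF XY(1)] sub[OF XY(2)] by (auto simp: \<A>_def ideal_set_def)
      with XY show "a + b \<in> \<Union>\<C>" by blast
    qed
    then show "\<Union>\<C> \<in> \<A>" using ne sub by (auto simp: \<A>_def)
  qed
  then obtain Q where Q: "Q \<in> \<A>" and max: "\<And>X. X \<in> \<A> \<Longrightarrow> Q \<subseteq> X \<Longrightarrow> X = Q" by blast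
  have idQ: "ideal_set Q" and JQ: "J \<subseteq> Q" and yQ: "y ^ k \<notin> Q" for k using Q by (auto simp: \<A>_def)
  have add: "a + b \<in> Q" if "a \<in> Q" "b \<in> Q" for a b using idQ that by (simp add: ideal_set_def)
  have mul: "r * a \<in> Q" if "a \<in> Q" for a r using idQ that by (simp add: ideal_set_def)
  have ex: "\<exists>k r. y ^ k - r * a \<in> Q" if a: "a \<notin> Q" for a
  proof (rule ccontr)
    assume no: "\<not> ?thesis"
    define X where "X = {q + r * a |q r. q \<in> Q}"
    have "ideal_set X"
      unfolding ideal_set_def
    proof (intro conjI ballI allI)
      have "0 + 0 * a \<in> X" unfolding X_def using idQ unfolding ideal_set_def by blast
      then show "0 \<in> X" by simp
      fix u assume "u \<in> X"
      then obtain q r where u: "u = q + r * a" "q \<in> Q" by (auto simp: X_def)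
      show "s * u \<in> X" for s
      proof -
        have "s * u = s * q + (s * r) * a" using u by (simp add: algebra_simps)
        then show ?thesis using mul[OF u(2), of s] by (auto simp: X_def)
      qed
      fix v assume "v \<in> X"
      then obtain q' r' where v: "v = q' + r' * a" "q' \<in> Q" by (auto simp: X_def)
      have "u + v = (q + q') + (r + r') * a" using u v by (simp add: algebra_simps)
      then show "u + v \<in> X" using add[OF u(2) v(2)] by (auto simp: X_def)
    qed
    moreover have "Q \<subseteq> X"
    proof
      fix q assume "q \<in> Q"
      then have "q + 0 * a \<in> X" unfolding X_def by blast
      then show "q \<in> X" by simp
    qed
    moreover have "y ^ k \<notin> X" for k
    proof
      assume "y ^ k \<in> X"
      then obtain q r where "y ^ k = q + r * a" "q \<in> Q" by (auto simp: X_def)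
      then have "y ^ k - r * a \<in> Q" by simp
      with no show False by blast
    qed
    ultimately have "X = Q" using JQ by (intro max) (auto simp: \<A>_def)
    moreover have "0 + 1 * a \<in> X" unfolding X_def using idQ unfolding ideal_set_def by blast
    ultimately show False using a by simp
  qed
  have prime: "a \<in> Q \<or> b \<in> Q" if ab: "a * b \<in> Q" for a b
  proof (rule ccontr)
    assume "\<not> ?thesis"
    then obtain k r l s where kr: "y ^ k - r * a \<in> Q" "y ^ l - s * b \<in> Q" using ex by metis
    have "y ^ (k + l) = y ^ l * (y ^ k - r * a) + (r * a) * (y ^ l - s * b) + (r * s) * (a * b)"
      by (simp add: algebra_simps power_add)
    also have "\<dots> \<in> Q" by (intro add mul kr ab)
    finally show False using yQ by blast
  qed
  show ?thesis by (rule that[of Q]) (use idQ JQ yQ ex prime in auto)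
qed

lemma finite_monoms: "finite {m :: 'v::finite \<Rightarrow>\<^sub>0 nat. monom_degree m \<le> d}"
proof (rule finite_imageD)
  have "Poly_Mapping.lookup ` {m :: 'v \<Rightarrow>\<^sub>0 nat. monom_degree m \<le> d} \<subseteq> PiE UNIV (\<lambda>_. {..d})"
  proof safe
    fix m :: "'v \<Rightarrow>\<^sub>0 nat" and i assume "monom_degree m \<le> d"
    moreover have "Poly_Mapping.lookup m i \<le> monom_degree m"
      unfolding monom_degree_def by (rule member_le_sum) auto
    ultimately show "Poly_Mapping.lookup m i \<le> d" by simp
  qed auto
  then show "finite (Poly_Mapping.lookup ` {m :: 'v \<Rightarrow>\<^sub>0 nat. monom_degree m \<le> d})"
    by (rule finite_subset) (intro finite_PiE, auto)
  show "inj_on Poly_Mapping.lookup {m :: 'v \<Rightarrow>\<^sub>0 nat. monom_degree m \<le> d}"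
    by (intro inj_onI) (simp add: poly_mapping_eqI)
qed

definition poly_in_var :: "'v::finite \<Rightarrow> complex poly \<Rightarrow> ('v, complex) mpoly" where
  "poly_in_var i q = poly (map_poly pconst q) (pvar i)"

lemma poly_in_var_pCons: "poly_in_var i (pCons a p) = pconst a + pvar i * poly_in_var i p"
  by (simp add: poly_in_var_def map_poly_pCons)

lemma poly_in_var_0 [simp]: "poly_in_var i 0 = 0"
  by (simp add: poly_in_var_def)

lemma poly_in_var_add: "poly_in_var i (p + q) = poly_in_var i p + poly_in_var i q"
  by (induction p q rule: poly_induct2) (simp_all add: poly_in_var_pCons pconst_add algebra_simps)

lemma poly_in_var_smult: "poly_in_var i (smult c p) = pconst c * poly_in_var i p"
  by (induction p) (simp_all add: poly_in_var_pCons pconst_mult algebra_simps)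

lemma poly_in_var_linear: "poly_in_var i ([:-b, 1:] * p) = (pvar i - pconst b) * poly_in_var i p"
proof -
  have "[:-b, 1:] * p = smult (- b) p + pCons 0 p" by simp
  then show ?thesis
    by (simp only: poly_in_var_add poly_in_var_smult poly_in_var_pCons pconst_uminus pconst_0) (simp add: algebra_simps)
qed

lemma poly_in_var_sum: "poly_in_var i (\<Sum>b\<in>B. f b) = (\<Sum>b\<in>B. poly_in_var i (f b))"
  by (induction B rule: infinite_finite_induct) (simp_all add: poly_in_var_add)

lemma poly_in_var_prod: "poly_in_var i (\<Prod>b\<in>B. [:-f b, 1:]) = (\<Prod>b\<in>B. pvar i - pconst (f b))"
  by (induction B rule: infinite_finite_induct)
    (simp_all add: poly_in_var_linear poly_in_var_pCons one_pCons del: mult_pCons_left)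

lemma prime_ideal_prod:
  assumes "ideal_set Q" "1 \<notin> Q" "\<And>a b. a * b \<in> Q \<Longrightarrow> a \<in> Q \<or> b \<in> Q" "(\<Prod>b\<in>B. f b) \<in> Q"
  shows "\<exists>b\<in>B. f b \<in> Q"
  using assms(4)
proof (induction B rule: infinite_finite_induct)
  case (insert x F)
  then show ?case using assms(3)[of "f x" "prod f F"] by auto
qed (use assms in auto)

text \<open>
The uncountability argument for the Nullstellensatz. If no \<open>x\<^sub>i - b\<close> lay in \<open>Q\<close>, each of them
would divide a power of \<open>y\<close> modulo \<open>Q\<close>, with a cofactor \<open>g b\<close>. As there are uncountably many \<open>b\<close>, infinitely
many cofactors share the exponent of \<open>y\<close> and the degree, so finitely many of them are linearly dependent. Multiplying the dependence
by the product of the factors \<open>x\<^sub>i - b\<close> puts a nonzero polynomial in the single variable \<open>x\<^sub>i\<close> into \<open>Q\<close>. It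
splits into linear factors, and \<open>Q\<close> is prime.
\<close>

lemma prime_ideal_coordinate:
  fixes Q :: "('v::finite, complex) mpoly set"
  assumes Q: "ideal_set Q" "\<And>k. y ^ k \<notin> Q"
    and ex: "\<And>a. a \<notin> Q \<Longrightarrow> \<exists>k r. y ^ k - r * a \<in> Q"
    and prime: "\<And>a b. a * b \<in> Q \<Longrightarrow> a \<in> Q \<or> b \<in> Q"
  shows "\<exists>b. pvar i - pconst b \<in> Q"
proof (rule ccontr)
  assume no: "\<not> ?thesis"
  have add: "a + b \<in> Q" if "a \<in> Q" "b \<in> Q" for a b using Q(1) that by (simp add: ideal_set_def)
  have mul: "r * a \<in> Q" if "a \<in> Q" for a r using Q(1) that by (simp add: ideal_set_def)
  have one: "1 \<notin> Q" using Q(2)[of 0] by simp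
  have "\<forall>b. \<exists>k r. y ^ k - r * (pvar i - pconst b) \<in> Q" using ex no by blast
  then obtain k g where kg: "\<And>b. y ^ k b - g b * (pvar i - pconst b) \<in> Q" by metis
  define f where "f b = (k b, total_degree (g b))" for b
  have "\<exists>p. infinite (f -` {p})"
  proof (rule ccontr)
    assume "\<not> ?thesis"
    then have "countable (\<Union>p. f -` {p})" by (intro countable_UN) (auto intro: countable_finite)
    moreover have "(\<Union>p. f -` {p}) = UNIV" by auto
    ultimately show False using uncountable_UNIV_complex by simp
  qed
  then obtain k0 d where inf: "infinite (f -` {(k0, d)})" by auto
  define T where "T = {m :: 'v \<Rightarrow>\<^sub>0 nat. monom_degree m \<le> d}"
  have finT: "finite T" unfolding T_def by (rule finite_monoms)
  obtain B where B: "B \<subseteq> f -` {(k0, d)}" "finite B" "card B = Suc (card T)"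
    using infinite_arbitrarily_large[OF inf] by metis
  obtain c where c: "\<exists>b\<in>B. c b \<noteq> 0" "\<forall>m\<in>T. (\<Sum>b\<in>B. c b * Poly_Mapping.lookup (g b) m) = 0"
    using homogeneous_system_nontrivial[OF finT B(2), of "\<lambda>b. Poly_Mapping.lookup (g b)"] B(3) by auto
  have kb: "k b = k0" and deg: "total_degree (g b) = d" if "b \<in> B" for b
    using B(1) that by (auto simp: f_def)
  have lin: "(\<Sum>b\<in>B. pconst (c b) * g b) = 0"
  proof (rule poly_mapping_eqI)
    fix m
    have "Poly_Mapping.lookup (\<Sum>b\<in>B. pconst (c b) * g b) m = (\<Sum>b\<in>B. c b * Poly_Mapping.lookup (g b) m)"
      unfolding lookup_sum pconst_def mult_map_scale_conv_mult[symmetric]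
      by (intro sum.cong) (simp_all add: Poly_Mapping.map.rep_eq when_def)
    also have "\<dots> = 0"
    proof (cases "m \<in> T")
      case False
      have "Poly_Mapping.lookup (g b) m = 0" if "b \<in> B" for b
      proof (rule ccontr)
        assume "Poly_Mapping.lookup (g b) m \<noteq> 0"
        then have "monom_degree m \<in> insert 0 (monom_degree ` Poly_Mapping.keys (g b))" by (simp add: in_keys_iff)
        then have "monom_degree m \<le> total_degree (g b)" unfolding total_degree_def by (intro Max_ge) auto
        with False deg[OF that] show False by (simp add: T_def)
      qed
      then show ?thesis by simp
    qed (use c(2) in simp)
    finally show "Poly_Mapping.lookup (\<Sum>b\<in>B. pconst (c b) * g b) m = Poly_Mapping.lookup 0 m" by simp
  qed
  \<comment> \<open>The linear dependence multiplied by the product of all factors becomes \<open>q\<close>; it is nonzero since only one term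
    survives at a point of \<open>B\<close>.\<close>
  define q where "q = (\<Sum>b\<in>B. smult (c b) (\<Prod>b'\<in>B - {b}. [:-b', 1:]))"
  have inq: "poly_in_var i q = (\<Sum>b\<in>B. pconst (c b) * (\<Prod>b'\<in>B - {b}. pvar i - pconst b'))"
    by (simp add: q_def poly_in_var_sum poly_in_var_smult poly_in_var_prod)
  define L where "L = (\<Prod>b\<in>B. pvar i - pconst b)"
  have L: "L = (pvar i - pconst b) * (\<Prod>b'\<in>B - {b}. pvar i - pconst b')" if "b \<in> B" for b
    unfolding L_def using B(2) that by (rule prod.remove)
  have "y ^ k0 * poly_in_var i q - L * (\<Sum>b\<in>B. pconst (c b) * g b) =
      (\<Sum>b\<in>B. pconst (c b) * (\<Prod>b'\<in>B - {b}. pvar i - pconst b') * (y ^ k b - g b * (pvar i - pconst b)))"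
    unfolding inq sum_distrib_left sum_subtractf[symmetric]
    by (intro sum.cong) (simp_all add: L kb algebra_simps)
  also have "\<dots> \<in> Q" by (intro ideal_set_sum Q mul kg)
  finally have "y ^ k0 * poly_in_var i q \<in> Q" by (simp add: lin)
  with prime Q(2) have inQ: "poly_in_var i q \<in> Q" by blast
  have "q \<noteq> 0"
  proof
    assume "q = 0"
    obtain b where b: "b \<in> B" "c b \<noteq> 0" using c(1) by blast
    have "poly q b = (\<Sum>b'\<in>B. if b' = b then c b * (\<Prod>b'\<in>B - {b}. b - b') else 0)"
      unfolding q_def poly_sum poly_smult poly_prod
    proof (intro sum.cong refl)
      fix b' assume "b' \<in> B"
      show "c b' * (\<Prod>x\<in>B - {b'}. poly [:- x, 1:] b) = (if b' = b then c b * (\<Prod>b'\<in>B - {b}. b - b') else 0)"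
        using b B(2) by auto
    qed
    also have "\<dots> = c b * (\<Prod>b'\<in>B - {b}. b - b')" using b B(2) by simp
    finally show False using \<open>q = 0\<close> b B(2) by simp
  qed
  obtain root where root: "smult (lead_coeff q) (\<Prod>j<degree q. [:-root j, 1:]) = q"
    using complex_poly_decompose' by blast
  have "poly_in_var i q = pconst (lead_coeff q) * (\<Prod>j<degree q. pvar i - pconst (root j))"
    by (subst root[symmetric]) (simp only: poly_in_var_smult poly_in_var_prod)
  then have "pconst (inverse (lead_coeff q)) * poly_in_var i q = (\<Prod>j<degree q. pvar i - pconst (root j))"
    using \<open>q \<noteq> 0\<close> by (simp add: mult.assoc[symmetric] pconst_mult[symmetric])
  with mul[OF inQ] have "(\<Prod>j<degree q. pvar i - pconst (root j)) \<in> Q" by metis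
  from prime_ideal_prod[OF Q(1) one prime this] no show False by blast
qed

text \<open>
Modulo \<open>Q\<close> the variable \<open>x\<^sub>i\<close> is the constant \<open>b i\<close>, so a polynomial is congruent to its value at \<open>b\<close>;
for monomials this is an induction on the degree.
\<close>

lemma mpoly_congruent_value:
  fixes Q :: "('v::finite, complex) mpoly set"
  assumes Q: "ideal_set Q" and b: "\<And>i. pvar i - pconst (b i) \<in> Q"
  shows "f - pconst (ceval f b) \<in> Q"
proof -
  have add: "a + b \<in> Q" if "a \<in> Q" "b \<in> Q" for a b using Q that by (simp add: ideal_set_def)
  have mul: "r * a \<in> Q" if "a \<in> Q" for a r using Q that by (simp add: ideal_set_def)
  have mon: "Poly_Mapping.single m 1 - pconst (monom_eval b m) \<in> Q" for m
  proof (induction "monom_degree m" arbitrary: m)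
    case 0
    then have "m = 0" by (intro poly_mapping_eqI) (simp add: monom_degree_def)
    then show ?case using Q by (simp add: ideal_set_def)
  next
    case (Suc n)
    obtain i where i: "Poly_Mapping.lookup m i > 0"
      using Suc(2) by (fastforce simp: monom_degree_def)
    define m' where "m' = m - Poly_Mapping.single i 1"
    have m: "m = Poly_Mapping.single i 1 + m'"
      using i by (intro poly_mapping_eqI) (auto simp: m'_def lookup_add lookup_minus lookup_single when_def)
    have deg1: "monom_degree (Poly_Mapping.single i 1 :: 'v \<Rightarrow>\<^sub>0 nat) = 1"
      by (simp add: monom_degree_def lookup_single when_def)
    have "monom_degree m = 1 + monom_degree m'"
      unfolding m using deg1 by (simp add: monom_degree_def lookup_add sum.distrib)
    then have IH: "Poly_Mapping.single m' 1 - pconst (monom_eval b m') \<in> Q" using Suc by simp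
    have s: "Poly_Mapping.single m 1 = pvar i * Poly_Mapping.single m' 1"
      unfolding m pvar_def by (simp add: mult_single)
    have v: "monom_eval b m = b i * monom_eval b m'" unfolding m monom_eval_add monom_eval_var ..
    have "Poly_Mapping.single m 1 - pconst (monom_eval b m) =
        pvar i * (Poly_Mapping.single m' 1 - pconst (monom_eval b m')) + pconst (monom_eval b m') * (pvar i - pconst (b i))"
      unfolding s v by (simp add: pconst_mult algebra_simps)
    then show ?case using add[OF mul[OF IH] mul[OF b]] by simp
  qed
  have "f - pconst (ceval f b) =
     (\<Sum>m\<in>Poly_Mapping.keys f. pconst (Poly_Mapping.lookup f m) * (Poly_Mapping.single m 1 - pconst (monom_eval b m)))"
  proof -
    have psum: "pconst (\<Sum>m\<in>S. h m) = (\<Sum>m\<in>S. pconst (h m) :: ('v, complex) mpoly)" for S and h :: "('v \<Rightarrow>\<^sub>0 nat) \<Rightarrow> complex"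
      by (induction S rule: infinite_finite_induct) (simp_all add: pconst_add)
    have "f = (\<Sum>m\<in>Poly_Mapping.keys f. pconst (Poly_Mapping.lookup f m) * Poly_Mapping.single m 1)"
      by (subst poly_mapping_sum_singles) (simp add: pconst_def mult_single)
    then show ?thesis
      by (simp add: ceval_def psum pconst_mult right_diff_distrib sum_subtractf)
  qed
  also have "\<dots> \<in> Q" by (intro ideal_set_sum Q mul mon)
  finally show ?thesis .
qed

text \<open>
The prime ideal avoiding the powers of \<open>y\<close> is the ideal of a point \<open>b\<close>: a value
\<open>f(b) \<noteq> 0\<close> for an \<open>f\<close> in the ideal would put the unit 1 into it, and \<open>y(b) = 0\<close> would put \<open>y\<close> into it.
\<close>

theorem nullstellensatz:
  fixes J :: "('v::finite, complex) mpoly set"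
  assumes J: "ideal_set J" and y: "\<And>k. y ^ k \<notin> J"
  obtains b where "\<And>f. f \<in> J \<Longrightarrow> ceval f b = 0" "ceval y b \<noteq> 0"
proof -
  obtain Q where Q: "ideal_set Q" "J \<subseteq> Q" "\<And>k. y ^ k \<notin> Q"
    and ex: "\<And>a. a \<notin> Q \<Longrightarrow> \<exists>k r. y ^ k - r * a \<in> Q"
    and prime: "\<And>a b. a * b \<in> Q \<Longrightarrow> a \<in> Q \<or> b \<in> Q"
    by (rule prime_ideal_avoiding_powers[OF J y], rule that, assumption+)
  have "\<forall>i. \<exists>b. pvar i - pconst b \<in> Q"
    using prime_ideal_coordinate[OF Q(1,3) ex prime] by blast
  then obtain b where b: "\<And>i. pvar i - pconst (b i) \<in> Q" by metis
  show ?thesis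
  proof (rule that[of b])
    fix f assume "f \<in> J"
    have "f - (f - pconst (ceval f b)) \<in> Q"
      using Q(1,2) \<open>f \<in> J\<close> mpoly_congruent_value[OF Q(1) b] by (blast intro: ideal_set_diff)
    then have cQ: "pconst (ceval f b) \<in> Q" by simp
    show "ceval f b = 0"
    proof (rule ccontr)
      assume nz: "ceval f b \<noteq> 0"
      have "pconst (inverse (ceval f b)) * pconst (ceval f b) \<in> Q"
        using Q(1) cQ by (simp add: ideal_set_def)
      then have "1 \<in> Q" using nz by (simp add: pconst_mult[symmetric])
      then show False using Q(3)[of 0] by simp
    qed
  next
    show "ceval y b \<noteq> 0"
      using mpoly_congruent_value[OF Q(1) b, of y] Q(3)[of 1] by auto
  qed
qed

section \<open>Plane relations between the coordinates of a curve\<close>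

definition hom_point :: "complex ^ 'n \<Rightarrow> 'n option \<Rightarrow> complex" where
  "hom_point p = case_option 1 (($) p)"

lemma hom_point_simps [simp]: "hom_point p None = 1" "hom_point p (Some j) = p $ j"
  by (simp_all add: hom_point_def)

lemma homogeneous_scale:
  assumes "homogeneous H"
  shows "\<exists>d. \<forall>l x. ceval H (\<lambda>i. l * x i) = l ^ d * ceval H x"
proof -
  obtain d where "\<And>m. m \<in> Poly_Mapping.keys H \<Longrightarrow> monom_degree m = d"
    using assms by (auto simp: homogeneous_def)
  then show ?thesis
    by (intro exI[of _ d]) (auto simp: ceval_def monom_eval_scale sum_distrib_left intro!: sum.cong)
qed

lemma infinity_pointI:
  fixes C :: "(complex ^ 'n::finite) set"
  assumes "x None = 0" "x \<noteq> (\<lambda>_. 0)"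
    and "\<And>H. homogeneous H \<Longrightarrow> (\<And>p. p \<in> C \<Longrightarrow> ceval H (hom_point p) = 0) \<Longrightarrow> ceval H x = 0"
  shows "(\<chi> i. x i) \<in> infinity_points C"
proof -
  have "($) (\<chi> i. x i) = x" by (rule ext) simp
  moreover have "(\<chi> i. x i) \<noteq> 0" using assms(2) by (auto simp: vec_eq_iff)
  ultimately show ?thesis
    using assms(1,3) unfolding infinity_points_def projective_closure_def mpoly_eval_id hom_point_def by auto
qed

text \<open>
The ideal generated by \<open>x\<^sub>0\<close>, \<open>x\<^sub>1\<close> and the polynomials that vanish on the cone over \<open>C \<times> {1}\<close> has no zero
except the origin, because another zero would be an infinity point with \<open>x\<^sub>1 = 0\<close>. The
Nullstellensatz puts a power of every coordinate into it. The exponent is written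
\<open>Suc k\<close> because the part of degree \<open>k\<close> of the cofactors is extracted later.
\<close>

lemma power_in_infinity_ideal:
  fixes C :: "(complex ^ 'n::{finite,linorder}) set"
  assumes C: "no_infinity_point_with_x1_zero C"
  shows "\<exists>k H A B. (\<forall>p\<in>C. \<forall>l. ceval H (\<lambda>i. l * hom_point p i) = 0) \<and>
     pvar (Some j) ^ Suc k = H + A * pvar None + B * pvar (Some first_index)"
proof -
  define Z where "Z = {H :: ('n option, complex) mpoly. \<forall>p\<in>C. \<forall>l. ceval H (\<lambda>i. l * hom_point p i) = 0}"
  define J where "J = {H + A * pvar None + B * pvar (Some first_index) |H A B. H \<in> Z}"
  have J: "ideal_set J"
    unfolding ideal_set_def
  proof (intro conjI ballI allI)
    have "0 = 0 + 0 * pvar None + 0 * pvar (Some first_index :: 'n option)" by simp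
    moreover have "0 \<in> Z" by (simp add: Z_def)
    ultimately show "0 \<in> J" unfolding J_def by blast
    fix a assume "a \<in> J"
    then obtain H A B where a: "a = H + A * pvar None + B * pvar (Some first_index)" "H \<in> Z"
      by (auto simp: J_def)
    show "r * a \<in> J" for r
    proof -
      have "r * a = (r * H) + (r * A) * pvar None + (r * B) * pvar (Some first_index)"
        unfolding a(1) by (simp add: algebra_simps)
      moreover have "r * H \<in> Z" using a(2) by (simp add: Z_def ceval_mult)
      ultimately show ?thesis unfolding J_def by blast
    qed
    fix b assume "b \<in> J"
    then obtain H' A' B' where b: "b = H' + A' * pvar None + B' * pvar (Some first_index)" "H' \<in> Z"
      by (auto simp: J_def)
    have "a + b = (H + H') + (A + A') * pvar None + (B + B') * pvar (Some first_index)"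
      unfolding a(1) b(1) by (simp add: algebra_simps)
    moreover have "H + H' \<in> Z" using a(2) b(2) by (simp add: Z_def ceval_add)
    ultimately show "a + b \<in> J" unfolding J_def by blast
  qed
  have "\<exists>k. pvar (Some j) ^ k \<in> J"
  proof (rule ccontr)
    assume "\<not> ?thesis"
    then have no: "pvar (Some j) ^ k \<notin> J" for k by blast
    obtain b where b: "\<And>f. f \<in> J \<Longrightarrow> ceval f b = 0" "ceval (pvar (Some j)) b \<noteq> 0"
      by (rule nullstellensatz[OF J no], rule that, assumption+)
    have mem: "H \<in> J" if "H \<in> Z" for H
    proof -
      have "H = H + 0 * pvar None + 0 * pvar (Some first_index)" by simp
      then show ?thesis using that unfolding J_def by blast
    qed
    have Z0: "0 \<in> Z" by (simp add: Z_def)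
    have "pvar None = 0 + 1 * pvar None + 0 * pvar (Some first_index :: 'n option)" by simp
    then have "pvar None \<in> J" using Z0 unfolding J_def by blast
    from b(1)[OF this] have b0: "b None = 0" by simp
    have "pvar (Some first_index) = 0 + 0 * pvar None + 1 * pvar (Some first_index :: 'n option)" by simp
    then have "pvar (Some first_index) \<in> J" using Z0 unfolding J_def by blast
    from b(1)[OF this] have b1: "b (Some first_index) = 0" by simp
    have "(\<chi> i. b i) \<in> infinity_points C"
    proof (rule infinity_pointI)
      show "b \<noteq> (\<lambda>_. 0)" using b(2) by auto
      fix H :: "('n option, complex) mpoly"
      assume H: "homogeneous H" "\<And>p. p \<in> C \<Longrightarrow> ceval H (hom_point p) = 0"
      obtain d where "\<And>l x. ceval H (\<lambda>i. l * x i) = l ^ d * ceval H x"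
        using homogeneous_scale[OF H(1)] by blast
      then have "H \<in> Z" using H(2) by (simp add: Z_def)
      then show "ceval H b = 0" by (intro b(1) mem)
    qed (rule b0)
    with C b1 show False by (auto simp: no_infinity_point_with_x1_zero_def)
  qed
  then obtain k where "pvar (Some j) ^ k \<in> J" by blast
  then have "pvar (Some j) ^ Suc k \<in> J" using J by (simp add: ideal_set_def)
  then show ?thesis unfolding J_def Z_def by blast
qed

definition power_product :: "('n::finite \<Rightarrow> nat) \<Rightarrow> complex ^ 'n \<Rightarrow> complex" where
  "power_product m p = (\<Prod>i\<in>UNIV. p $ i ^ m i)"

text \<open>
Linear combinations of monomials in the coordinate ring of \<open>C\<close>: the equation is required on \<open>C\<close> only.
\<close>

definition spanned :: "(complex ^ 'n::finite) set \<Rightarrow> ('n \<Rightarrow> nat) set \<Rightarrow> (complex ^ 'n \<Rightarrow> complex) \<Rightarrow> bool" where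
  "spanned C T f \<longleftrightarrow> (\<exists>c. \<forall>p\<in>C. f p = (\<Sum>m\<in>T. c m * power_product m p))"

lemma power_product_add: "power_product (\<lambda>i. m i + n i) p = power_product m p * power_product n p"
  by (simp add: power_product_def power_add prod.distrib)

lemma power_product_single: "power_product (\<lambda>i. if i = j then k else 0) p = p $ j ^ k"
proof -
  have "power_product (\<lambda>i. if i = j then k else 0) p = (\<Prod>i\<in>UNIV. if i = j then p $ i ^ k else 1)"
    unfolding power_product_def by (intro prod.cong) auto
  then show ?thesis by simp
qed

lemma spanned_zero: "spanned C T (\<lambda>p. 0)"
  unfolding spanned_def by (rule exI[of _ "\<lambda>_. 0"]) simp

lemma spanned_add: "spanned C T f \<Longrightarrow> spanned C T g \<Longrightarrow> spanned C T (\<lambda>p. f p + g p)"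
  unfolding spanned_def
  by (elim exE, rename_tac a b, rule_tac x = "\<lambda>m. a m + b m" in exI) (simp add: distrib_right sum.distrib)

lemma spanned_cmult: "spanned C T f \<Longrightarrow> spanned C T (\<lambda>p. c * f p)"
  unfolding spanned_def
  by (elim exE, rename_tac a, rule_tac x = "\<lambda>m. c * a m" in exI) (simp add: sum_distrib_left mult.assoc)

lemma spanned_sum: "(\<And>i. i \<in> I \<Longrightarrow> spanned C T (f i)) \<Longrightarrow> spanned C T (\<lambda>p. \<Sum>i\<in>I. f i p)"
  by (induction I rule: infinite_finite_induct) (simp_all add: spanned_zero spanned_add)

lemma spanned_mono: "spanned C S f \<Longrightarrow> S \<subseteq> T \<Longrightarrow> finite T \<Longrightarrow> spanned C T f"
  unfolding spanned_def
proof (elim exE)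
  fix c assume ST: "S \<subseteq> T" "finite T" and c: "\<forall>p\<in>C. f p = (\<Sum>m\<in>S. c m * power_product m p)"
  have "\<forall>p\<in>C. f p = (\<Sum>m\<in>T. (if m \<in> S then c m else 0) * power_product m p)"
  proof
    fix p assume "p \<in> C"
    have "(\<Sum>m\<in>T. (if m \<in> S then c m else 0) * power_product m p) = (\<Sum>m\<in>S. c m * power_product m p)"
      using ST by (intro sum.mono_neutral_cong_right) auto
    with c \<open>p \<in> C\<close> show "f p = (\<Sum>m\<in>T. (if m \<in> S then c m else 0) * power_product m p)" by simp
  qed
  then show "\<exists>c. \<forall>p\<in>C. f p = (\<Sum>m\<in>T. c m * power_product m p)"
    by (intro exI[of _ "\<lambda>m. if m \<in> S then c m else 0"])
qed

lemma spanned_eq: "spanned C T g \<Longrightarrow> (\<And>p. p \<in> C \<Longrightarrow> f p = g p) \<Longrightarrow> spanned C T f"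
  by (simp add: spanned_def)

lemma spanned_power_product: "m \<in> T \<Longrightarrow> finite T \<Longrightarrow> spanned C T (power_product m)"
  unfolding spanned_def by (rule exI[of _ "\<lambda>n. if n = m then 1 else 0"]) (simp add: if_distrib[of "\<lambda>x. x * _"] cong: if_cong)

definition deg_le :: "nat \<Rightarrow> ('n::finite \<Rightarrow> nat) set" where
  "deg_le d = {m. sum m UNIV \<le> d}"

lemma finite_deg_le: "finite (deg_le d :: ('n::finite \<Rightarrow> nat) set)"
proof (rule finite_subset)
  show "deg_le d \<subseteq> PiE (UNIV :: 'n set) (\<lambda>_. {..d})"
  proof
    fix m :: "'n \<Rightarrow> nat" assume "m \<in> deg_le d"
    moreover have "m i \<le> sum m UNIV" for i by (rule member_le_sum) auto
    ultimately show "m \<in> PiE UNIV (\<lambda>_. {..d})" by (force simp: deg_le_def intro: order_trans)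
  qed
qed (intro finite_PiE, auto)

text \<open>
Setting \<open>x\<^sub>0 = 1\<close> turns the homogeneous part of degree \<open>d\<close> into a polynomial of degree at most \<open>d\<close>.
\<close>

lemma hom_component_spanned:
  fixes A :: "('n::finite option, complex) mpoly"
  shows "spanned C (deg_le d) (\<lambda>p. \<Sum>m\<in>{m\<in>Poly_Mapping.keys A. monom_degree m = d}. Poly_Mapping.lookup A m * monom_eval (hom_point p) m)"
proof (intro spanned_sum spanned_cmult)
  fix m assume "m \<in> {m \<in> Poly_Mapping.keys A. monom_degree m = d}"
  then have d: "monom_degree m = d" by simp
  have split: "(UNIV :: 'n option set) = insert None (range Some)" by (rule UNIV_option_conv)
  have "(\<Sum>i\<in>UNIV. Poly_Mapping.lookup m (Some i)) \<le> d"
    unfolding d[symmetric] monom_degree_def split by (simp add: sum.reindex)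
  then have "(\<lambda>i. Poly_Mapping.lookup m (Some i)) \<in> deg_le d" by (simp add: deg_le_def)
  moreover have "monom_eval (hom_point p) m = power_product (\<lambda>i. Poly_Mapping.lookup m (Some i)) p" for p
    unfolding monom_eval_def split by (simp add: prod.reindex power_product_def)
  ultimately show "spanned C (deg_le d) (\<lambda>p. monom_eval (hom_point p) m)"
    using spanned_power_product[OF _ finite_deg_le] by simp
qed

text \<open>
The identity in the infinity ideal is evaluated along the line \<open>l * (1 : p)\<close> of the cone, where the
polynomial vanishing on the cone drops out; the coefficients of \<open>l\<close> to the power \<open>Suc k\<close> are compared.
\<close>

lemma coordinate_power_reduction:
  fixes C :: "(complex ^ 'n::{finite,linorder}) set"
  assumes C: "no_infinity_point_with_x1_zero C"
  shows "\<exists>k \<alpha> \<beta>. spanned C (deg_le k) \<alpha> \<and> spanned C (deg_le k) \<beta> \<and>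
     (\<forall>p\<in>C. p $ j ^ Suc k = \<alpha> p + p $ first_index * \<beta> p)"
proof -
  obtain k H A B where H: "\<And>p l. p \<in> C \<Longrightarrow> ceval H (\<lambda>i. l * hom_point p i) = 0"
    and eq: "pvar (Some j) ^ Suc k = H + A * pvar None + B * pvar (Some first_index)"
    using power_in_infinity_ideal[OF C, of j] by blast
  define comp where "comp A = (\<lambda>p. \<Sum>m\<in>{m\<in>Poly_Mapping.keys A. monom_degree m = k}. Poly_Mapping.lookup A m * monom_eval (hom_point p) m)"
    for A :: "('n option, complex) mpoly"
  have rel: "p $ j ^ Suc k = comp A p + p $ first_index * comp B p" if p: "p \<in> C" for p
  proof -
    define pl where "pl A = (\<Sum>m\<in>Poly_Mapping.keys A. monom (Poly_Mapping.lookup A m * monom_eval (hom_point p) m) (monom_degree m))"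
      for A :: "('n option, complex) mpoly"
    have pl: "poly (pl A) l = ceval A (\<lambda>i. l * hom_point p i)" for A l
      by (simp add: pl_def ceval_def poly_sum poly_monom monom_eval_scale mult_ac)
    have co: "coeff (pl A) k = comp A p" for A
      unfolding pl_def comp_def coeff_sum coeff_monom
      by (rule sum.mono_neutral_cong_right) auto
    have "poly (monom (p $ j ^ Suc k) (Suc k)) l = poly (pCons 0 (pl A + smult (p $ first_index) (pl B))) l" for l
    proof -
      have "(l * p $ j) ^ Suc k = ceval (pvar (Some j) ^ Suc k) (\<lambda>i. l * hom_point p i)"
        by (simp only: ceval_power ceval_pvar hom_point_simps)
      also have "\<dots> = ceval A (\<lambda>i. l * hom_point p i) * l + ceval B (\<lambda>i. l * hom_point p i) * (l * p $ first_index)"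
        unfolding eq ceval_add ceval_mult H[OF p] by simp
      finally show ?thesis
        by (simp add: poly_monom pl power_mult_distrib algebra_simps)
    qed
    then have "monom (p $ j ^ Suc k) (Suc k) = pCons 0 (pl A + smult (p $ first_index) (pl B))"
      by (intro poly_eq_poly_eq_iff[THEN iffD1] ext)
    from arg_cong[OF this, of "\<lambda>q. coeff q (Suc k)"] show ?thesis
      by (simp add: co)
  qed
  show ?thesis
    by (rule exI[of _ k], rule exI[of _ "comp A"], rule exI[of _ "comp B"])
      (use rel hom_component_spanned in \<open>auto simp: comp_def\<close>)
qed

text \<open>
Replacing a power \<open>Suc (k j)\<close> of \<open>x\<^sub>j\<close> by \<open>\<alpha> + x\<^sub>1 \<beta>\<close> does not raise the total degree, but lowers the
degree in the variables other than \<open>x\<^sub>1\<close>, since \<open>\<alpha>\<close> and \<open>\<beta>\<close> have degree at most \<open>k j\<close>. This is the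
finiteness of the coordinate ring over the polynomials in \<open>x\<^sub>1\<close>, together with a degree bound.
\<close>

lemma monomial_reduction:
  fixes C :: "(complex ^ 'n::{finite,linorder}) set" and k :: "'n \<Rightarrow> nat"
  assumes red: "\<And>j. \<exists>\<alpha> \<beta>. spanned C (deg_le (k j)) \<alpha> \<and> spanned C (deg_le (k j)) \<beta> \<and>
     (\<forall>p\<in>C. p $ j ^ Suc (k j) = \<alpha> p + p $ first_index * \<beta> p)"
  shows "spanned C {m'. sum m' UNIV \<le> sum m UNIV \<and> (\<forall>j. j \<noteq> first_index \<longrightarrow> m' j \<le> k j)} (power_product m)"
    (is "spanned C (?T (sum m UNIV)) _")
proof (induction "sum m (- {first_index})" arbitrary: m rule: less_induct)
  case less
  have finT: "finite (?T e)" for e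
    by (rule finite_subset[OF _ finite_deg_le[of e]]) (auto simp: deg_le_def)
  show ?case
  proof (cases "\<forall>j. j \<noteq> first_index \<longrightarrow> m j \<le> k j")
    case True
    then show ?thesis by (intro spanned_power_product finT) simp
  next
    case False
    then obtain j where j: "j \<noteq> first_index" "m j > k j" by (auto simp: not_le)
    define m' where "m' = m(j := m j - Suc (k j))"
    have split: "sum f UNIV = f first_index + sum f (- {first_index})" for f :: "'n \<Rightarrow> nat"
      by (simp add: sum.remove[of UNIV first_index] Compl_eq_Diff_UNIV)
    have m: "m = (\<lambda>i. m' i + (if i = j then Suc (k j) else 0))"
      using j by (auto simp: m'_def fun_eq_iff)
    have m'1: "m' first_index = m first_index" using j by (simp add: m'_def)
    have sm: "sum m (- {first_index}) = sum m' (- {first_index}) + Suc (k j)"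
      by (subst m) (use j in \<open>simp add: sum.distrib\<close>)
    have step: "spanned C (?T (sum m UNIV)) (\<lambda>p. power_product m' p * p $ first_index ^ e * f p)"
      if f: "spanned C (deg_le (k j)) f" and e: "e \<le> 1" for f e
    proof -
      obtain c where c: "\<And>p. p \<in> C \<Longrightarrow> f p = (\<Sum>u\<in>deg_le (k j). c u * power_product u p)"
        using f unfolding spanned_def by blast
      define n where "n u = (\<lambda>i. (m' i + (if i = first_index then e else 0)) + u i)" for u
      have "spanned C (?T (sum m UNIV)) (\<lambda>p. \<Sum>u\<in>deg_le (k j). c u * power_product (n u) p)"
      proof (intro spanned_sum spanned_cmult)
        fix u :: "'n \<Rightarrow> nat" assume "u \<in> deg_le (k j)"
        then have u: "sum u UNIV \<le> k j" by (simp add: deg_le_def)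
        have n1: "sum (n u) (- {first_index}) = sum m' (- {first_index}) + sum u (- {first_index})"
          by (simp add: n_def sum.distrib)
        have "sum (n u) (- {first_index}) < sum m (- {first_index})"
          unfolding n1 sm using u split[of u] by simp
        then have "spanned C (?T (sum (n u) UNIV)) (power_product (n u))" by (rule less)
        moreover have "sum (n u) UNIV \<le> sum m UNIV"
          unfolding split[of "n u"] split[of m] n1 sm using u split[of u] e m'1 by (simp add: n_def)
        ultimately show "spanned C (?T (sum m UNIV)) (power_product (n u))"
          by (elim spanned_mono) (use finT in auto)
      qed
      then show ?thesis
      proof (rule spanned_eq)
        fix p assume that: "p \<in> C"
        show "power_product m' p * p $ first_index ^ e * f p = (\<Sum>u\<in>deg_le (k j). c u * power_product (n u) p)"
        unfolding c[OF that] n_def power_product_add power_product_single sum_distrib_left by (simp add: mult_ac)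
      qed
    qed
    obtain \<alpha> \<beta> where ab: "spanned C (deg_le (k j)) \<alpha>" "spanned C (deg_le (k j)) \<beta>"
      "\<And>p. p \<in> C \<Longrightarrow> p $ j ^ Suc (k j) = \<alpha> p + p $ first_index * \<beta> p"
      using red[of j] by blast
    show ?thesis
    proof (rule spanned_eq)
      show "spanned C (?T (sum m UNIV)) (\<lambda>p. power_product m' p * p $ first_index ^ 0 * \<alpha> p + power_product m' p * p $ first_index ^ 1 * \<beta> p)"
        by (intro spanned_add step ab) simp_all
      fix p assume p: "p \<in> C"
      have "power_product m p = power_product m' p * p $ j ^ Suc (k j)"
        by (subst m) (simp only: power_product_add power_product_single)
      then show "power_product m p = power_product m' p * p $ first_index ^ 0 * \<alpha> p + power_product m' p * p $ first_index ^ 1 * \<beta> p"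
        unfolding ab(3)[OF p] by (simp add: algebra_simps)
    qed
  qed
qed

text \<open>
The monomials \<open>x\<^sub>1\<^sup>a x\<^sub>j\<^sup>b\<close> with \<open>a, b \<le> E\<close> reduce on \<open>C\<close> to monomials whose number grows only linearly
with \<open>E\<close>, while there are \<open>(E + 1)\<^sup>2\<close> of them; so they become linearly dependent.
\<close>

theorem coordinate_relation:
  fixes C :: "(complex ^ 'n::{finite,linorder}) set"
  assumes C: "no_infinity_point_with_x1_zero C" and j: "j \<noteq> first_index"
  shows "\<exists>P :: complex poly poly. P \<noteq> 0 \<and> (\<forall>p\<in>C. poly (poly P [:p $ j:]) (p $ first_index) = 0)"
proof -
  have "\<forall>j. \<exists>k \<alpha> \<beta>. spanned C (deg_le k) \<alpha> \<and> spanned C (deg_le k) \<beta> \<and>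
     (\<forall>p\<in>C. p $ j ^ Suc k = \<alpha> p + p $ first_index * \<beta> p)"
    using coordinate_power_reduction[OF C] by blast
  from choice[OF this] obtain k where k: "\<And>j. \<exists>\<alpha> \<beta>. spanned C (deg_le (k j)) \<alpha> \<and> spanned C (deg_le (k j)) \<beta> \<and>
     (\<forall>p\<in>C. p $ j ^ Suc (k j) = \<alpha> p + p $ first_index * \<beta> p)" by blast
  define K where "K = (\<Prod>i\<in>- {first_index}. Suc (k i))"
  \<comment> \<open>This \<open>E\<close> satisfies \<open>(2 * E + 1) * K < (E + 1)\<^sup>2\<close>.\<close>
  define E where "E = 2 * K"
  define T where "T = {m :: 'n \<Rightarrow> nat. sum m UNIV \<le> 2 * E \<and> (\<forall>j. j \<noteq> first_index \<longrightarrow> m j \<le> k j)}"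
  \<comment> \<open>Since \<open>T\<close> bounds the total degree by \<open>2 * E\<close>, it lies in a box with \<open>(2 * E + 1) * K\<close> elements.\<close>
  define box where "box = PiE (UNIV :: 'n set) (\<lambda>i. if i = first_index then {..2 * E} else {..k i})"
  have "card box = (\<Prod>i\<in>UNIV. if i = first_index then 2 * E + 1 else Suc (k i))"
    unfolding box_def by (subst card_PiE) (auto intro!: prod.cong)
  also have "\<dots> = (2 * E + 1) * K"
    unfolding K_def by (subst prod.remove[of UNIV first_index]) (auto simp: Compl_eq_Diff_UNIV intro!: prod.cong)
  finally have cbox: "card box = (2 * E + 1) * K" .
  have finbox: "finite box" unfolding box_def by (intro finite_PiE) auto
  have Tbox: "T \<subseteq> box"
  proof
    fix m assume m: "m \<in> T"
    moreover have "m first_index \<le> sum m UNIV" by (rule member_le_sum) auto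
    ultimately show "m \<in> box" by (auto simp: T_def box_def)
  qed
  have finT: "finite T" using Tbox finbox by (rule finite_subset)
  define I where "I = {..E} \<times> {..E}"
  have "card T \<le> (2 * E + 1) * K" using card_mono[OF finbox Tbox] cbox by simp
  also have "\<dots> < (E + 1) * (E + 1)" by (simp add: E_def algebra_simps)
  also have "\<dots> = card I" by (simp add: I_def card_cartesian_product)
  finally have card: "card T < card I" .
  define mm where "mm ab = (\<lambda>i. (if i = first_index then fst ab else 0) + (if i = j then snd ab else (0::nat)))" for ab :: "nat \<times> nat"
  have "\<forall>ab\<in>I. \<exists>c. \<forall>p\<in>C. power_product (mm ab) p = (\<Sum>m\<in>T. c m * power_product m p)"
  proof
    fix ab assume ab: "ab \<in> I"
    have "sum (mm ab) UNIV = fst ab + snd ab" by (simp add: mm_def sum.distrib)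
    then have le: "sum (mm ab) UNIV \<le> 2 * E" using ab by (auto simp: I_def)
    have "spanned C T (power_product (mm ab))"
      by (rule spanned_mono[OF monomial_reduction[OF k]]) (use le finT in \<open>auto simp: T_def\<close>)
    then show "\<exists>c. \<forall>p\<in>C. power_product (mm ab) p = (\<Sum>m\<in>T. c m * power_product m p)" by (simp add: spanned_def)
  qed
  from bchoice[OF this] obtain M where M: "\<And>ab p. ab \<in> I \<Longrightarrow> p \<in> C \<Longrightarrow> power_product (mm ab) p = (\<Sum>m\<in>T. M ab m * power_product m p)"
    by blast
  have finI: "finite I" by (simp add: I_def)
  obtain c where c: "\<exists>ab\<in>I. c ab \<noteq> 0" "\<And>m. m \<in> T \<Longrightarrow> (\<Sum>ab\<in>I. c ab * M ab m) = 0"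
    using homogeneous_system_nontrivial[OF finT finI card, of M] by blast
  define P where "P = (\<Sum>ab\<in>I. monom (monom (c ab) (fst ab)) (snd ab))"
  have "P \<noteq> 0"
  proof
    assume P0: "P = 0"
    obtain a b where ab: "(a, b) \<in> I" "c (a, b) \<noteq> 0" using c(1) by auto
    have "coeff (coeff P b) a = (\<Sum>ab\<in>I. if ab = (a, b) then c ab else 0)"
      unfolding P_def coeff_sum by (intro sum.cong refl) (auto simp: coeff_sum)
    also have "\<dots> = c (a, b)" using ab finI by simp
    finally show False using P0 ab by simp
  qed
  moreover have "poly (poly P [:p $ j:]) (p $ first_index) = 0" if p: "p \<in> C" for p
  proof -
    have "poly (poly P [:p $ j:]) (p $ first_index) = (\<Sum>ab\<in>I. c ab * power_product (mm ab) p)"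
      unfolding P_def mm_def power_product_add power_product_single
      by (simp add: poly_sum poly_monom poly_power mult.assoc)
    also have "\<dots> = (\<Sum>ab\<in>I. \<Sum>m\<in>T. c ab * M ab m * power_product m p)"
      by (intro sum.cong refl) (simp add: M p sum_distrib_left mult.assoc)
    also have "\<dots> = (\<Sum>m\<in>T. (\<Sum>ab\<in>I. c ab * M ab m) * power_product m p)"
      by (subst sum.swap) (simp add: sum_distrib_right)
    also have "\<dots> = 0" using c(2) by simp
    finally show ?thesis .
  qed
  ultimately show ?thesis by blast
qed

text \<open>
If \<open>x\<^sub>1(p)\<close> were small compared to \<open>p\<close> along a sequence of points \<open>p\<close> of \<open>C\<close>, a limit of the points
\<open>(p : 1)\<close>, normalized by the length of \<open>p\<close>, would be an infinity point with \<open>x\<^sub>1 = 0\<close>.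
\<close>

lemma linear_growth:
  fixes C :: "(complex ^ 'n::{finite,linorder}) set"
  assumes C: "no_infinity_point_with_x1_zero C"
  shows "\<exists>K>0. \<forall>p\<in>C. norm p \<le> K * (1 + norm (p $ first_index))"
proof (rule ccontr)
  assume no: "\<not> ?thesis"
  have "\<forall>n::nat. \<exists>p\<in>C. norm p > real (Suc n) * (1 + norm (p $ first_index))"
  proof
    fix n
    show "\<exists>p\<in>C. norm p > real (Suc n) * (1 + norm (p $ first_index))"
      using no by (metis not_le of_nat_0_less_iff zero_less_Suc)
  qed
  then obtain P where P: "\<And>n. P n \<in> C" "\<And>n. norm (P n) > real (Suc n) * (1 + norm (P n $ first_index))"
    by metis
  have big: "norm (P n) > real (Suc n)" for n
  proof -
    have "real (Suc n) * 1 \<le> real (Suc n) * (1 + norm (P n $ first_index))"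
      by (intro mult_left_mono) auto
    then show ?thesis unfolding mult_1_right using P(2)[of n] by (rule le_less_trans)
  qed
  have nz: "norm (P n) > 0" for n by (rule le_less_trans[OF _ big[of n]]) simp
  define u where "u n = P n /\<^sub>R norm (P n)" for n
  have "u n \<in> sphere 0 1" for n using nz[of n] by (simp add: u_def)
  moreover have "compact (sphere (0 :: (complex, 'n) vec) 1)" by (rule compact_sphere)
  ultimately obtain l r where l: "l \<in> sphere 0 1" and r: "strict_mono r" and lim: "(u \<circ> r) \<longlonglongrightarrow> l"
    unfolding compact_def by blast
  define s where "s n = 1 / norm (P n)" for n
  have s_le: "norm (s n) \<le> inverse (real (Suc n))" for n
    using big[of n] nz[of n] by (simp add: s_def field_simps)
  have s0: "s \<longlonglongrightarrow> 0"
    by (rule Lim_null_comparison[OF _ LIMSEQ_inverse_real_of_nat]) (rule always_eventually, rule allI, rule s_le)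
  have u1_le: "norm (u n $ first_index) \<le> inverse (real (Suc n))" for n
  proof -
    have "real (Suc n) * norm (P n $ first_index) \<le> real (Suc n) * (1 + norm (P n $ first_index))"
      by (intro mult_left_mono) auto
    also have "\<dots> \<le> norm (P n)" using P(2)[of n] by (rule less_imp_le)
    finally show ?thesis using nz[of n] by (simp add: u_def field_simps)
  qed
  have u10: "(\<lambda>n. u n $ first_index) \<longlonglongrightarrow> 0"
    by (rule Lim_null_comparison[OF _ LIMSEQ_inverse_real_of_nat]) (rule always_eventually, rule allI, rule u1_le)
  have "(\<lambda>n. (u \<circ> r) n $ first_index) \<longlonglongrightarrow> l $ first_index"
    by (rule tendsto_vec_nth[OF lim])
  moreover have "(\<lambda>n. (u \<circ> r) n $ first_index) \<longlonglongrightarrow> 0"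
    using LIMSEQ_subseq_LIMSEQ[OF u10 r] by (simp add: o_def)
  ultimately have l1: "l $ first_index = 0" by (rule LIMSEQ_unique)
  define x where "x = case_option 0 (($) l)"
  have "(\<chi> i. x i) \<in> infinity_points C"
  proof (rule infinity_pointI)
    show "x None = 0" by (simp add: x_def)
    show "x \<noteq> (\<lambda>_. 0)"
    proof
      assume x0: "x = (\<lambda>_. 0)"
      have "l $ i = 0" for i using fun_cong[OF x0, of "Some i"] by (simp add: x_def)
      then have "l = 0" by (simp add: vec_eq_iff)
      then show False using l by simp
    qed
    fix H :: "('n option, complex) mpoly"
    assume H: "homogeneous H" "\<And>p. p \<in> C \<Longrightarrow> ceval H (hom_point p) = 0"
    obtain d where d: "\<And>l x. ceval H (\<lambda>i. l * x i) = l ^ d * ceval H x"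
      using homogeneous_scale[OF H(1)] by blast
    define v where "v n i = of_real (s n) * hom_point (P n) i" for n i
    have v0: "ceval H (v n) = 0" for n unfolding v_def d using H(2)[OF P(1)] by simp
    have vlim: "(\<lambda>n. v (r n) i) \<longlonglongrightarrow> x i" for i
    proof (cases i)
      case None
      have "(\<lambda>n. complex_of_real (s (r n))) \<longlonglongrightarrow> of_real 0"
        using LIMSEQ_subseq_LIMSEQ[OF s0 r] by (intro tendsto_of_real) (simp add: o_def)
      then show ?thesis by (simp add: None v_def x_def)
    next
      case (Some j)
      have "v (r n) i = (u \<circ> r) n $ j" for n
        by (simp add: Some v_def u_def s_def scaleR_conv_of_real[where 'a = complex] inverse_eq_divide)
      then show ?thesis using tendsto_vec_nth[OF lim, of j] by (simp add: Some x_def)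
    qed
    have "(\<lambda>n. ceval H (v (r n))) \<longlonglongrightarrow> ceval H x"
      unfolding ceval_def monom_eval_def by (intro tendsto_intros vlim)
    then show "ceval H x = 0" by (simp add: v0 LIMSEQ_const_iff)
  qed
  moreover have "(\<chi> i. x i) $ Some first_index = 0" using l1 by (simp add: x_def)
  ultimately show False using C by (auto simp: no_infinity_point_with_x1_zero_def)
qed

section \<open>Holomorphic families of polynomials with simple roots\<close>

text \<open>
The setting of the covering argument: over an open set, constant degree and simple roots make the roots
the sheets of a covering. It is applied to the fibres of a plane curve over a half-plane of logarithms.
\<close>

context
  fixes p :: "complex \<Rightarrow> complex poly" and W :: "complex set" and d :: nat
  assumes W: "open W"
    and deg: "\<And>w. w \<in> W \<Longrightarrow> degree (p w) = d"
    and sqf: "\<And>w. w \<in> W \<Longrightarrow> rsquarefree (p w)"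
    and hol: "\<And>k. (\<lambda>w. coeff (p w) k) holomorphic_on W"
begin

lemma family_poly_continuous: "continuous_on W (\<lambda>w. poly (p w) y)"
proof -
  have "continuous_on W (\<lambda>w. \<Sum>k\<le>d. coeff (p w) k * y ^ k)"
    by (intro continuous_intros holomorphic_on_imp_continuous_on hol)
  then show ?thesis
    by (rule continuous_on_eq) (simp add: poly_altdef deg)
qed

lemma family_card_roots:
  assumes "w \<in> W" shows "card {y. poly (p w) y = 0} = d"
proof -
  let ?Z = "{y. poly (p w) y = 0}"
  have nz: "p w \<noteq> 0" using sqf[OF assms] by (simp add: rsquarefree_def)
  have "degree (p w) = degree (smult (lead_coeff (p w)) (\<Prod>z\<in>?Z. [:-z, 1:]))"
    using complex_poly_decompose_rsquarefree[OF sqf[OF assms]] by simp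
  also have "\<dots> = card ?Z"
    using nz by (simp add: degree_prod_eq_sum_degree)
  finally show ?thesis using deg[OF assms] by simp
qed

text \<open>
The value at \<open>y\<close> is the leading coefficient times the product of the distances from \<open>y\<close> to the roots.
\<close>

lemma family_root_bound:
  assumes "w \<in> W" and "\<And>z. poly (p w) z = 0 \<Longrightarrow> e \<le> dist z y" and "0 \<le> e"
  shows "norm (coeff (p w) d) * e ^ d \<le> norm (poly (p w) y)"
proof -
  let ?Z = "{y. poly (p w) y = 0}"
  have "poly (p w) y = poly (smult (lead_coeff (p w)) (\<Prod>z\<in>?Z. [:-z, 1:])) y"
    using complex_poly_decompose_rsquarefree[OF sqf[OF assms(1)]] by simp
  then have "norm (poly (p w) y) = norm (coeff (p w) d) * (\<Prod>z\<in>?Z. dist z y)"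
    by (simp add: poly_prod norm_mult deg[OF assms(1)] dist_norm norm_minus_commute flip: prod_norm)
  moreover have "e ^ d \<le> (\<Prod>z\<in>?Z. dist z y)"
    using prod_mono[of ?Z "\<lambda>_. e" "\<lambda>z. dist z y"] assms(2,3) family_card_roots[OF assms(1)] by simp
  ultimately show ?thesis by (simp add: mult_left_mono)
qed

lemma family_root_nearby:
  assumes "w1 \<in> W" "poly (p w1) y1 = 0" "0 < e"
  shows "\<forall>\<^sub>F w in at w1 within W. \<exists>y. poly (p w) y = 0 \<and> dist y y1 < e"
proof -
  have "continuous_on W (\<lambda>w. norm (coeff (p w) d) * e ^ d - norm (poly (p w) y1))"
    by (intro continuous_intros family_poly_continuous holomorphic_on_imp_continuous_on hol)
  then have lim: "((\<lambda>w. norm (coeff (p w) d) * e ^ d - norm (poly (p w) y1)) \<longlongrightarrow>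
      norm (coeff (p w1) d) * e ^ d - norm (poly (p w1) y1)) (at w1 within W)"
    using assms(1) by (simp add: continuous_on)
  have "coeff (p w1) d \<noteq> 0"
    using deg[OF assms(1)] sqf[OF assms(1)] by (auto simp: rsquarefree_def)
  then have "0 < norm (coeff (p w1) d) * e ^ d - norm (poly (p w1) y1)"
    using assms by simp
  from order_tendstoD(1)[OF lim this]
  have "\<forall>\<^sub>F w in at w1 within W. 0 < norm (coeff (p w) d) * e ^ d - norm (poly (p w) y1)" .
  moreover have "\<forall>\<^sub>F w in at w1 within W. w \<in> W"
    by (simp add: eventually_at_topological) (use W assms(1) in blast)
  ultimately show ?thesis
  proof eventually_elim
    case (elim w)
    show ?case
    proof (rule ccontr)
      assume "\<not> ?case"
      then have "norm (coeff (p w) d) * e ^ d \<le> norm (poly (p w) y1)"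
        using assms(3) by (intro family_root_bound[OF elim(2)]) (auto simp: not_less)
      with elim(1) show False by simp
    qed
  qed
qed

definition root_graph :: "(complex \<times> complex) set" where
  "root_graph = {(w, y). w \<in> W \<and> poly (p w) y = 0}"

text \<open>
Around each of the \<open>d\<close> roots at \<open>w1\<close> put a disc of radius \<open>\<delta>\<close>, so small that the discs are disjoint. For \<open>w\<close> near
\<open>w1\<close> every disc contains a root, and by counting exactly one; \<open>s y w\<close> is the root in the disc around \<open>y\<close>.
\<close>

lemma family_local_sections:
  assumes w1: "w1 \<in> W"
  obtains T \<delta> s where "open T" "w1 \<in> T" "T \<subseteq> W" "\<delta> > 0"
    and "\<And>y. poly (p w1) y = 0 \<Longrightarrow> continuous_on T (s y)"
    and "\<And>y w. poly (p w1) y = 0 \<Longrightarrow> w \<in> T \<Longrightarrow> poly (p w) (s y w) = 0 \<and> dist (s y w) y < \<delta>"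
    and "\<And>w z. w \<in> T \<Longrightarrow> poly (p w) z = 0 \<Longrightarrow> \<exists>y. poly (p w1) y = 0 \<and> z = s y w"
    and "\<And>y w z. poly (p w1) y = 0 \<Longrightarrow> w \<in> T \<Longrightarrow> poly (p w) z = 0 \<Longrightarrow> dist z y < \<delta> \<Longrightarrow> z = s y w"
    and "\<And>y y'. poly (p w1) y = 0 \<Longrightarrow> poly (p w1) y' = 0 \<Longrightarrow> y \<noteq> y' \<Longrightarrow> 2 * \<delta> < dist y y'"
proof -
  define Z where "Z w = {y. poly (p w) y = 0}" for w
  have finZ: "finite (Z w)" if "w \<in> W" for w
    using sqf[OF that] by (auto simp: Z_def rsquarefree_def intro: poly_roots_finite)
  have cardZ: "card (Z w) = d" if "w \<in> W" for w
    using family_card_roots[OF that] by (simp add: Z_def)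
  obtain \<delta> where \<delta>: "\<delta> > 0" "\<And>y y'. y \<in> Z w1 \<Longrightarrow> y' \<in> Z w1 \<Longrightarrow> y \<noteq> y' \<Longrightarrow> 2 * \<delta> < dist y y'"
  proof -
    define D where "D = (\<lambda>(a,b). dist a b) ` ((Z w1 \<times> Z w1) - Id)"
    have "finite D" unfolding D_def using finZ[OF w1] by auto
    moreover have "\<forall>x\<in>D. x > 0" unfolding D_def by auto
    ultimately obtain m where m: "m > 0" "\<forall>x\<in>D. m \<le> x"
      by (metis Min_gr_iff Min_le equals0D gt_ex)
    show ?thesis
      by (rule that[of "m/3"]) (use m in \<open>force simp: D_def\<close>)+
  qed
  have "\<forall>\<^sub>F w in at w1 within W. \<forall>y\<in>Z w1. \<exists>z. poly (p w) z = 0 \<and> dist z y < \<delta>"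
    using finZ[OF w1]
  proof (rule eventually_ball_finite, intro ballI)
    fix y assume "y \<in> Z w1"
    then show "\<forall>\<^sub>F w in at w1 within W. \<exists>z. poly (p w) z = 0 \<and> dist z y < \<delta>"
      by (intro family_root_nearby w1 \<delta>(1)) (simp add: Z_def)
  qed
  then have "\<forall>\<^sub>F w in at w1. \<forall>y\<in>Z w1. \<exists>z. poly (p w) z = 0 \<and> dist z y < \<delta>"
    unfolding at_within_open[OF w1 W] .
  then obtain T0 where T0: "open T0" "w1 \<in> T0"
    "\<And>w. w \<in> T0 \<Longrightarrow> w \<noteq> w1 \<Longrightarrow> \<forall>y\<in>Z w1. \<exists>z. poly (p w) z = 0 \<and> dist z y < \<delta>"
    unfolding eventually_at_topological by blast
  define T where "T = T0 \<inter> W"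
  have T: "open T" "w1 \<in> T" "T \<subseteq> W" using T0 W w1 by (auto simp: T_def)
  have "\<forall>w\<in>T. \<forall>y\<in>Z w1. \<exists>z. z \<in> Z w \<and> dist z y < \<delta>"
    using T0(3) \<delta>(1) by (fastforce simp: T_def Z_def)
  then have ex: "\<exists>z. z \<in> Z w \<and> dist z y < \<delta>" if "w \<in> T" "y \<in> Z w1" for w y
    using that by blast
  define s where "s y w = (SOME z. z \<in> Z w \<and> dist z y < \<delta>)" for y w
  have s: "s y w \<in> Z w \<and> dist (s y w) y < \<delta>" if "w \<in> T" "y \<in> Z w1" for w y
    unfolding s_def by (rule someI_ex) (rule ex[OF that])
  have inj: "inj_on (\<lambda>y. s y w) (Z w1)" if "w \<in> T" for w
  proof (rule inj_onI, rule ccontr)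
    fix y y' assume yy: "y \<in> Z w1" "y' \<in> Z w1" "s y w = s y' w" "y \<noteq> y'"
    have "dist y y' \<le> dist (s y w) y + dist (s y' w) y'"
      using dist_triangle3[of y y' "s y w"] yy(3) by simp
    with s[OF that yy(1)] s[OF that yy(2)] \<delta>(2)[OF yy(1,2,4)] show False by linarith
  qed
  have surj: "(\<lambda>y. s y w) ` Z w1 = Z w" if "w \<in> T" for w
  proof (rule card_subset_eq)
    show "finite (Z w)" using finZ that T by auto
    show "(\<lambda>y. s y w) ` Z w1 \<subseteq> Z w" using s that by auto
    show "card ((\<lambda>y. s y w) ` Z w1) = card (Z w)"
      using card_image[OF inj[OF that]] cardZ w1 that T by auto
  qed
  have uniq: "z = s y w" if y: "y \<in> Z w1" and w: "w \<in> T" and z: "z \<in> Z w" "dist z y < \<delta>" for y w z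
  proof (rule ccontr)
    assume ne: "z \<noteq> s y w"
    obtain y' where y': "y' \<in> Z w1" "z = s y' w" using surj[OF w] z(1) by blast
    then have "y \<noteq> y'" using ne by blast
    have "dist y y' \<le> dist z y + dist z y'" by (rule dist_triangle3)
    moreover have "dist z y' < \<delta>" using s[OF w y'(1)] y'(2) by simp
    ultimately show False using \<delta>(2)[OF y y'(1) \<open>y \<noteq> y'\<close>] z(2) by linarith
  qed
  have cont: "continuous_on T (s y)" if y: "y \<in> Z w1" for y
    unfolding continuous_on_def
  proof
    fix w assume w: "w \<in> T"
    show "(s y \<longlongrightarrow> s y w) (at w within T)"
    proof (rule tendstoI)
      fix e :: real assume "e > 0"
      \<comment> \<open>Small enough for a root near \<open>s y w\<close> to remain in the disc around \<open>y\<close>.\<close>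
      define e' where "e' = min e (\<delta> - dist (s y w) y)"
      have e': "e' > 0" "e' \<le> e" "e' \<le> \<delta> - dist (s y w) y"
        using \<open>e > 0\<close> s[OF w y] by (auto simp: e'_def)
      have "\<forall>\<^sub>F u in at w within W. \<exists>z. poly (p u) z = 0 \<and> dist z (s y w) < e'"
        using s[OF w y] w T e' by (intro family_root_nearby) (auto simp: Z_def)
      then have "\<forall>\<^sub>F u in at w within T. \<exists>z. poly (p u) z = 0 \<and> dist z (s y w) < e'"
        by (rule filter_leD[OF at_le[OF T(3)]])
      moreover have "\<forall>\<^sub>F u in at w within T. u \<in> T"
        by (simp add: eventually_at_topological) (use T w in blast)
      ultimately show "\<forall>\<^sub>F u in at w within T. dist (s y u) (s y w) < e"
      proof eventually_elim
        case (elim u)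
        then obtain z where z: "z \<in> Z u" "dist z (s y w) < e'" by (auto simp: Z_def)
        have "dist z y \<le> dist z (s y w) + dist (s y w) y" by (rule dist_triangle)
        then have "z = s y u" using z e' elim(2) y by (intro uniq) auto
        then show ?case using z e' by auto
      qed
    qed
  qed
  show ?thesis
  proof (rule that[of T \<delta> s])
    show "open T" "w1 \<in> T" "T \<subseteq> W" "\<delta> > 0" by fact+
    fix y assume "poly (p w1) y = 0"
    then have y: "y \<in> Z w1" by (simp add: Z_def)
    show "continuous_on T (s y)" by (rule cont[OF y])
    show "2 * \<delta> < dist y y'" if "poly (p w1) y' = 0" "y \<noteq> y'" for y'
      using \<delta>(2)[OF y _ that(2)] that(1) by (simp add: Z_def)
    fix w assume w: "w \<in> T"
    show "poly (p w) (s y w) = 0 \<and> dist (s y w) y < \<delta>" using s[OF w y] by (simp add: Z_def)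
    show "z = s y w" if "poly (p w) z = 0" "dist z y < \<delta>" for z
      by (rule uniq[OF y w _ that(2)]) (simp add: Z_def that(1))
  next
    fix w z assume "w \<in> T" "poly (p w) z = 0"
    then show "\<exists>y. poly (p w1) y = 0 \<and> z = s y w" using surj[of w] by (auto simp: Z_def)
  qed
qed

lemma root_graph_covering:
  assumes "d \<ge> 1"
  shows "covering_space root_graph fst W"
  unfolding covering_space_def
proof (intro conjI ballI)
  show "continuous_on root_graph fst" by (intro continuous_intros)
  show "fst ` root_graph = W"
  proof
    show "W \<subseteq> fst ` root_graph"
    proof
      fix w assume w: "w \<in> W"
      have "{y. poly (p w) y = 0} \<noteq> {}"
        using family_card_roots[OF w] assms by (metis card.empty not_one_le_zero)
      then show "w \<in> fst ` root_graph" using w by (force simp: root_graph_def)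
    qed
  qed (auto simp: root_graph_def)
next
  fix w1 assume w1: "w1 \<in> W"
  obtain T \<delta> s where T: "open T" "w1 \<in> T" "T \<subseteq> W" "\<delta> > 0"
    and cont: "\<And>y. poly (p w1) y = 0 \<Longrightarrow> continuous_on T (s y)"
    and s: "\<And>y w. poly (p w1) y = 0 \<Longrightarrow> w \<in> T \<Longrightarrow> poly (p w) (s y w) = 0 \<and> dist (s y w) y < \<delta>"
    and surj: "\<And>w z. w \<in> T \<Longrightarrow> poly (p w) z = 0 \<Longrightarrow> \<exists>y. poly (p w1) y = 0 \<and> z = s y w"
    and uniq: "\<And>y w z. poly (p w1) y = 0 \<Longrightarrow> w \<in> T \<Longrightarrow> poly (p w) z = 0 \<Longrightarrow> dist z y < \<delta> \<Longrightarrow> z = s y w"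
    and sep: "\<And>y y'. poly (p w1) y = 0 \<Longrightarrow> poly (p w1) y' = 0 \<Longrightarrow> y \<noteq> y' \<Longrightarrow> 2 * \<delta> < dist y y'"
    by (rule family_local_sections[OF w1], rule that, assumption+)
  define sheet where "sheet y = root_graph \<inter> (T \<times> ball y \<delta>)" for y
  define v where "v = sheet ` {y. poly (p w1) y = 0}"
  show "\<exists>T. w1 \<in> T \<and> openin (top_of_set W) T \<and>
           (\<exists>v. \<Union>v = root_graph \<inter> fst -` T \<and>
                (\<forall>u\<in>v. openin (top_of_set root_graph) u) \<and>
                pairwise disjnt v \<and> (\<forall>u\<in>v. \<exists>q. homeomorphism u T fst q))"
  proof (intro exI[of _ T] conjI exI[of _ v] ballI)
    show "w1 \<in> T" "openin (top_of_set W) T" using T by (auto intro: open_subset)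
    show "\<Union>v = root_graph \<inter> fst -` T"
    proof
      show "root_graph \<inter> fst -` T \<subseteq> \<Union>v"
      proof
        fix x assume "x \<in> root_graph \<inter> fst -` T"
        then obtain w z where x: "x = (w, z)" "w \<in> T" "poly (p w) z = 0" "x \<in> root_graph"
          by (auto simp: root_graph_def)
        obtain y where y: "poly (p w1) y = 0" "z = s y w" using surj x by blast
        then have "x \<in> sheet y" using x s[of y w] by (auto simp: sheet_def dist_commute)
        then show "x \<in> \<Union>v" using y by (auto simp: v_def)
      qed
    qed (auto simp: v_def sheet_def)
    show "openin (top_of_set root_graph) u" if "u \<in> v" for u
      using that T by (auto simp: v_def sheet_def intro!: openin_open_Int open_Times)
    show "pairwise disjnt v"
    proof (rule pairwiseI)
      fix a b assume "a \<in> v" "b \<in> v" "a \<noteq> b"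
      then obtain y y' where yy: "a = sheet y" "b = sheet y'" "poly (p w1) y = 0" "poly (p w1) y' = 0" "y \<noteq> y'"
        by (auto simp: v_def)
      have "ball y \<delta> \<inter> ball y' \<delta> = {}"
        using sep[OF yy(3,4,5)] by (intro disjoint_ballI) auto
      then show "disjnt a b" using yy by (auto simp: sheet_def disjnt_def)
    qed
    fix u assume "u \<in> v"
    then obtain y where y: "u = sheet y" "poly (p w1) y = 0" by (auto simp: v_def)
    have "homeomorphism u T fst (\<lambda>w. (w, s y w))"
    proof (rule homeomorphismI)
      show "continuous_on u fst" by (intro continuous_intros)
      show "continuous_on T (\<lambda>w. (w, s y w))" by (intro continuous_intros cont y)
      show "fst ` u \<subseteq> T" by (auto simp: y sheet_def)
      show "(\<lambda>w. (w, s y w)) ` T \<subseteq> u"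
        using s[OF y(2)] T by (auto simp: y sheet_def root_graph_def dist_commute)
      show "(fst x, s y (fst x)) = x" if "x \<in> u" for x
        using that uniq[OF y(2)] by (auto simp: y sheet_def root_graph_def dist_commute)
    qed simp
    then show "\<exists>q. homeomorphism u T fst q" by blast
  qed
qed

text \<open>
Implicit differentiation: the increment of \<open>poly (p w) (h w)\<close>, which is 0, splits into the
increment of the coefficients and the increment of \<open>h\<close>, the latter multiplied by a factor that
tends to the derivative at a simple root.
\<close>

lemma continuous_root_holomorphic:
  assumes cont: "continuous_on W h" and root: "\<And>w. w \<in> W \<Longrightarrow> poly (p w) (h w) = 0"
  shows "h holomorphic_on W"
  unfolding holomorphic_on_open[OF W]
proof
  fix w0 assume w0: "w0 \<in> W"
  define y0 where "y0 = h w0"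
  obtain D where D: "\<And>z. poly (p w0) z - poly (p w0) y0 = D z * (z - y0)"
    "isCont D y0" "D y0 = poly (pderiv (p w0)) y0"
    using CARAT_DERIV[THEN iffD1, OF poly_DERIV[of "p w0" y0]] by blast
  have D0: "D y0 \<noteq> 0"
  proof
    assume "D y0 = 0"
    with D(3) have "poly (pderiv (p w0)) y0 = 0" by simp
    moreover have "poly (p w0) y0 = 0" using root[OF w0] by (simp add: y0_def)
    ultimately show False using sqf[OF w0] rsquarefree_roots[of "p w0"] by blast
  qed
  define A where "A w = (\<Sum>k\<le>d. (coeff (p w) k - coeff (p w0) k) / (w - w0) * h w ^ k)" for w
  have hlim: "(h \<longlongrightarrow> y0) (at w0)"
    using cont w0 W unfolding y0_def by (metis at_within_open continuous_on)
  have dlim: "((\<lambda>w. (coeff (p w) k - coeff (p w0) k) / (w - w0)) \<longlongrightarrow> deriv (\<lambda>w. coeff (p w) k) w0) (at w0)" for k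
    using holomorphic_derivI[OF hol W w0, of k] by (simp add: has_field_derivative_iff)
  have "(A \<longlongrightarrow> (\<Sum>k\<le>d. deriv (\<lambda>w. coeff (p w) k) w0 * y0 ^ k)) (at w0)"
    unfolding A_def by (intro tendsto_intros dlim hlim)
  moreover have "((\<lambda>w. D (h w)) \<longlongrightarrow> D y0) (at w0)"
    using D(2) hlim by (simp add: isCont_tendsto_compose)
  ultimately have lim: "((\<lambda>w. - A w / D (h w)) \<longlongrightarrow>
      - (\<Sum>k\<le>d. deriv (\<lambda>w. coeff (p w) k) w0 * y0 ^ k) / D y0) (at w0)" (is "(_ \<longlongrightarrow> ?l) _")
    using D0 by (intro tendsto_intros)
  have "\<forall>\<^sub>F w in at w0. D (h w) \<noteq> 0"
    using \<open>((\<lambda>w. D (h w)) \<longlongrightarrow> D y0) (at w0)\<close> D0 by (rule tendsto_imp_eventually_ne)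
  moreover have "\<forall>\<^sub>F w in at w0. w \<in> W"
    using eventually_at_topological W w0 by blast
  moreover have "\<forall>\<^sub>F w in at w0. w \<noteq> w0"
    by (simp add: eventually_at_filter)
  ultimately have "\<forall>\<^sub>F w in at w0. - A w / D (h w) = (h w - h w0) / (w - w0)"
  proof eventually_elim
    case (elim w)
    have "0 = poly (p w) (h w) - poly (p w0) y0"
      using root elim w0 by (simp add: y0_def)
    also have "\<dots> = (poly (p w) (h w) - poly (p w0) (h w)) + (poly (p w0) (h w) - poly (p w0) y0)"
      by simp
    also have "poly (p w) (h w) - poly (p w0) (h w) = (w - w0) * A w"
    proof -
      have "(w - w0) * A w = (\<Sum>k\<le>d. (coeff (p w) k - coeff (p w0) k) * h w ^ k)"
        unfolding A_def sum_distrib_left using elim by (intro sum.cong) auto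
      then show ?thesis
        using elim by (simp add: poly_altdef deg w0 left_diff_distrib sum_subtractf)
    qed
    also have "poly (p w0) (h w) - poly (p w0) y0 = D (h w) * (h w - y0)" by (rule D)
    finally show ?case using elim by (simp add: field_simps y0_def add_eq_0_iff)
  qed
  then have "((\<lambda>w. (h w - h w0) / (w - w0)) \<longlongrightarrow> ?l) (at w0)"
    using lim by (rule Lim_transform_eventually[rotated])
  then show "\<exists>f'. (h has_field_derivative f') (at w0)"
    unfolding has_field_derivative_iff by blast
qed

lemma root_lift:
  assumes "simply_connected W" "w0 \<in> W" "poly (p w0) y0 = 0" "d \<ge> 1"
  obtains h where "h holomorphic_on W" "\<And>w. w \<in> W \<Longrightarrow> poly (p w) (h w) = 0" "h w0 = y0"
proof -
  obtain g where g: "continuous_on W g" "g \<in> W \<rightarrow> root_graph" "g w0 = (w0, y0)"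
    "\<And>w. w \<in> W \<Longrightarrow> fst (g w) = id w"
  proof (rule covering_space_lift_strong[of root_graph fst W "(w0, y0)" w0 W id])
    show "covering_space root_graph fst W" by (rule root_graph_covering) fact
    show "(w0, y0) \<in> root_graph" using assms by (auto simp: root_graph_def)
    show "locally path_connected W" using W by (rule open_imp_locally_path_connected)
  qed (use assms in auto)
  have root: "poly (p w) (snd (g w)) = 0" if "w \<in> W" for w
    using g(2,4) that by (force simp: root_graph_def)
  show ?thesis
  proof (rule that[of "\<lambda>w. snd (g w)"])
    show "(\<lambda>w. snd (g w)) holomorphic_on W"
      by (rule continuous_root_holomorphic[OF _ root]) (intro continuous_intros g, simp)
  qed (use g root in auto)
qed

lemma root_lift_unique:
  assumes "connected W" "w0 \<in> W" "d \<ge> 1" "h1 w0 = h2 w0" "w \<in> W"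
    "continuous_on W h1" "\<And>w. w \<in> W \<Longrightarrow> poly (p w) (h1 w) = 0"
    "continuous_on W h2" "\<And>w. w \<in> W \<Longrightarrow> poly (p w) (h2 w) = 0"
  shows "h1 w = h2 w"
proof -
  have "(\<lambda>w. (w, h1 w)) w = (\<lambda>w. (w, h2 w)) w"
    by (rule covering_space_lift_unique[OF root_graph_covering, of _ w0 _ W id])
      (use assms in \<open>auto simp: root_graph_def intro!: continuous_intros\<close>)
  then show ?thesis by simp
qed

end

section \<open>Puiseux expansions of plane curves at infinity\<close>

text \<open>
Polynomials in two variables are polynomials in \<open>y\<close> whose coefficients are polynomials in \<open>z\<close>.
\<close>

abbreviation fibre :: "complex poly poly \<Rightarrow> complex \<Rightarrow> complex poly" where
  "fibre P z \<equiv> map_poly (\<lambda>c. poly c z) P"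

lemma poly_fibre: "poly (fibre P z) y = poly (poly P [:y:]) z"
  by (induction P) (simp_all add: map_poly_pCons)

lemma pderiv_fibre: "pderiv (fibre P z) = fibre (pderiv P) z"
  by (rule poly_eqI) (simp add: coeff_pderiv coeff_map_poly)

lemma poly_bounded_below:
  fixes p :: "complex poly"
  assumes "p \<noteq> 0"
  shows "\<exists>R \<delta>. \<delta> > 0 \<and> (\<forall>z. R \<le> norm z \<longrightarrow> \<delta> \<le> norm (poly p z))"
proof (cases p)
  case (pCons a q)
  show ?thesis
  proof (cases "q = 0")
    case True
    then show ?thesis using assms pCons by (intro exI[of _ 0] exI[of _ "norm a"]) auto
  next
    case False
    from poly_infinity[OF this, of 1 a] show ?thesis
      unfolding pCons(1) by (meson zero_less_one)
  qed
qed

lemma poly_bounded_above: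
  fixes p :: "complex poly"
  shows "\<exists>K\<ge>0. \<forall>z. 1 \<le> norm z \<longrightarrow> norm (poly p z) \<le> K * norm z ^ degree p"
proof (intro exI[of _ "\<Sum>i\<le>degree p. norm (coeff p i)"] conjI allI impI)
  fix z :: complex assume z: "1 \<le> norm z"
  have "norm (poly p z) \<le> (\<Sum>i\<le>degree p. norm (coeff p i * z ^ i))"
    unfolding poly_altdef by (rule norm_sum)
  also have "\<dots> \<le> (\<Sum>i\<le>degree p. norm (coeff p i) * norm z ^ degree p)"
    using z by (intro sum_mono) (auto simp: norm_mult norm_power intro!: mult_left_mono power_increasing)
  finally show "norm (poly p z) \<le> (\<Sum>i\<le>degree p. norm (coeff p i)) * norm z ^ degree p"
    by (simp add: sum_distrib_right)
qed (auto intro: sum_nonneg)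

lemma polys_bounded_above:
  fixes c :: "nat \<Rightarrow> complex poly"
  shows "\<exists>K m. K \<ge> 0 \<and> (\<forall>z. 1 \<le> norm z \<longrightarrow> (\<Sum>k<d. norm (poly (c k) z)) \<le> K * norm z ^ m)"
proof -
  have "\<forall>k. \<exists>K\<ge>0. \<forall>z. 1 \<le> norm z \<longrightarrow> norm (poly (c k) z) \<le> K * norm z ^ degree (c k)"
    using poly_bounded_above by blast
  from choice[OF this] obtain K where K: "\<And>k. K k \<ge> 0"
    "\<And>k z. 1 \<le> norm z \<Longrightarrow> norm (poly (c k) z) \<le> K k * norm z ^ degree (c k)"
    by blast
  define m where "m = (\<Sum>k<d. degree (c k))"
  show ?thesis
  proof (intro exI[of _ "\<Sum>k<d. K k"] exI[of _ m] conjI allI impI)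
    fix z :: complex assume z: "1 \<le> norm z"
    have "(\<Sum>k<d. norm (poly (c k) z)) \<le> (\<Sum>k<d. K k * norm z ^ m)"
    proof (rule sum_mono)
      fix k assume "k \<in> {..<d}"
      then have "degree (c k) \<le> m" unfolding m_def by (intro member_le_sum) auto
      then show "norm (poly (c k) z) \<le> K k * norm z ^ m"
        using K z by (meson order_trans mult_left_mono power_increasing)
    qed
    then show "(\<Sum>k<d. norm (poly (c k) z)) \<le> (\<Sum>k<d. K k) * norm z ^ m"
      by (simp add: sum_distrib_right)
  qed (auto intro: sum_nonneg K)
qed

text \<open>
Cauchy's bound for the roots of a polynomial. Applied to fibres, it makes the roots grow at most
like a power of the parameter.
\<close>

lemma root_norm_bound:
  fixes p :: "complex poly"
  assumes "poly p y = 0" "degree p = d" "p \<noteq> 0"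
  shows "norm y \<le> 1 + (\<Sum>k<d. norm (coeff p k)) / norm (coeff p d)"
proof (cases "norm y \<le> 1")
  case False
  have lc: "norm (coeff p d) > 0" using assms by auto
  have d: "d > 0" using assms by (metis degree_eq_zeroE gr0I mult_zero_right add.right_neutral poly_pCons poly_0 pCons_0_0)
  have "coeff p d * y ^ d = - (\<Sum>k<d. coeff p k * y ^ k)"
    using assms by (simp add: poly_altdef lessThan_Suc_atMost[symmetric] add_eq_0_iff)
  then have "norm (coeff p d) * norm y ^ d \<le> (\<Sum>k<d. norm (coeff p k * y ^ k))"
    by (metis norm_minus_cancel norm_mult norm_power norm_sum)
  also have "\<dots> \<le> (\<Sum>k<d. norm (coeff p k) * norm y ^ (d - 1))"
    using False by (intro sum_mono) (auto simp: norm_mult norm_power intro!: mult_left_mono power_increasing)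
  finally have "norm (coeff p d) * norm y * norm y ^ (d - 1) \<le> (\<Sum>k<d. norm (coeff p k)) * norm y ^ (d - 1)"
    using d by (simp add: sum_distrib_right power_eq_if split: if_splits)
  then have "norm (coeff p d) * norm y \<le> (\<Sum>k<d. norm (coeff p k))"
  proof (rule mult_right_le_imp_le)
    show "0 < norm y ^ (d - 1)" using False by (intro zero_less_power) linarith
  qed
  then have "norm y \<le> (\<Sum>k<d. norm (coeff p k)) / norm (coeff p d)"
    using lc by (simp add: field_simps)
  then show ?thesis by simp
next
  case True
  have "0 \<le> (\<Sum>k<d. norm (coeff p k)) / norm (coeff p d)" by (simp add: sum_nonneg)
  with True show ?thesis by linarith
qed

text \<open>
The expansions of the roots over \<open>z = t\<^sup>-\<^sup>N\<close> near infinity. Every root has to be a value of some \<open>g\<close>, but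
the functions \<open>g\<close> may take other values as well: which tuples of them lie on a curve is decided by its equations.
\<close>

definition puiseux_roots :: "complex poly poly \<Rightarrow> nat \<Rightarrow> (complex \<Rightarrow> complex) set \<Rightarrow> bool" where
  "puiseux_roots P N G \<longleftrightarrow> finite G \<and> (\<forall>g\<in>G. g meromorphic_on {0}) \<and>
     (\<forall>\<^sub>F t in at 0. \<forall>y. poly (poly P [:y:]) (inverse t ^ N) = 0 \<longrightarrow> (\<exists>g\<in>G. y = g t))"

lemma puiseux_roots_rescale:
  assumes "puiseux_roots P N G" "m > 0"
  shows "puiseux_roots P (N * m) ((\<lambda>g t. g (t ^ m)) ` G)"
  unfolding puiseux_roots_def
proof (intro conjI)
  show "finite ((\<lambda>g t. g (t ^ m)) ` G)" using assms by (simp add: puiseux_roots_def)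
  show "\<forall>g\<in>(\<lambda>g t. g (t ^ m)) ` G. g meromorphic_on {0}"
  proof
    fix g' assume "g' \<in> (\<lambda>g t. g (t ^ m)) ` G"
    then obtain g where g: "g \<in> G" "g' = (\<lambda>t. g (t ^ m))" by auto
    have "g meromorphic_on {0}" using assms g by (simp add: puiseux_roots_def)
    then show "g' meromorphic_on {0}"
      unfolding g(2) using assms(2)
      by (intro meromorphic_on_compose[of g "{0}" "\<lambda>t. t ^ m"]) (auto intro!: analytic_intros)
  qed
  have "filterlim (\<lambda>t::complex. t ^ m) (at 0) (at 0)"
    unfolding filterlim_at
    using assms(2) by (auto simp: eventually_at_filter intro!: tendsto_eq_intros)
  moreover have "\<forall>\<^sub>F t in at 0. \<forall>y. poly (poly P [:y:]) (inverse t ^ N) = 0 \<longrightarrow> (\<exists>g\<in>G. y = g t)"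
    using assms by (simp add: puiseux_roots_def)
  ultimately have "\<forall>\<^sub>F t in at 0. \<forall>y. poly (poly P [:y:]) (inverse (t ^ m) ^ N) = 0 \<longrightarrow> (\<exists>g\<in>G. y = g (t ^ m))"
    by (rule eventually_compose_filterlim[rotated])
  then show "\<forall>\<^sub>F t in at 0. \<forall>y. poly (poly P [:y:]) (inverse t ^ (N * m)) = 0
      \<longrightarrow> (\<exists>g\<in>(\<lambda>g t. g (t ^ m)) ` G. y = g t)"
    by eventually_elim (auto simp: power_mult power_mult_distrib mult.commute[of N] power_inverse)
qed

lemma puiseux_roots_product:
  assumes "smult c P = A * B" "puiseux_roots A N G" "puiseux_roots B N H"
  shows "puiseux_roots P N (G \<union> H)"
  unfolding puiseux_roots_def
proof (intro conjI)
  have "\<forall>\<^sub>F t in at 0. \<forall>y. poly (poly A [:y:]) (inverse t ^ N) = 0 \<longrightarrow> (\<exists>g\<in>G. y = g t)"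
    "\<forall>\<^sub>F t in at 0. \<forall>y. poly (poly B [:y:]) (inverse t ^ N) = 0 \<longrightarrow> (\<exists>g\<in>H. y = g t)"
    using assms by (simp_all add: puiseux_roots_def)
  then show "\<forall>\<^sub>F t in at 0. \<forall>y. poly (poly P [:y:]) (inverse t ^ N) = 0 \<longrightarrow> (\<exists>g\<in>G \<union> H. y = g t)"
  proof eventually_elim
    case (elim t)
    show ?case
    proof (intro allI impI)
      fix y assume y: "poly (poly P [:y:]) (inverse t ^ N) = 0"
      have "poly (poly (smult c P) [:y:]) (inverse t ^ N) = 0" using y by simp
      then have "poly (poly A [:y:]) (inverse t ^ N) = 0 \<or> poly (poly B [:y:]) (inverse t ^ N) = 0"
        unfolding assms(1) by simp
      then show "\<exists>g\<in>G \<union> H. y = g t" using elim by blast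
    qed
  qed
qed (use assms in \<open>auto simp: puiseux_roots_def\<close>)

text \<open>
Take an element \<open>g\<close> of least degree in the ideal generated by \<open>P\<close> and its derivative.
If \<open>g\<close> is constant in \<open>y\<close>, it is a Bezout identity. Otherwise pseudo-division of \<open>P\<close> by \<open>g\<close> leaves no remainder,
as the remainder lies in the ideal, and \<open>P\<close> splits up to a factor from the coefficients.
\<close>

lemma separable_or_splits:
  fixes P :: "complex poly poly"
  assumes "degree P > 0"
  shows "(\<exists>u v r. u * P + v * pderiv P = [:r:] \<and> r \<noteq> 0) \<or>
    (\<exists>c A B. c \<noteq> 0 \<and> smult c P = A * B \<and> A \<noteq> 0 \<and> B \<noteq> 0 \<and> degree A < degree P \<and> degree B < degree P)"
proof -
  define I where "I = {u * P + v * pderiv P |u v. True} - {0}"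
  have P': "pderiv P \<noteq> 0" using assms by (simp add: pderiv_eq_0_iff)
  have "pderiv P = 0 * P + 1 * pderiv P" by simp
  then have P'I: "pderiv P \<in> I" using P' unfolding I_def by blast
  define g where "g = arg_min degree (\<lambda>x. x \<in> I)"
  have g: "g \<in> I" and gmin: "\<And>h. h \<in> I \<Longrightarrow> degree g \<le> degree h"
    using arg_min_nat_lemma[of "\<lambda>x. x \<in> I" _ degree] P'I by (auto simp: g_def)
  obtain u v where uv: "g = u * P + v * pderiv P" "g \<noteq> 0" using g by (auto simp: I_def)
  show ?thesis
  proof (cases "degree g = 0")
    case True
    then show ?thesis using uv by (metis degree_eq_zeroE pCons_0_0)
  next
    case False
    obtain q r where qr: "pseudo_divmod P g = (q, r)" by fastforce
    define c where "c = coeff g (degree g) ^ (Suc (degree P) - degree g)"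
    have c: "c \<noteq> 0" using uv(2) by (simp add: c_def)
    have eq: "smult c P = g * q + r" and r: "r = 0 \<or> degree r < degree g"
      using pseudo_divmod[OF uv(2) qr] by (simp_all add: c_def)
    have "r = ([:c:] - q * u) * P + (- q * v) * pderiv P"
      using eq uv(1) by (simp add: algebra_simps)
    then have "r \<in> I \<or> r = 0" unfolding I_def by blast
    with r gmin have "r = 0" by fastforce
    then have eq': "smult c P = g * q" using eq by simp
    have q: "q \<noteq> 0" using eq' c assms by auto
    have "degree P = degree g + degree q"
      using arg_cong[OF eq', of degree] c uv(2) q by (simp add: degree_mult_eq)
    moreover have "degree g < degree P"
      using gmin[OF P'I] assms by (simp add: degree_pderiv)
    ultimately have "degree g < degree P" "degree q < degree P" using False by simp_all
    then show ?thesis using eq' c uv(2) q by blast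
  qed
qed

text \<open>
The logarithms of the numbers \<open>z\<close> with \<open>\<bar>z\<bar> > R\<close>.
\<close>

definition half_plane :: "real \<Rightarrow> complex set" where
  "half_plane R = {w. Re w > ln R}"

lemma exp_Ln_periodic: "w \<noteq> 0 \<Longrightarrow> exp v = w \<Longrightarrow> \<exists>m::int. Ln w = v + 2 * of_real pi * of_int m * \<i>"
proof -
  assume "w \<noteq> 0" "exp v = w"
  then have "exp (Ln w) = exp v" by simp
  then show ?thesis by (auto simp: exp_eq mult_ac)
qed

text \<open>
The family \<open>w \<mapsto> P(exp w, -)\<close> over a half-plane, which is simply connected, in contrast to the set \<open>\<bar>z\<bar> > R\<close>.
\<close>

context
  fixes P :: "complex poly poly" and R :: real and d :: nat
  assumes R: "R \<ge> 1"
    and lc: "\<And>z. norm z > R \<Longrightarrow> degree (fibre P z) = d"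
    and sep: "\<And>z. norm z > R \<Longrightarrow> rsquarefree (fibre P z)"
    and d: "d \<ge> 1"
begin

lemma half_plane_norm: "w \<in> half_plane R \<longleftrightarrow> norm (exp w) > R"
  using R exp_less_cancel_iff[of "ln R" "Re w"] by (simp add: half_plane_def)

lemma half_plane_open: "open (half_plane R)" and half_plane_convex: "convex (half_plane R)"
  by (simp_all add: half_plane_def open_halfspace_Re_gt convex_halfspace_Re_gt)

lemma half_plane_coeff_holomorphic: "(\<lambda>w. coeff (fibre P (exp w)) k) holomorphic_on half_plane R"
  by (simp add: coeff_map_poly) (intro holomorphic_intros)

lemma exp_family_lift:
  assumes "w0 \<in> half_plane R" "poly (fibre P (exp w0)) y0 = 0"
  obtains h where "h holomorphic_on half_plane R" "\<And>w. w \<in> half_plane R \<Longrightarrow> poly (fibre P (exp w)) (h w) = 0" "h w0 = y0"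
proof (rule root_lift[of "half_plane R" "\<lambda>w. fibre P (exp w)" d w0 y0])
  show "simply_connected (half_plane R)" by (rule convex_imp_simply_connected) (rule half_plane_convex)
qed (use assms that lc sep d in \<open>auto simp: half_plane_norm intro: half_plane_open half_plane_coeff_holomorphic\<close>)

lemma exp_family_unique:
  assumes "w0 \<in> half_plane R" "w \<in> half_plane R" "h1 w0 = h2 w0"
    "continuous_on (half_plane R) h1" "\<And>w. w \<in> half_plane R \<Longrightarrow> poly (fibre P (exp w)) (h1 w) = 0"
    "continuous_on (half_plane R) h2" "\<And>w. w \<in> half_plane R \<Longrightarrow> poly (fibre P (exp w)) (h2 w) = 0"
  shows "h1 w = h2 w"
proof (rule root_lift_unique[of "half_plane R" "\<lambda>w. fibre P (exp w)" d w0 h1 h2 w])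
  show "connected (half_plane R)" by (rule convex_connected) (rule half_plane_convex)
qed (use assms lc sep d in \<open>auto simp: half_plane_norm intro: half_plane_open half_plane_coeff_holomorphic\<close>)

lemma exp_family_roots: "w \<in> half_plane R \<Longrightarrow> card {y. poly (fibre P (exp w)) y = 0} = d"
  by (rule family_card_roots[of "half_plane R" "\<lambda>w. fibre P (exp w)" d])
    (use lc sep in \<open>auto simp: half_plane_norm intro: half_plane_open half_plane_coeff_holomorphic\<close>)

lemma exp_family_finite: "w \<in> half_plane R \<Longrightarrow> finite {y. poly (fibre P (exp w)) y = 0}"
  using exp_family_roots d by (metis card.infinite not_one_le_zero)

text \<open>
A holomorphic root over the half-plane is determined by its value at one point \<open>w0\<close>, and there are \<open>d\<close> such values.
\<close>

lemma exp_family_finitely_many: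
  obtains H where "finite H"
    and "\<And>h. h \<in> H \<Longrightarrow> h holomorphic_on half_plane R"
    and "\<And>h w. h \<in> H \<Longrightarrow> w \<in> half_plane R \<Longrightarrow> poly (fibre P (exp w)) (h w) = 0"
    and "\<And>w y. w \<in> half_plane R \<Longrightarrow> poly (fibre P (exp w)) y = 0 \<Longrightarrow> \<exists>h\<in>H. h w = y"
proof -
  define w0 :: complex where "w0 = of_real (ln R + 1)"
  have w0: "w0 \<in> half_plane R" by (simp add: half_plane_def w0_def)
  define Z where "Z = {y. poly (fibre P (exp w0)) y = 0}"
  have "\<exists>h. h holomorphic_on half_plane R \<and> (\<forall>w\<in> half_plane R. poly (fibre P (exp w)) (h w) = 0) \<and> h w0 = y" if "y \<in> Z" for y
    by (rule exp_family_lift[OF w0, of y]) (use that in \<open>auto simp: Z_def\<close>)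
  then have "\<forall>y\<in>Z. \<exists>h. h holomorphic_on half_plane R \<and> (\<forall>w\<in> half_plane R. poly (fibre P (exp w)) (h w) = 0) \<and> h w0 = y" by blast
  from bchoice[OF this] obtain h where h: "\<And>y. y \<in> Z \<Longrightarrow> h y holomorphic_on half_plane R"
    "\<And>y w. y \<in> Z \<Longrightarrow> w \<in> half_plane R \<Longrightarrow> poly (fibre P (exp w)) (h y w) = 0" "\<And>y. y \<in> Z \<Longrightarrow> h y w0 = y"
    by blast
  show ?thesis
  proof (rule that[of "h ` Z"])
    show "finite (h ` Z)" using exp_family_finite[OF w0] by (simp add: Z_def)
    fix w y assume wy: "w \<in> half_plane R" "poly (fibre P (exp w)) y = 0"
    obtain f where f: "f holomorphic_on half_plane R" "\<And>w. w \<in> half_plane R \<Longrightarrow> poly (fibre P (exp w)) (f w) = 0" "f w = y"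
      by (rule exp_family_lift[OF wy], rule that, assumption+)
    have y0: "f w0 \<in> Z" using f(2)[OF w0] by (simp add: Z_def)
    have "h (f w0) w = f w"
      by (rule exp_family_unique[where ?h1.0 = "h (f w0)" and ?h2.0 = f, OF w0 wy(1)]) (use h f y0 in \<open>auto intro: holomorphic_on_imp_continuous_on\<close>)
    then show "\<exists>h\<in>h ` Z. h w = y" using f(3) y0 by auto
  qed (use h in auto)
qed

lemma half_plane_shift: "w \<in> half_plane R \<Longrightarrow> w + 2 * of_real pi * of_int k * \<i> \<in> half_plane R"
  by (simp add: half_plane_def)

lemma exp_shift: "exp (w + 2 * of_real pi * of_int k * \<i>) = exp w"
  unfolding exp_eq by (rule exI[of _ k]) simp

text \<open>
Shifting by \<open>2 \<pi> \<i>\<close> permutes the \<open>d\<close> values of roots, so among the shifts by at most \<open>d\<close> periods two agree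
at a point and therefore everywhere. Their difference divides \<open>fact d\<close>, which is thus a common period for all roots.
\<close>

lemma exp_family_periodic:
  assumes hol: "h holomorphic_on half_plane R" and root: "\<And>w. w \<in> half_plane R \<Longrightarrow> poly (fibre P (exp w)) (h w) = 0"
    and w: "w \<in> half_plane R"
  shows "h (w + 2 * of_real pi * of_int (int (fact d) * m) * \<i>) = h w"
proof -
  define s where "s k w = w + 2 * of_real pi * of_int k * \<i>" for k :: int and w
  have ss: "s k (s l w) = s (k + l) w" for k l w by (simp add: s_def algebra_simps)
  have s0: "s 0 w = w" for w by (simp add: s_def)
  have s_half_plane: "s k w \<in> half_plane R" if "w \<in> half_plane R" for k w using half_plane_shift that by (simp add: s_def)
  have sexp: "exp (s k w) = exp w" for k w using exp_shift by (simp add: s_def)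
  have contk: "continuous_on (half_plane R) (\<lambda>w. h (s k w))" for k
    by (rule continuous_on_compose2[OF holomorphic_on_imp_continuous_on[OF hol]])
      (auto simp: s_half_plane, auto simp: s_def intro!: continuous_intros)
  have rootk: "poly (fibre P (exp w)) (h (s k w)) = 0" if "w \<in> half_plane R" for k w
    using root[OF s_half_plane[OF that], of k] by (simp add: sexp)
  have "\<not> inj_on (\<lambda>k. h (s (int k) w)) {0..d}"
  proof
    assume "inj_on (\<lambda>k. h (s (int k) w)) {0..d}"
    then have "card {0..d} \<le> card {y. poly (fibre P (exp w)) y = 0}"
      by (rule card_inj_on_le) (use rootk w exp_family_finite in auto)
    then show False using exp_family_roots[OF w] by simp
  qed
  then obtain k l where kl: "k < l" "l \<le> d" "h (s (int k) w) = h (s (int l) w)"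
    unfolding inj_on_def by (metis atLeastAtMost_iff linorder_neqE_nat)
  have eq: "h (s (int k) v) = h (s (int l) v)" if "v \<in> half_plane R" for v
    by (rule exp_family_unique[where ?h1.0 = "\<lambda>v. h (s (int k) v)" and ?h2.0 = "\<lambda>v. h (s (int l) v)", OF w that kl(3)]) (use contk rootk in auto)
  define e where "e = int (l - k)"
  have per: "h (s e v) = h v" if "v \<in> half_plane R" for v
    using eq[OF s_half_plane[OF that, of "- int k"]] kl(1) by (simp add: ss s0 e_def of_nat_diff)
  have pern: "h (s (e * int n) v) = h v" if "v \<in> half_plane R" for v n
  proof (induction n)
    case (Suc n)
    have "s (e * int (Suc n)) v = s e (s (e * int n) v)" by (simp add: ss algebra_simps)
    then show ?case using per[OF s_half_plane[OF that]] Suc by simp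
  qed (simp add: s0)
  have peri: "h (s (e * n) v) = h v" if "v \<in> half_plane R" for v n
  proof (cases n)
    case (nonneg n') then show ?thesis using pern[OF that] by simp
  next
    case (neg n')
    have "h (s (e * int (Suc n')) (s (e * n) v)) = h (s (e * n) v)" by (rule pern) (rule s_half_plane[OF that])
    moreover have "s (e * int (Suc n')) (s (e * n) v) = v" unfolding ss neg
      by (metis add.commute add.left_inverse distrib_left minus_mult_right s0 add.right_inverse)
    ultimately show ?thesis by simp
  qed
  have "(l - k) dvd fact d" using kl by (intro dvd_fact) auto
  then obtain c where "fact d = (l - k) * c" ..
  then have eq: "int (fact d) * m = e * (int c * m)" by (simp add: e_def del: of_nat_fact)
  show ?thesis using peri[OF w, of "int c * m"] unfolding eq s_def .
qed

end

text \<open>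
For large \<open>z\<close> the fibres have constant degree and simple roots, by the Bezout identity. The
holomorphic roots \<open>h(w)\<close> with \<open>z = exp w\<close> have the period \<open>2 \<pi> \<i> N\<close>, so \<open>h(- N ln t)\<close> is a
well-defined holomorphic function of \<open>t \<noteq> 0\<close>. The root bound excludes an essential singularity at 0.
\<close>

lemma puiseux_roots_separable:
  fixes P :: "complex poly poly"
  assumes d: "degree P > 0" and uv: "u * P + v * pderiv P = [:r:]" "r \<noteq> 0"
  shows "\<exists>N>0. \<exists>G. puiseux_roots P N G"
proof -
  define d where "d = degree P"
  have d1: "d \<ge> 1" using assms by (simp add: d_def)
  have lc0: "coeff P d \<noteq> 0" using assms by (auto simp: d_def)
  obtain R1 \<delta> where R1: "\<delta> > 0" "\<And>z. R1 \<le> norm z \<Longrightarrow> \<delta> \<le> norm (poly (coeff P d) z)"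
    using poly_bounded_below[OF lc0] by blast
  obtain R2 \<delta>2 where R2: "\<delta>2 > 0" "\<And>z. R2 \<le> norm z \<Longrightarrow> \<delta>2 \<le> norm (poly r z)"
    using poly_bounded_below[OF uv(2)] by blast
  obtain K m where K: "K \<ge> 0" "\<And>z. 1 \<le> norm z \<Longrightarrow> (\<Sum>k<d. norm (poly (coeff P k) z)) \<le> K * norm z ^ m"
    using polys_bounded_above[where d = d and c = "coeff P"] by blast
  define R where "R = max 1 (max R1 R2)"
  have R: "R \<ge> 1" "R \<ge> R1" "R \<ge> R2" by (auto simp: R_def)
  have deg: "degree (fibre P z) = d" if "norm z > R" for z
  proof (rule antisym)
    show "degree (fibre P z) \<le> d" by (rule degree_le) (auto simp: coeff_map_poly d_def coeff_eq_0)
    have "coeff (fibre P z) d \<noteq> 0"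
      using R1(1) R1(2)[of z] R that by (auto simp: coeff_map_poly)
    then show "d \<le> degree (fibre P z)" by (rule le_degree)
  qed
  have sqf: "rsquarefree (fibre P z)" if "norm z > R" for z
    unfolding rsquarefree_roots
  proof (intro allI notI)
    fix y assume "poly (fibre P z) y = 0 \<and> poly (pderiv (fibre P z)) y = 0"
    then have "poly (poly P [:y:]) z = 0" "poly (poly (pderiv P) [:y:]) z = 0"
      by (simp_all add: pderiv_fibre poly_fibre)
    then have "poly (poly (u * P + v * pderiv P) [:y:]) z = 0" by simp
    then have "poly r z = 0" unfolding uv(1) by simp
    then show False using R2(1) R2(2)[of z] R that by auto
  qed
  obtain H where H: "finite H"
    and Hhol: "\<And>h. h \<in> H \<Longrightarrow> h holomorphic_on half_plane R"
    and Hroot: "\<And>h w. h \<in> H \<Longrightarrow> w \<in> half_plane R \<Longrightarrow> poly (fibre P (exp w)) (h w) = 0"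
    and Hall: "\<And>w y. w \<in> half_plane R \<Longrightarrow> poly (fibre P (exp w)) y = 0 \<Longrightarrow> \<exists>h\<in>H. h w = y"
    by (rule exp_family_finitely_many[OF R(1) deg sqf d1]) (assumption, assumption, rule that, assumption+)
  define N :: nat where "N = fact d"
  have N: "N > 0" by (simp add: N_def)
  have per: "h (w + 2 * of_real pi * of_int (int N * k) * \<i>) = h w" if "h \<in> H" "w \<in> half_plane R" for h w k
    unfolding N_def using that Hhol Hroot deg sqf d1 R(1) by (intro exp_family_periodic) auto
  have half_plane_iff: "w \<in> half_plane R \<longleftrightarrow> norm (exp w) > R" for w by (rule half_plane_norm[OF R(1) deg sqf d1])
  \<comment> \<open>The condition \<open>\<bar>t\<bar> < \<epsilon>\<close> means that \<open>z = t\<^sup>-\<^sup>N\<close> satisfies \<open>\<bar>z\<bar> > R\<close>.\<close>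
  define \<epsilon> where "\<epsilon> = exp (- (ln R / N))"
  have \<epsilon>: "\<epsilon> > 0" "\<epsilon> \<le> 1" using R(1) N by (auto simp: \<epsilon>_def)
  define D where "D = ball 0 \<epsilon> - {0 :: complex}"
  have D_half_plane: "- of_nat N * v \<in> half_plane R" if "norm (exp v) < \<epsilon>" for v :: complex
  proof -
    have "Re v < - (ln R / N)" using that by (simp add: \<epsilon>_def)
    then have "ln R < - (real N * Re v)" using N by (simp add: field_simps)
    then show ?thesis by (simp add: half_plane_def)
  qed
  define descend where "descend h t = (h (- of_nat N * Ln t) :: complex)" for h :: "complex \<Rightarrow> complex" and t
  have descend_exp: "descend h (exp v) = h (- of_nat N * v)" if "h \<in> H" "norm (exp v) < \<epsilon>" for h v
  proof -
    obtain k :: int where k: "Ln (exp v) = v + 2 * of_real pi * of_int k * \<i>"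
      using exp_Ln_periodic[of "exp v" v] by auto
    have "descend h (exp v) = h (- of_nat N * v + 2 * of_real pi * of_int (int N * (- k)) * \<i>)"
      unfolding descend_def k by (simp add: algebra_simps)
    also have "\<dots> = h (- of_nat N * v)" by (rule per[OF that(1) D_half_plane[OF that(2)]])
    finally show ?thesis .
  qed
  have descend_hol: "descend h holomorphic_on D" if h: "h \<in> H" for h
  proof -
    have "descend h field_differentiable at t0" if t0: "t0 \<in> D" for t0
    proof -
      have t00: "t0 \<noteq> 0" and "norm t0 < \<epsilon>" using t0 by (auto simp: D_def)
      define v0 where "v0 = Ln t0"
      have v0: "exp v0 = t0" using t00 by (simp add: v0_def)
      \<comment> \<open>Near \<open>t0\<close> the logarithm \<open>v0 + Ln (t / t0)\<close> of \<open>t\<close> is holomorphic, also when \<open>t0\<close> lies on the cut of \<open>Ln\<close>.\<close>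
      define U where "U = D \<inter> {t. t / t0 \<notin> \<real>\<^sub>\<le>\<^sub>0}"
      have "open {t. t / t0 \<in> - \<real>\<^sub>\<le>\<^sub>0}"
        using open_vimage[of "- \<real>\<^sub>\<le>\<^sub>0" "\<lambda>t. t / t0"] t00 closed_nonpos_Reals_complex
        by (simp add: vimage_def open_closed[symmetric] closed_def continuous_on_divide)
      then have "open U" unfolding U_def D_def by (intro open_Int open_Diff) auto
      then have U: "open U" "t0 \<in> U" using t0 t00 by (auto simp: U_def D_def)
      have eq: "descend h t = h (- of_nat N * (v0 + Ln (t / t0)))" if "t \<in> U" for t
      proof -
        have "t = exp (v0 + Ln (t / t0))" using that t00 by (auto simp: U_def D_def exp_add v0)
        moreover have "norm t < \<epsilon>" using that by (simp add: U_def D_def)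
        ultimately show ?thesis using descend_exp[OF h, of "v0 + Ln (t / t0)"] by simp
      qed
      have "(\<lambda>t. h (- of_nat N * (v0 + Ln (t / t0)))) holomorphic_on U"
      proof (rule holomorphic_on_compose_gen[of "\<lambda>t. - of_nat N * (v0 + Ln (t / t0))" U h "half_plane R", unfolded o_def])
        show "(\<lambda>t. - of_nat N * (v0 + Ln (t / t0))) holomorphic_on U"
          using t00 by (intro holomorphic_intros) (auto simp: U_def)
        show "h holomorphic_on half_plane R" by (rule Hhol[OF h])
        show "(\<lambda>t. - of_nat N * (v0 + Ln (t / t0))) ` U \<subseteq> half_plane R"
        proof
          fix w assume "w \<in> (\<lambda>t. - of_nat N * (v0 + Ln (t / t0))) ` U"
          then obtain t where t: "t \<in> U" "w = - of_nat N * (v0 + Ln (t / t0))" by auto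
          have "exp (v0 + Ln (t / t0)) = t" using t t00 by (auto simp: U_def D_def exp_add v0)
          then show "w \<in> half_plane R" unfolding t(2) by (intro D_half_plane) (use t in \<open>simp add: U_def D_def\<close>)
        qed
      qed
      then have "descend h holomorphic_on U" using eq by (simp cong: holomorphic_cong)
      then show ?thesis using U by (simp add: holomorphic_on_imp_differentiable_at)
    qed
    then show ?thesis by (simp add: holomorphic_on_def field_differentiable_at_within)
  qed
  have descend_root: "poly (poly P [:descend h t:]) (inverse t ^ N) = 0" "norm (inverse t ^ N) > R"
    if h: "h \<in> H" and t: "t \<in> D" for h t
  proof -
    have t0: "t \<noteq> 0" "norm t < \<epsilon>" using t by (auto simp: D_def)
    have w: "- of_nat N * Ln t \<in> half_plane R" using D_half_plane[of "Ln t"] t0 by simp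
    have e: "exp (- of_nat N * Ln t) = inverse t ^ N"
      using t0 by (simp add: exp_minus exp_of_nat_mult power_inverse)
    show "poly (poly P [:descend h t:]) (inverse t ^ N) = 0"
      using Hroot[OF h w] unfolding e poly_fibre by (simp add: descend_def)
    show "norm (inverse t ^ N) > R" using w unfolding half_plane_iff e .
  qed
  have descend_mero: "descend h meromorphic_on {0}" if h: "h \<in> H" for h
  proof -
    have bound: "norm (t ^ (N * m) * descend h t) \<le> 1 + K / \<delta>" if t: "t \<in> D" for t
    proof -
      define z where "z = inverse t ^ N"
      have t0: "t \<noteq> 0" "norm t < 1" using t \<epsilon> by (auto simp: D_def)
      have z: "norm z > R" "norm z \<ge> 1" using descend_root(2)[OF h t] R(1) by (auto simp: z_def)
      have "poly (fibre P z) (descend h t) = 0" using descend_root(1)[OF h t] by (simp add: poly_fibre z_def)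
      moreover have "fibre P z \<noteq> 0" using sqf[OF z(1)] by (auto simp: rsquarefree_def)
      ultimately have "norm (descend h t) \<le> 1 + (\<Sum>k<d. norm (coeff (fibre P z) k)) / norm (coeff (fibre P z) d)"
        using deg[OF z(1)] by (intro root_norm_bound)
      also have "\<dots> \<le> 1 + (K * norm z ^ m) / \<delta>"
        using K(2)[OF z(2)] R1(1) R1(2)[of z] z(1) R K(1)
        by (intro add_left_mono frac_le) (auto simp: coeff_map_poly sum_nonneg)
      also have "\<dots> \<le> norm z ^ m + (K * norm z ^ m) / \<delta>"
        using z(2) by (intro add_right_mono one_le_power)
      also have "\<dots> = (1 + K / \<delta>) * norm z ^ m" by (simp add: field_simps)
      finally have "norm t ^ (N * m) * norm (descend h t) \<le> norm t ^ (N * m) * ((1 + K / \<delta>) * norm z ^ m)"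
        by (rule mult_left_mono) simp
      also have "\<dots> = (1 + K / \<delta>) * (norm t ^ (N * m) * norm z ^ m)" by simp
      also have "norm t ^ (N * m) * norm z ^ m = 1"
        using t0 by (simp add: z_def norm_power norm_inverse power_mult power_inverse flip: power_mult_distrib)
      finally show ?thesis by (simp add: norm_mult norm_power)
    qed
    have ex: "\<exists>B. \<forall>\<^sub>F t in at 0. norm (t ^ (N * m) * descend h t) \<le> B"
    proof (intro exI[of _ "1 + K / \<delta>"])
      have "\<forall>\<^sub>F t in at 0. t \<in> ball 0 \<epsilon> - {0 :: complex}"
        using \<epsilon> by (intro eventually_at_in_open) auto
      then show "\<forall>\<^sub>F t in at 0. norm (t ^ (N * m) * descend h t) \<le> 1 + K / \<delta>"
        by eventually_elim (rule bound, simp add: D_def)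
    qed
    have "(\<lambda>t. t ^ (N * m) * descend h t) holomorphic_on ball 0 \<epsilon> - {0}"
      using descend_hol[OF h] unfolding D_def by (intro holomorphic_intros)
    then obtain g where g: "g holomorphic_on ball 0 \<epsilon>"
      "\<And>t. t \<in> ball 0 \<epsilon> - {0} \<Longrightarrow> g t = t ^ (N * m) * descend h t"
      using holomorphic_on_extend_bounded[of "\<lambda>t. t ^ (N * m) * descend h t" "ball 0 \<epsilon>" 0] ex \<epsilon>
      by auto
    have "g analytic_on {0}" unfolding analytic_at
      by (intro exI[of _ "ball 0 \<epsilon>"]) (use g(1) \<epsilon> in auto)
    then have "(\<lambda>t. g t / t ^ (N * m)) meromorphic_on {0}"
      by (intro meromorphic_intros analytic_on_imp_meromorphic_on)
    moreover have "\<forall>\<^sub>F t in at 0. descend h t = g t / t ^ (N * m)"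
    proof -
      have "\<forall>\<^sub>F t in at 0. t \<in> ball 0 \<epsilon> - {0 :: complex}"
        using \<epsilon> by (intro eventually_at_in_open) auto
      then show ?thesis by eventually_elim (simp add: g(2))
    qed
    ultimately show ?thesis by (subst meromorphic_on_cong) auto
  qed
  have "puiseux_roots P N (descend ` H)"
    unfolding puiseux_roots_def
  proof (intro conjI)
    show "finite (descend ` H)" using H by simp
    show "\<forall>g\<in>descend ` H. g meromorphic_on {0}" using descend_mero by auto
    have "\<forall>\<^sub>F t in at 0. t \<in> ball 0 \<epsilon> - {0 :: complex}"
      using \<epsilon> by (intro eventually_at_in_open) auto
    then show "\<forall>\<^sub>F t in at 0. \<forall>y. poly (poly P [:y:]) (inverse t ^ N) = 0 \<longrightarrow> (\<exists>g\<in>descend ` H. y = g t)"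
    proof eventually_elim
      case (elim t)
      then have t0: "t \<noteq> 0" "norm t < \<epsilon>" by auto
      have w: "- of_nat N * Ln t \<in> half_plane R" using D_half_plane[of "Ln t"] t0 by simp
      have e: "exp (- of_nat N * Ln t) = inverse t ^ N"
        using t0 by (simp add: exp_minus exp_of_nat_mult power_inverse)
      show ?case
      proof (intro allI impI)
        fix y assume "poly (poly P [:y:]) (inverse t ^ N) = 0"
        then have "poly (fibre P (exp (- of_nat N * Ln t))) y = 0" unfolding e poly_fibre .
        from Hall[OF w this] show "\<exists>g\<in>descend ` H. y = g t" by (auto simp: descend_def)
      qed
    qed
  qed
  then show ?thesis using N by blast
qed

text \<open>
Puiseux's theorem at infinity, by induction on the degree in \<open>y\<close>. When \<open>P\<close> splits, the two ramification indices
are replaced by their product.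
\<close>

theorem puiseux_roots_exist:
  fixes P :: "complex poly poly"
  assumes "P \<noteq> 0"
  shows "\<exists>N>0. \<exists>G. puiseux_roots P N G"
  using assms
proof (induction "degree P" arbitrary: P rule: less_induct)
  case less
  consider "degree P = 0" | "degree P > 0" "\<exists>u v r. u * P + v * pderiv P = [:r:] \<and> r \<noteq> 0"
    | c A B where "smult c P = A * B" "A \<noteq> 0" "B \<noteq> 0" "degree A < degree P" "degree B < degree P"
    using separable_or_splits[of P] by blast
  then show ?case
  proof cases
    case 1
    then obtain a where P: "P = [:a:]" "a \<noteq> 0" using less.prems by (metis degree_eq_zeroE pCons_0_0)
    obtain R \<delta> where R: "\<delta> > 0" "\<And>z. R \<le> norm z \<Longrightarrow> \<delta> \<le> norm (poly a z)"
      using poly_bounded_below[OF P(2)] by blast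
    have "filterlim (\<lambda>t::complex. inverse t) at_infinity (at 0)" by (rule filterlim_inverse_at_infinity)
    then have "\<forall>\<^sub>F t in at (0::complex). R \<le> norm (inverse t)"
      unfolding filterlim_at_infinity_conv_norm_at_top filterlim_at_top by blast
    then have "puiseux_roots P 1 {}"
      unfolding puiseux_roots_def
    proof (intro conjI, goal_cases)
      case 3
      then show ?case
      proof eventually_elim
        case (elim t)
        then show ?case using R(1) R(2)[of "inverse t"] by (auto simp: P(1))
      qed
    qed auto
    then show ?thesis by (intro exI[of _ 1]) auto
  next
    case 2
    then show ?thesis using puiseux_roots_separable by blast
  next
    case 3
    obtain N G where G: "N > 0" "puiseux_roots A N G" using less.hyps[OF 3(4,2)] by blast
    obtain M H where H: "M > 0" "puiseux_roots B M H" using less.hyps[OF 3(5,3)] by blast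
    have "puiseux_roots P (N * M) ((\<lambda>g t. g (t ^ M)) ` G \<union> (\<lambda>g t. g (t ^ N)) ` H)"
      using puiseux_roots_rescale[OF G(2) H(1)] puiseux_roots_rescale[OF H(2) G(1)]
      by (intro puiseux_roots_product[OF 3(1)]) (simp_all add: mult.commute)
    then show ?thesis using G(1) H(1) by (metis nat_0_less_mult_iff)
  qed
qed

section \<open>Common ramification and homogenization\<close>

lemma ramification_index_props:
  assumes "puiseux_series a"
  shows "ramification_index a > 0" and "a q \<noteq> 0 \<Longrightarrow> of_nat (ramification_index a) * q \<in> \<int>"
proof -
  let ?P = "\<lambda>K. K > 0 \<and> (\<forall>q. a q \<noteq> 0 \<longrightarrow> of_nat K * q \<in> \<int>)"
  have "\<exists>K. ?P K" using assms unfolding puiseux_series_def by blast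
  then have "?P (LEAST K. ?P K)" by (rule LeastI_ex)
  then show "ramification_index a > 0" "a q \<noteq> 0 \<Longrightarrow> of_nat (ramification_index a) * q \<in> \<int>"
    unfolding ramification_index_def by blast+
qed

text \<open>
The multipliers that clear all denominators are closed under remainders, so the least one divides all others.
\<close>

lemma ramification_index_dvd:
  assumes "puiseux_series a" "\<And>q. a q \<noteq> 0 \<Longrightarrow> of_nat K * q \<in> \<int>"
  shows "ramification_index a dvd K"
proof (rule ccontr)
  define r where "r = ramification_index a"
  have r: "r > 0" "\<And>q. a q \<noteq> 0 \<Longrightarrow> of_nat r * q \<in> \<int>"
    using ramification_index_props[OF assms(1)] by (auto simp: r_def)
  assume "\<not> ramification_index a dvd K"
  then have pos: "K mod r > 0" by (simp add: r_def dvd_eq_mod_eq_0)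
  have "of_nat (K mod r) * q \<in> \<int>" if "a q \<noteq> 0" for q
  proof -
    have "rat_of_nat K = of_nat (K div r) * of_nat r + of_nat (K mod r)"
      by (metis div_mult_mod_eq of_nat_add of_nat_mult)
    then have "of_nat (K mod r) * q = of_nat K * q - of_nat (K div r) * (of_nat r * q)"
      by (simp add: algebra_simps)
    also have "\<dots> \<in> \<int>" by (rule Ints_diff[OF assms(2)[OF that] Ints_mult[OF Ints_of_nat r(2)[OF that]]])
    finally show ?thesis .
  qed
  with pos have "(LEAST K. K > 0 \<and> (\<forall>q. a q \<noteq> 0 \<longrightarrow> of_nat K * q \<in> \<int>)) \<le> K mod r"
    by (intro Least_le) blast
  then have "r \<le> K mod r" unfolding r_def ramification_index_def .
  with r(1) show False by (meson mod_less_divisor not_le)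
qed

lemma common_ramification_props:
  fixes \<phi> :: "'n::finite \<Rightarrow> rat \<Rightarrow> complex"
  assumes "\<And>j. puiseux_series (\<phi> j)"
  shows common_ramification_pos: "common_ramification \<phi> > 0"
    and common_ramification_int: "\<phi> j q \<noteq> 0 \<Longrightarrow> of_nat (common_ramification \<phi>) * q \<in> \<int>"
    and common_ramification_dvd: "(\<And>j q. \<phi> j q \<noteq> 0 \<Longrightarrow> of_nat K * q \<in> \<int>) \<Longrightarrow> common_ramification \<phi> dvd K"
proof -
  have fin: "finite (ramification_index ` range \<phi>)" by simp
  show "common_ramification \<phi> > 0"
    unfolding common_ramification_def using ramification_index_props(1)[OF assms]
    by (metis (no_types, lifting) Lcm_0_iff[OF fin] image_iff neq0_conv less_irrefl)
  show "of_nat (common_ramification \<phi>) * q \<in> \<int>" if "\<phi> j q \<noteq> 0"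
  proof -
    have "ramification_index (\<phi> j) dvd common_ramification \<phi>"
      unfolding common_ramification_def by (intro dvd_Lcm) auto
    then obtain c where c: "common_ramification \<phi> = ramification_index (\<phi> j) * c" ..
    have "of_nat (common_ramification \<phi>) * q = of_nat c * (of_nat (ramification_index (\<phi> j)) * q)"
      by (simp add: c)
    also have "\<dots> \<in> \<int>" by (rule Ints_mult[OF Ints_of_nat ramification_index_props(2)[OF assms that]])
    finally show ?thesis .
  qed
  show "common_ramification \<phi> dvd K" if "\<And>j q. \<phi> j q \<noteq> 0 \<Longrightarrow> of_nat K * q \<in> \<int>"
    unfolding common_ramification_def
    by (rule Lcm_least) (use ramification_index_dvd[OF assms] that in auto)
qed

text \<open>
With the finer denominator \<open>L\<close> only the exponents divisible by \<open>m\<close> carry nonzero coefficients, so both sides have the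
same nonzero terms.
\<close>

lemma sums_refine_ramification:
  fixes \<phi> :: "'n::finite \<Rightarrow> rat \<Rightarrow> complex"
  assumes \<phi>: "\<And>j. puiseux_series (\<phi> j)" and L: "L = common_ramification \<phi> * m" "m > 0"
  shows "(\<lambda>k. \<phi> j (of_nat k / of_nat (common_ramification \<phi>)) * (u ^ m) ^ k) sums s \<longleftrightarrow>
         (\<lambda>k. \<phi> j (of_nat k / of_nat L) * u ^ k) sums s"
proof -
  let ?N = "common_ramification \<phi>" and ?f = "\<lambda>k. \<phi> j (of_nat k / of_nat L) * u ^ k"
  have N: "?N > 0" by (rule common_ramification_pos[OF \<phi>])
  have "(\<lambda>k. ?f (m * k)) sums s \<longleftrightarrow> ?f sums s"
  proof (rule sums_mono_reindex)
    show "strict_mono (\<lambda>k. m * k)" using L(2) by (simp add: strict_mono_def)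
    fix n assume n: "n \<notin> range (\<lambda>k. m * k)"
    show "?f n = 0"
    proof (rule ccontr)
      assume "?f n \<noteq> 0"
      then have "of_nat ?N * (of_nat n / rat_of_nat L) \<in> \<int>"
        by (intro common_ramification_int[OF \<phi>]) auto
      also have "of_nat ?N * (of_nat n / rat_of_nat L) = of_nat n / of_nat m"
        using N L by (simp add: field_simps)
      finally obtain i :: int where i: "rat_of_nat n / of_nat m = of_int i" by (auto elim: Ints_cases)
      then have "rat_of_nat n = of_int i * of_nat m" using L(2) by (simp add: field_simps)
      then have "of_int (int n) = (of_int (i * int m) :: rat)" by simp
      then have "int n = i * int m" by (simp only: of_int_eq_iff)
      then have "int m dvd int n" by simp
      then have "m dvd n" by simp
      with n show False by (auto elim: dvdE)
    qed
  qed
  moreover have "?f (m * k) = \<phi> j (of_nat k / of_nat ?N) * (u ^ m) ^ k" for k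
    using L N by (simp add: power_mult)
  ultimately show ?thesis by simp
qed

text \<open>
A leaf is a power series in \<open>exp (- Ln z / L)\<close>, a fixed branch of \<open>z\<close> to the power \<open>- 1 / L\<close>. The
denominator \<open>L\<close> may be any multiple of the ramification; \<open>e\<close> is then an \<open>m\<close>-th root of the conjugating root
of unity \<open>c\<close>. This makes series with different ramification comparable.
\<close>

lemma leaf_sums:
  fixes \<phi> :: "'n::finite \<Rightarrow> rat \<Rightarrow> complex"
  assumes \<phi>: "\<And>j. puiseux_series (\<phi> j)" and L: "L = common_ramification \<phi> * m" "m > 0" and z: "z \<noteq> 0"
    and e: "e ^ m = c"
  shows "leaf_term \<phi> c j z sums (z * s) \<longleftrightarrow> (\<lambda>k. \<phi> j (of_nat k / of_nat L) * (e * exp (- Ln z / of_nat L)) ^ k) sums s"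
proof -
  let ?N = "common_ramification \<phi>"
  have N: "?N > 0" by (rule common_ramification_pos[OF \<phi>])
  define v where "v = c * exp (- Ln z / of_nat ?N)"
  have v: "(e * exp (- Ln z / of_nat L)) ^ m = v"
  proof -
    have "exp (- Ln z / of_nat L) ^ m = exp (of_nat m * (- Ln z / of_nat L))" by (rule exp_of_nat_mult[symmetric])
    also have "of_nat m * (- Ln z / of_nat L) = - Ln z / of_nat ?N" using L N by (simp add: field_simps)
    finally show ?thesis by (simp add: power_mult_distrib e v_def)
  qed
  have t: "leaf_term \<phi> c j z k = z * (\<phi> j (of_nat k / of_nat ?N) * v ^ k)" for k
  proof -
    have "z powr (1 - of_nat k / of_nat ?N) = exp (Ln z + of_nat k * (- Ln z / of_nat ?N))"
      using z by (simp add: powr_def algebra_simps)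
    also have "\<dots> = z * exp (- Ln z / of_nat ?N) ^ k"
      unfolding exp_add exp_of_nat_mult using z by simp
    finally show ?thesis by (simp add: leaf_term_def Let_def v_def power_mult_distrib)
  qed
  have "leaf_term \<phi> c j z sums (z * s) \<longleftrightarrow> (\<lambda>k. \<phi> j (of_nat k / of_nat ?N) * v ^ k) sums s"
    unfolding t using z by (simp add: sums_mult_iff)
  also have "\<dots> \<longleftrightarrow> (\<lambda>k. \<phi> j (of_nat k / of_nat L) * (e * exp (- Ln z / of_nat L)) ^ k) sums s"
    unfolding v[symmetric] by (rule sums_refine_ramification[OF \<phi> L])
  finally show ?thesis .
qed

lemma homogenize_eval:
  fixes f :: "('n::finite, real) mpoly"
  assumes h: "h 0 = 0"
  shows "mpoly_eval h (homogenize f) (case_option x0 x) =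
    (\<Sum>m\<in>Poly_Mapping.keys f. h (Poly_Mapping.lookup f m) *
       (x0 ^ (total_degree f - monom_degree m) * (\<Prod>i\<in>UNIV. x i ^ Poly_Mapping.lookup m i)))"
proof -
  let ?d = "total_degree f" and ?K = "Poly_Mapping.keys f"
  let ?hm = "homogenize_monom ?d :: ('n \<Rightarrow>\<^sub>0 nat) \<Rightarrow> _"
  have lk: "Poly_Mapping.lookup (?hm m) = case_option (?d - monom_degree m) (Poly_Mapping.lookup m)" for m :: "'n \<Rightarrow>\<^sub>0 nat"
    by (simp add: homogenize_monom.rep_eq monom_degree_def)
  have inj: "inj ?hm"
  proof (rule injI)
    fix m n :: "'n \<Rightarrow>\<^sub>0 nat" assume "?hm m = ?hm n"
    then have "Poly_Mapping.lookup (?hm m) (Some i) = Poly_Mapping.lookup (?hm n) (Some i)" for i by simp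
    then show "m = n" by (intro poly_mapping_eqI) (simp add: lk)
  qed
  have lh: "Poly_Mapping.lookup (homogenize f) (?hm m) = Poly_Mapping.lookup f m" if "m \<in> ?K" for m
  proof -
    have "Poly_Mapping.lookup (homogenize f) (?hm m) = (\<Sum>n\<in>?K. if n = m then Poly_Mapping.lookup f n else 0)"
      unfolding homogenize_def lookup_sum by (intro sum.cong) (auto simp: lookup_single when_def inj_eq[OF inj])
    then show ?thesis using that by simp
  qed
  have sub: "Poly_Mapping.keys (homogenize f) \<subseteq> ?hm ` ?K"
  proof (rule subsetI, rule ccontr)
    fix M assume M: "M \<in> Poly_Mapping.keys (homogenize f)" "M \<notin> ?hm ` ?K"
    have "Poly_Mapping.lookup (homogenize f) M = 0"
      unfolding homogenize_def lookup_sum using M(2) by (intro sum.neutral) (auto simp: lookup_single when_def)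
    with M(1) show False by (simp add: in_keys_iff)
  qed
  have split: "(UNIV :: 'n option set) = insert None (range Some)" by (rule UNIV_option_conv)
  have "mpoly_eval h (homogenize f) (case_option x0 x) = (\<Sum>M\<in>?hm ` ?K.
      h (Poly_Mapping.lookup (homogenize f) M) * (\<Prod>i\<in>UNIV. case_option x0 x i ^ Poly_Mapping.lookup M i))"
    unfolding mpoly_eval_def using sub h by (intro sum.mono_neutral_left) (auto simp: in_keys_iff)
  also have "\<dots> = (\<Sum>m\<in>?K. h (Poly_Mapping.lookup (homogenize f) (?hm m)) * (\<Prod>i\<in>UNIV. case_option x0 x i ^ Poly_Mapping.lookup (?hm m) i))"
    using inj by (subst sum.reindex) (auto intro: inj_on_subset)
  also have "\<dots> = (\<Sum>m\<in>?K. h (Poly_Mapping.lookup f m) *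
       (x0 ^ (total_degree f - monom_degree m) * (\<Prod>i\<in>UNIV. x i ^ Poly_Mapping.lookup m i)))"
    by (intro sum.cong refl) (simp add: lh lk split prod.reindex)
  finally show ?thesis .
qed

text \<open>
For \<open>t = 1 / z\<close> this translates the affine equations at a point into the homogenized equations
for its Puiseux parametrization.
\<close>

lemma homogenize_eval_scaled:
  fixes f :: "('n::finite, real) mpoly" and x :: "'n \<Rightarrow> complex"
  shows "mpoly_eval of_real (homogenize f) (case_option t (\<lambda>j. t * x j)) = t ^ total_degree f * mpoly_eval of_real f x"
proof -
  have "monom_degree m \<le> total_degree f" if "m \<in> Poly_Mapping.keys f" for m
    using that unfolding total_degree_def by (intro Max_ge) auto
  then show ?thesis
    by (subst homogenize_eval)
      (auto simp: mpoly_eval_def sum_distrib_left power_mult_distrib prod.distrib monom_degree_def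
        simp flip: power_sum mult.assoc power_add intro!: sum.cong)
qed

lemma mpoly_eval_fps_expansion:
  fixes f :: "('v::finite, real) mpoly" and x :: "'v \<Rightarrow> complex \<Rightarrow> complex"
  assumes "\<And>i. x i has_fps_expansion A i"
  shows "(\<lambda>s. mpoly_eval of_real f (\<lambda>i. x i s)) has_fps_expansion mpoly_eval (\<lambda>c. fps_const (of_real c)) f A"
  unfolding mpoly_eval_def
  by (intro has_fps_expansion_sum has_fps_expansion_mult has_fps_expansion_const has_fps_expansion_prod
      has_fps_expansion_power assms)

lemma mpoly_eval_meromorphic:
  fixes f :: "('v::finite, real) mpoly"
  assumes "\<And>i. g i meromorphic_on A"
  shows "(\<lambda>s. mpoly_eval of_real f (\<lambda>i. g i s)) meromorphic_on A"
  unfolding mpoly_eval_def by (intro meromorphic_intros assms)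

section \<open>Existence of the infinity branches\<close>

lemma nth_root_exists:
  fixes c :: complex
  assumes "m > 0"
  obtains e where "e ^ m = c"
proof (cases "c = 0")
  case False
  have "exp (Ln c / of_nat m) ^ m = c"
    unfolding exp_of_nat_mult[symmetric] using assms False by simp
  then show ?thesis by (rule that)
qed (use assms in \<open>auto intro: that[of 0]\<close>)

lemma power_exp_Ln:
  assumes "z \<noteq> 0" "N > 0"
  shows "exp (- Ln z / of_nat N) ^ N = inverse z"
proof -
  have "of_nat N * (- Ln z / of_nat N) = - Ln z" using assms by simp
  then show ?thesis unfolding exp_of_nat_mult[symmetric] using assms by (simp add: exp_minus)
qed

text \<open>
The parameter \<open>t = exp (- Ln z / N)\<close>, a solution of \<open>t\<^sup>-\<^sup>N = z\<close>, is small when \<open>z\<close> is large.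
\<close>

lemma norm_exp_Ln_less:
  assumes N: "N > 0" and \<epsilon>: "\<epsilon> > 0" and z: "norm z > exp (- real N * ln \<epsilon>)"
  shows "z \<noteq> 0" and "norm (exp (- Ln z / of_nat N)) < \<epsilon>"
proof -
  have pos: "norm z > 0" by (rule less_trans[OF exp_gt_zero z])
  then show z0: "z \<noteq> 0" by simp
  have "exp (- real N * ln \<epsilon>) < exp (ln (norm z))" using z pos by simp
  then have "- real N * ln \<epsilon> < ln (norm z)" by (rule exp_less_cancel)
  then have "- ln (norm z) / real N < ln \<epsilon>" using N by (simp add: field_simps)
  then have "exp (- ln (norm z) / real N) < exp (ln \<epsilon>)" by (rule exp_less_mono)
  then show "norm (exp (- Ln z / of_nat N)) < \<epsilon>" using z0 \<epsilon> by simp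
qed

text \<open>
A tuple of meromorphic germs that parametrizes points of the curve by \<open>x\<^sub>1 = t\<^sup>-\<^sup>N\<close> is an infinity branch. By linear
growth the functions \<open>t\<^sup>N \<gamma>\<^sub>j(t)\<close> are bounded, hence holomorphic at 0; their Taylor coefficients are the
Puiseux series. The homogenized equations hold for the power series because they hold for
their values, and the infinity point is the limit of the points of the curve. The chosen \<open>N\<close> is
a multiple of the common ramification, so a conjugate by \<open>c\<close> corresponds to the parameter \<open>e t\<close> with \<open>e\<^sup>m = c\<close>.
\<close>

lemma branch_of_germ:
  fixes F :: "('n::{finite,linorder}, real) mpoly set" and \<gamma> :: "'n \<Rightarrow> complex \<Rightarrow> complex"
  assumes C: "no_infinity_point_with_x1_zero (zero_locus F)" and N: "N > 0"
    and mero: "\<And>j. \<gamma> j meromorphic_on {0}" and first: "\<gamma> first_index = (\<lambda>t. inverse t ^ N)"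
    and inC: "\<forall>\<^sub>F t in at 0. (\<chi> j. \<gamma> j t) \<in> zero_locus F"
  shows "\<exists>B. infinity_branch F B \<and>
    (\<forall>z. norm z > snd B \<longrightarrow> leaf_point (fst B) 1 z = (\<chi> j. \<gamma> j (exp (- Ln z / of_nat N))))"
proof -
  let ?C = "zero_locus F" and ?pt = "\<lambda>t. (\<chi> j. \<gamma> j t)"
  obtain K where K: "K > 0" "\<And>p. p \<in> ?C \<Longrightarrow> norm p \<le> K * (1 + norm (p $ first_index))"
    using linear_growth[OF C] by blast
  have "\<forall>\<^sub>F t in at 0. \<forall>j. \<gamma> j analytic_on {t}"
  proof (rule eventually_all_finite)
    fix j
    have "isolated_singularity_at (\<gamma> j) 0" using mero[of j] by (simp add: meromorphic_at_iff)
    then obtain r where r: "r > 0" "\<gamma> j analytic_on ball 0 r - {0}" by (auto simp: isolated_singularity_at_def)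
    have "\<forall>\<^sub>F t in at 0. t \<in> ball 0 r - {0 :: complex}" using r by (intro eventually_at_in_open) auto
    then show "\<forall>\<^sub>F t in at 0. \<gamma> j analytic_on {t}"
      by eventually_elim (use r(2) in \<open>auto elim: analytic_on_subset\<close>)
  qed
  with inC have "\<forall>\<^sub>F t in at 0. ?pt t \<in> ?C \<and> (\<forall>j. \<gamma> j analytic_on {t})" by eventually_elim simp
  then obtain r where r: "r > 0"
    "\<And>t. t \<noteq> 0 \<Longrightarrow> dist t 0 < r \<Longrightarrow> ?pt t \<in> ?C \<and> (\<forall>j. \<gamma> j analytic_on {t})"
    unfolding eventually_at by blast
  define \<epsilon> where "\<epsilon> = min 1 r"
  have \<epsilon>: "\<epsilon> > 0" "\<epsilon> \<le> 1" using r by (auto simp: \<epsilon>_def)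
  have pC: "?pt t \<in> ?C" and an: "\<gamma> j analytic_on {t}" if "t \<noteq> 0" "norm t < \<epsilon>" for t j
    using r(2)[of t] that by (auto simp: \<epsilon>_def)
  have bound: "norm (t ^ N * \<gamma> j t) \<le> 2 * K" if t: "t \<noteq> 0" "norm t < \<epsilon>" for t j
  proof -
    have "norm (\<gamma> j t) \<le> norm (?pt t)" using Finite_Cartesian_Product.norm_nth_le[of "?pt t" j] by simp
    also have "\<dots> \<le> K * (1 + norm (inverse t ^ N))" using K(2)[OF pC[OF t]] by (simp add: first)
    finally have "norm t ^ N * norm (\<gamma> j t) \<le> norm t ^ N * (K * (1 + norm (inverse t ^ N)))"
      by (rule mult_left_mono) simp
    also have "\<dots> = K * (norm t ^ N + 1)" 
    proof -
      have "norm (inverse t ^ N) = inverse (norm t ^ N)" by (simp add: norm_power norm_inverse power_inverse)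
      then show ?thesis using t by (simp add: algebra_simps)
    qed
    also have "\<dots> \<le> K * (1 + 1)"
      using K(1) t \<epsilon> by (intro mult_left_mono add_right_mono power_le_one) auto
    finally show ?thesis by (simp add: norm_mult norm_power)
  qed
  have "\<exists>\<psi>. \<psi> holomorphic_on ball 0 \<epsilon> \<and> (\<forall>t\<in>ball 0 \<epsilon> - {0}. \<psi> t = t ^ N * \<gamma> j t)" for j
  proof -
    have "\<gamma> j holomorphic_on ball 0 \<epsilon> - {0}"
      by (rule analytic_imp_holomorphic, subst analytic_on_analytic_at) (auto intro: an)
    then have hol: "(\<lambda>t. t ^ N * \<gamma> j t) holomorphic_on ball 0 \<epsilon> - {0}" by (intro holomorphic_intros)
    have "\<forall>\<^sub>F t in at 0. t \<in> ball 0 \<epsilon> - {0 :: complex}" using \<epsilon> by (intro eventually_at_in_open) auto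
    then have "\<forall>\<^sub>F t in at 0. norm (t ^ N * \<gamma> j t) \<le> 2 * K"
      by eventually_elim (rule bound, auto)
    then show ?thesis
      using holomorphic_on_extend_bounded[OF hol] \<epsilon> by auto
  qed
  then have "\<forall>j. \<exists>\<psi>. \<psi> holomorphic_on ball 0 \<epsilon> \<and> (\<forall>t\<in>ball 0 \<epsilon> - {0}. \<psi> t = t ^ N * \<gamma> j t)" by blast
  from choice[OF this] obtain \<psi>0 where "\<forall>j. \<psi>0 j holomorphic_on ball 0 \<epsilon> \<and> (\<forall>t\<in>ball 0 \<epsilon> - {0}. \<psi>0 j t = t ^ N * \<gamma> j t)" ..
  then have \<psi>0: "\<And>j. \<psi>0 j holomorphic_on ball 0 \<epsilon>"
    "\<And>j t. t \<noteq> 0 \<Longrightarrow> norm t < \<epsilon> \<Longrightarrow> \<psi>0 j t = t ^ N * \<gamma> j t"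
    by auto
  \<comment> \<open>The extension of the first component is 1 also at 0, as a Puiseux solution requires.\<close>
  define \<psi> where "\<psi> j = (if j = first_index then (\<lambda>_. 1) else \<psi>0 j)" for j
  have \<psi>_hol: "\<psi> j holomorphic_on ball 0 \<epsilon>" for j using \<psi>0(1) by (simp add: \<psi>_def)
  have \<psi>_eq: "\<psi> j t = t ^ N * \<gamma> j t" if "t \<noteq> 0" "norm t < \<epsilon>" for j t
    using \<psi>0(2)[OF that] that by (auto simp: \<psi>_def first power_inverse)
  define a where "a j k = (deriv ^^ k) (\<psi> j) 0 / fact k" for j k
  have a_sums: "(\<lambda>k. a j k * t ^ k) sums \<psi> j t" if "norm t < \<epsilon>" for j t
    using holomorphic_power_series[OF \<psi>_hol, of t j] that by (simp add: a_def)
  have a_first: "a first_index k = (if k = 0 then 1 else 0)" for k by (simp add: a_def \<psi>_def)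
  have a0: "a j 0 = \<psi> j 0" for j by (simp add: a_def)
  define \<phi> :: "'n \<Rightarrow> rat \<Rightarrow> complex" where
    "\<phi> j q = (if q \<ge> 0 \<and> of_nat N * q \<in> \<int> then a j (nat \<lfloor>of_nat N * q\<rfloor>) else 0)" for j q
  have \<phi>_nat: "\<phi> j (of_nat k / of_nat N) = a j k" for j k using N by (simp add: \<phi>_def)
  have \<phi>0: "\<phi> j 0 = \<psi> j 0" for j using \<phi>_nat[of j 0] a0 by simp
  have ps: "puiseux_series (\<phi> j)" for j
    unfolding puiseux_series_def using N by (intro exI[of _ N]) (auto simp: \<phi>_def split: if_splits)
  define N0 where "N0 = common_ramification \<phi>"
  have N0: "N0 > 0" unfolding N0_def by (rule common_ramification_pos[OF ps])
  have "N0 dvd N" unfolding N0_def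
    by (rule common_ramification_dvd[OF ps]) (auto simp: \<phi>_def split: if_splits)
  then obtain m where m: "N = N0 * m" ..
  have m0: "m > 0" using m N by simp
  have \<phi>_first: "\<phi> first_index = (\<lambda>q. if q = 0 then 1 else 0)"
  proof
    fix q
    show "\<phi> first_index q = (if q = 0 then 1 else 0)"
    proof (cases "q > 0 \<and> of_nat N * q \<in> \<int>")
      case True
      then obtain i :: int where i: "of_nat N * q = of_int i" by (auto elim: Ints_cases)
      moreover have "of_nat N * q > 0" using True N by simp
      ultimately have "i > 0" by simp
      then show ?thesis using True i by (simp add: \<phi>_def a_first)
    next
      case False
      then show ?thesis by (auto simp: \<phi>_def a_first)
    qed
  qed
  define M where "M = exp (- real N * ln \<epsilon>)"
  have M: "M > 0" by (simp add: M_def)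
  have leaf: "leaf_term \<phi> c j z sums \<gamma> j (e * exp (- Ln z / of_nat N))"
    and leafC: "?pt (e * exp (- Ln z / of_nat N)) \<in> ?C"
    if z: "norm z > M" and e: "e ^ m = c" and c: "c ^ N0 = 1" for c e z j
  proof -
    have z0: "z \<noteq> 0" using z M by auto
    define t where "t = e * exp (- Ln z / of_nat N)"
    have eN: "e ^ N = 1" using e c by (simp add: m mult.commute[of N0] power_mult)
    then have "norm e ^ N = 1" by (metis norm_power norm_one)
    then have ne: "norm e = 1" using N power_eq_imp_eq_base[of "norm e" N 1] by simp
    have tn: "norm t < \<epsilon>"
      using norm_exp_Ln_less(2)[OF N \<epsilon>(1)] z ne by (simp add: t_def M_def norm_mult)
    have t0: "t \<noteq> 0" using ne by (auto simp: t_def)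
    have tN: "t ^ N = inverse z" using eN power_exp_Ln[OF z0 N] by (simp add: t_def power_mult_distrib)
    have "(\<lambda>k. \<phi> j (of_nat k / of_nat N) * t ^ k) sums \<psi> j t"
      using a_sums[OF tn] by (simp add: \<phi>_nat)
    then have "leaf_term \<phi> c j z sums (z * \<psi> j t)"
      unfolding t_def using leaf_sums[OF ps m[unfolded N0_def] m0 z0 e] by blast
    then show "leaf_term \<phi> c j z sums \<gamma> j (e * exp (- Ln z / of_nat N))"
      unfolding t_def[symmetric] \<psi>_eq[OF t0 tn] tN using z0 by (simp add: mult.assoc[symmetric])
    show "?pt (e * exp (- Ln z / of_nat N)) \<in> ?C" using pC[OF t0 tn] by (simp add: t_def)
  qed
  have leafpt: "leaf_point \<phi> c z = ?pt (e * exp (- Ln z / of_nat N))"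
    if "norm z > M" "e ^ m = c" "c ^ N0 = 1" for c e z
    unfolding leaf_point_def using sums_unique[OF leaf[OF that]] by (simp add: vec_eq_iff)
  have inf: "(\<chi> i. case i of None \<Rightarrow> 0 | Some j \<Rightarrow> \<phi> j 0) \<in> infinity_points ?C"
  proof (rule infinity_pointI)
    show "case_option 0 (\<lambda>j. \<phi> j 0) \<noteq> (\<lambda>_. 0)"
      by (rule notI, drule fun_cong[of _ _ "Some first_index"]) (simp add: \<phi>_first)
    fix H :: "('n option, complex) mpoly"
    assume H: "homogeneous H" "\<And>p. p \<in> ?C \<Longrightarrow> ceval H (hom_point p) = 0"
    obtain d where d: "\<And>l x. ceval H (\<lambda>i. l * x i) = l ^ d * ceval H x"
      using homogeneous_scale[OF H(1)] by blast
    define v where "v t i = t ^ N * hom_point (?pt t) i" for t i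
    have "\<forall>\<^sub>F t in at 0. t \<in> ball 0 \<epsilon> - {0 :: complex}" using \<epsilon> by (intro eventually_at_in_open) auto
    then have near: "\<forall>\<^sub>F t in at (0 :: complex). t \<noteq> 0 \<and> norm t < \<epsilon>" by eventually_elim auto
    have vlim: "((\<lambda>t. v t i) \<longlongrightarrow> (case i of None \<Rightarrow> 0 | Some j \<Rightarrow> \<phi> j 0)) (at 0)" for i
    proof (cases i)
      case None
      then show ?thesis using N by (auto simp: v_def intro!: tendsto_eq_intros)
    next
      case (Some j)
      have "continuous_on (ball 0 \<epsilon>) (\<psi> j)" by (rule holomorphic_on_imp_continuous_on[OF \<psi>_hol])
      then have "(\<psi> j \<longlongrightarrow> \<psi> j 0) (at 0)"
        using \<epsilon> by (metis at_within_open centre_in_ball continuous_on open_ball)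
      moreover have "\<forall>\<^sub>F t in at 0. \<psi> j t = v t i"
        using near by eventually_elim (simp add: v_def Some \<psi>_eq)
      ultimately have "((\<lambda>t. v t i) \<longlongrightarrow> \<psi> j 0) (at 0)" by (rule Lim_transform_eventually)
      then show ?thesis by (simp add: Some \<phi>0)
    qed
    have "((\<lambda>t. ceval H (v t)) \<longlongrightarrow> ceval H (case_option 0 (\<lambda>j. \<phi> j 0))) (at 0)"
      unfolding ceval_def monom_eval_def by (intro tendsto_intros vlim)
    moreover have "\<forall>\<^sub>F t in at 0. ceval H (v t) = 0"
      using near by eventually_elim (unfold v_def d, use H(2) pC in simp)
    then have "((\<lambda>t. ceval H (v t)) \<longlongrightarrow> 0) (at 0)" by (rule tendsto_eventually)
    ultimately show "ceval H (case_option 0 (\<lambda>j. \<phi> j 0)) = 0"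
      by (intro tendsto_unique[of "at (0::complex)"]) auto
  qed simp
  have fps_sums: "(\<lambda>k. fps_nth (puiseux_fps N0 (\<phi> j)) k * (t ^ m) ^ k) sums \<psi> j t" if "norm t < \<epsilon>" for j t
  proof -
    have "(\<lambda>k. \<phi> j (of_nat k / of_nat N) * t ^ k) sums \<psi> j t"
      using a_sums[OF that] by (simp add: \<phi>_nat)
    then show ?thesis
      using sums_refine_ramification[OF ps m[unfolded N0_def] m0, of j t "\<psi> j t"]
      by (simp add: puiseux_fps_def N0_def)
  qed
  have fps_exp: "eval_fps (puiseux_fps N0 (\<phi> j)) has_fps_expansion puiseux_fps N0 (\<phi> j)" for j
  proof -
    let ?A = "puiseux_fps N0 (\<phi> j)"
    define t :: complex where "t = of_real (\<epsilon> / 2)"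
    have t: "norm t < \<epsilon>" "t \<noteq> 0" using \<epsilon> by (auto simp: t_def)
    have "summable (\<lambda>k. fps_nth ?A k * (t ^ m) ^ k)" using fps_sums[OF t(1)] by (rule sums_summable)
    then have "norm (t ^ m) \<le> conv_radius (fps_nth ?A)" by (rule conv_radius_geI)
    moreover have "0 < ereal (norm (t ^ m))" using t by simp
    ultimately have "fps_conv_radius ?A > 0" unfolding fps_conv_radius_def by (rule less_le_trans[rotated])
    then show ?thesis by (simp add: has_fps_expansion_def)
  qed
  have fps_eq: "mpoly_eval (\<lambda>c. fps_const (of_real c)) (homogenize f)
      (case_option (fps_X ^ N0) (\<lambda>j. puiseux_fps N0 (\<phi> j))) = 0" (is "?X = 0") if f: "f \<in> F" for f
  proof -
    define E where "E s = mpoly_eval of_real (homogenize f)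
      (\<lambda>i. case_option (\<lambda>s. s ^ N0) (\<lambda>j. eval_fps (puiseux_fps N0 (\<phi> j))) i s)" for s :: complex
    have E: "E has_fps_expansion ?X"
      unfolding E_def
    proof (rule mpoly_eval_fps_expansion)
      show "case_option (\<lambda>s. s ^ N0) (\<lambda>j. eval_fps (puiseux_fps N0 (\<phi> j))) i has_fps_expansion
        case_option (fps_X ^ N0) (\<lambda>j. puiseux_fps N0 (\<phi> j)) i" for i
        by (cases i) (auto intro: fps_exp has_fps_expansion_fps_X_power)
    qed
    have zero: "E s = 0" if s: "s \<noteq> 0" "norm s < \<epsilon> ^ m" for s
    proof -
      obtain t where t: "t ^ m = s" by (rule nth_root_exists[OF m0])
      have "norm t ^ m < \<epsilon> ^ m" using s t by (simp add: norm_power[symmetric])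
      then have tn: "norm t < \<epsilon>" by (rule power_less_imp_less_base) (use \<epsilon> in simp)
      have t0: "t \<noteq> 0" using s t m0 by (auto simp: zero_power)
      have "eval_fps (puiseux_fps N0 (\<phi> j)) s = t ^ N * \<gamma> j t" for j
        using sums_unique[OF fps_sums[OF tn, of j]] \<psi>_eq[OF t0 tn, of j] t by (simp add: eval_fps_def)
      moreover have "s ^ N0 = t ^ N" by (simp add: t[symmetric] m mult.commute[of N0] power_mult)
      ultimately have "(\<lambda>i. case_option (\<lambda>s. s ^ N0) (\<lambda>j. eval_fps (puiseux_fps N0 (\<phi> j))) i s) =
          case_option (t ^ N) (\<lambda>j. t ^ N * \<gamma> j t)" by (auto split: option.split)
      then have "E s = (t ^ N) ^ total_degree f * mpoly_eval of_real f (\<lambda>j. \<gamma> j t)"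
        unfolding E_def by (simp only: homogenize_eval_scaled)
      also have "mpoly_eval of_real f (\<lambda>j. \<gamma> j t) = 0"
      proof -
        have "($) (?pt t) = (\<lambda>j. \<gamma> j t)" by (rule ext) simp
        then show ?thesis using pC[OF t0 tn] f by (auto simp: zero_locus_def)
      qed
      finally show ?thesis by simp
    qed
    have ev: "\<forall>\<^sub>F s in at 0. E s = 0"
    proof -
      have "\<forall>\<^sub>F s in at 0. s \<in> ball 0 (\<epsilon> ^ m) - {0 :: complex}" using \<epsilon> by (intro eventually_at_in_open) auto
      then show ?thesis by eventually_elim (rule zero, auto)
    qed
    have "isCont E 0" using has_fps_expansion_imp_continuous[OF E, of UNIV] by simp
    then have "E 0 = 0"
      using tendsto_unique[OF _ _ tendsto_eventually[OF ev]] by (simp add: isCont_def)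
    with ev have "\<forall>\<^sub>F s in nhds 0. E s = 0" by (auto simp: eventually_nhds_conv_at)
    then have "E has_fps_expansion 0" by (simp add: has_fps_expansion_0_iff)
    with E show ?thesis by (rule fps_expansion_unique_complex)
  qed
  have sol: "puiseux_solution F \<phi>"
    unfolding puiseux_solution_def Let_def N0_def[symmetric]
    using \<phi>_first ps inf fps_eq by blast
  have "infinity_branch F (\<phi>, M)"
    unfolding infinity_branch_def fst_conv snd_conv
  proof (intro conjI ballI allI impI sol M)
    show "summable (leaf_term \<phi> c j z)" if c: "c \<in> conjugation_roots \<phi>" and z: "norm z > M" for c j z
    proof -
      obtain e where e: "e ^ m = c" by (rule nth_root_exists[OF m0])
      show ?thesis
        using leaf[OF z e, of j] c by (intro sums_summable) (auto simp: conjugation_roots_def N0_def)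
    qed
    show "branch_points (\<phi>, M) \<subseteq> ?C"
    proof
      fix p assume "p \<in> branch_points (\<phi>, M)"
      then obtain c z where c: "c ^ N0 = 1" and z: "norm z > M" and p: "p = leaf_point \<phi> c z"
        by (auto simp: branch_points_def leaf_def conjugation_roots_def N0_def)
      obtain e where e: "e ^ m = c" by (rule nth_root_exists[OF m0])
      show "p \<in> ?C" unfolding p leafpt[OF z e c] by (rule leafC[OF z e c])
    qed
  qed
  moreover have "leaf_point \<phi> 1 z = ?pt (exp (- Ln z / of_nat N))" if "norm z > M" for z
    using leafpt[OF that, of 1 1] by simp
  ultimately show ?thesis by (intro exI[of _ "(\<phi>, M)"]) simp
qed

text \<open>
Puiseux's theorem for each coordinate leaves finitely many tuples \<open>\<gamma>\<close> of germs. A defining polynomial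
evaluated along \<open>\<gamma>\<close> is meromorphic, so near 0 it vanishes identically or at no \<open>t \<noteq> 0\<close>. Tuples on which all equations vanish,
called good, give branches; the others do not meet the curve near infinity. Only leaves of the root of unity 1 occur,
because the tuples give all points over \<open>z\<close> already at the parameter \<open>t = exp (- Ln z / N)\<close>.
\<close>

theorem finitely_many_branches_cover:
  fixes F :: "('n::{finite,linorder}, real) mpoly set"
  assumes F: "finite F" and C: "no_infinity_point_with_x1_zero (zero_locus F)"
  shows "\<exists>\<B> R. finite \<B> \<and> (\<forall>B\<in>\<B>. infinity_branch F B) \<and>
    (\<forall>p\<in>zero_locus F. norm p > R \<longrightarrow>
       (\<exists>B\<in>\<B>. norm (p $ first_index) > snd B \<and> p = leaf_point (fst B) 1 (p $ first_index)))"
proof -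
  let ?C = "zero_locus F"
  have "\<forall>j. \<exists>N P G. N > 0 \<and> (j \<noteq> first_index \<longrightarrow> puiseux_roots P N G \<and>
      (\<forall>p\<in>?C. poly (poly P [:p $ j:]) (p $ first_index) = 0))"
  proof
    fix j :: 'n
    show "\<exists>N P G. N > 0 \<and> (j \<noteq> first_index \<longrightarrow> puiseux_roots P N G \<and>
      (\<forall>p\<in>?C. poly (poly P [:p $ j:]) (p $ first_index) = 0))"
    proof (cases "j = first_index")
      case False
      obtain P :: "complex poly poly" where P: "P \<noteq> 0" "\<forall>p\<in>?C. poly (poly P [:p $ j:]) (p $ first_index) = 0"
        using coordinate_relation[OF C False] by blast
      obtain N G where "N > 0" "puiseux_roots P N G" using puiseux_roots_exist[OF P(1)] by blast
      with P(2) show ?thesis by blast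
    qed auto
  qed
  then obtain N0 P G0 where N0: "\<And>j. N0 j > 0"
    and G0: "\<And>j. j \<noteq> first_index \<Longrightarrow> puiseux_roots (P j) (N0 j) (G0 j)"
    and P: "\<And>j p. j \<noteq> first_index \<Longrightarrow> p \<in> ?C \<Longrightarrow> poly (poly (P j) [:p $ j:]) (p $ first_index) = 0"
    by metis
  define N where "N = (\<Prod>j\<in>UNIV. N0 j)"
  have N: "N > 0" unfolding N_def using N0 by (intro prod_pos) auto
  define m where "m j = (\<Prod>i\<in>UNIV - {j}. N0 i)" for j
  have m: "m j > 0" for j unfolding m_def using N0 by (intro prod_pos) auto
  have Nm: "N = N0 j * m j" for j unfolding N_def m_def by (rule prod.remove) auto
  define G where "G j = (if j = first_index then {\<lambda>t. inverse t ^ N} else (\<lambda>g t. g (t ^ m j)) ` G0 j)" for j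
  have G: "puiseux_roots (P j) N (G j)" if "j \<noteq> first_index" for j
    using puiseux_roots_rescale[OF G0[OF that] m[of j]] that by (simp add: G_def Nm[of j, symmetric])
  have finG: "finite (G j)" and meroG: "\<And>g. g \<in> G j \<Longrightarrow> g meromorphic_on {0}" for j
    by (cases "j = first_index"; use G[of j] in \<open>auto simp: G_def puiseux_roots_def intro!: meromorphic_intros\<close>)+
  define \<Gamma> where "\<Gamma> = PiE UNIV G"
  have fin: "finite \<Gamma>" unfolding \<Gamma>_def by (intro finite_PiE finG) simp
  have mero: "\<gamma> j meromorphic_on {0}" if "\<gamma> \<in> \<Gamma>" for \<gamma> j
    using that meroG[of "\<gamma> j" j] by (auto simp: \<Gamma>_def)
  have first: "\<gamma> first_index = (\<lambda>t. inverse t ^ N)" if "\<gamma> \<in> \<Gamma>" for \<gamma>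
    using that PiE_mem[of \<gamma> UNIV G first_index] by (simp add: \<Gamma>_def G_def)
  define good where "good \<gamma> \<longleftrightarrow> (\<forall>f\<in>F. \<forall>\<^sub>F t in at 0. mpoly_eval of_real f (\<lambda>j. \<gamma> j t) = 0)"
    for \<gamma> :: "'n \<Rightarrow> complex \<Rightarrow> complex"
  have in_C: "(\<chi> j. \<gamma> j t) \<in> ?C \<longleftrightarrow> (\<forall>f\<in>F. mpoly_eval of_real f (\<lambda>j. \<gamma> j t) = 0)" for \<gamma> t
  proof -
    have "($) (\<chi> j. \<gamma> j t) = (\<lambda>j. \<gamma> j t)" by (rule ext) simp
    then show ?thesis by (simp add: zero_locus_def)
  qed
  have goodC: "\<forall>\<^sub>F t in at 0. (\<chi> j. \<gamma> j t) \<in> ?C" if "good \<gamma>" for \<gamma>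
    unfolding in_C using that F by (simp add: good_def eventually_ball_finite_distrib)
  have badC: "\<forall>\<^sub>F t in at 0. (\<chi> j. \<gamma> j t) \<notin> ?C" if \<gamma>: "\<gamma> \<in> \<Gamma>" and "\<not> good \<gamma>" for \<gamma>
  proof -
    obtain f where f: "f \<in> F" "\<not> (\<forall>\<^sub>F t in at 0. mpoly_eval of_real f (\<lambda>j. \<gamma> j t) = 0)"
      using \<open>\<not> good \<gamma>\<close> by (auto simp: good_def)
    have "(\<lambda>t. mpoly_eval of_real f (\<lambda>j. \<gamma> j t)) meromorphic_on {0}"
      by (intro mpoly_eval_meromorphic mero \<gamma>)
    then have "\<not> (\<exists>\<^sub>F t in at 0. mpoly_eval of_real f (\<lambda>j. \<gamma> j t) = 0)"
      using f(2) not_essential_frequently_0_imp_eventually_0 unfolding meromorphic_at_iff by blast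
    then show ?thesis
      unfolding not_frequently by eventually_elim (use f(1) in \<open>auto simp: in_C\<close>)
  qed
  have "\<forall>\<^sub>F t in at 0. \<forall>\<gamma>\<in>\<Gamma>. \<not> good \<gamma> \<longrightarrow> (\<chi> j. \<gamma> j t) \<notin> ?C"
    using fin badC by (intro eventually_ball_finite) auto
  moreover have "\<forall>\<^sub>F t in at 0. \<forall>j. j \<noteq> first_index \<longrightarrow>
      (\<forall>y. poly (poly (P j) [:y:]) (inverse t ^ N) = 0 \<longrightarrow> (\<exists>g\<in>G j. y = g t))"
  proof (rule eventually_all_finite)
    show "\<forall>\<^sub>F t in at 0. j \<noteq> first_index \<longrightarrow>
      (\<forall>y. poly (poly (P j) [:y:]) (inverse t ^ N) = 0 \<longrightarrow> (\<exists>g\<in>G j. y = g t))" for j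
      using G[of j] by (cases "j = first_index") (auto simp: puiseux_roots_def)
  qed
  ultimately have "\<forall>\<^sub>F t in at 0. \<forall>p\<in>?C. p $ first_index = inverse t ^ N \<longrightarrow> (\<exists>\<gamma>\<in>\<Gamma>. good \<gamma> \<and> p = (\<chi> j. \<gamma> j t))"
  proof eventually_elim
    case (elim t)
    show ?case
    proof (intro ballI impI)
      fix p assume p: "p \<in> ?C" "p $ first_index = inverse t ^ N"
      have "\<exists>g\<in>G j. p $ j = g t" for j
      proof (cases "j = first_index")
        case False
        have "poly (poly (P j) [:p $ j:]) (inverse t ^ N) = 0" using P[OF False p(1)] p(2) by simp
        then show ?thesis using elim(2) False by blast
      qed (use p(2) in \<open>simp add: G_def\<close>)
      then obtain \<gamma> where \<gamma>: "\<And>j. \<gamma> j \<in> G j" "\<And>j. p $ j = \<gamma> j t" by metis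
      have 1: "\<gamma> \<in> \<Gamma>" using \<gamma>(1) by (auto simp: \<Gamma>_def PiE_UNIV_domain)
      have 2: "p = (\<chi> j. \<gamma> j t)" using \<gamma>(2) by (simp add: vec_eq_iff)
      have "good \<gamma>" using elim(1) 1 2 p(1) by blast
      with 1 2 show "\<exists>\<gamma>\<in>\<Gamma>. good \<gamma> \<and> p = (\<chi> j. \<gamma> j t)" by blast
    qed
  qed
  then obtain \<epsilon> where \<epsilon>: "\<epsilon> > 0"
    "\<And>t p. t \<noteq> 0 \<Longrightarrow> norm t < \<epsilon> \<Longrightarrow> p \<in> ?C \<Longrightarrow> p $ first_index = inverse t ^ N \<Longrightarrow>
      \<exists>\<gamma>\<in>\<Gamma>. good \<gamma> \<and> p = (\<chi> j. \<gamma> j t)"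
    unfolding eventually_at by (auto simp: dist_norm)
  have "\<forall>\<gamma>\<in>{\<gamma>\<in>\<Gamma>. good \<gamma>}. \<exists>B. infinity_branch F B \<and>
    (\<forall>z. norm z > snd B \<longrightarrow> leaf_point (fst B) 1 z = (\<chi> j. \<gamma> j (exp (- Ln z / of_nat N))))"
  proof safe
    fix \<gamma> assume "\<gamma> \<in> \<Gamma>" "good \<gamma>"
    then show "\<exists>B. infinity_branch F B \<and>
      (\<forall>z. norm z > snd B \<longrightarrow> leaf_point (fst B) 1 z = (\<chi> j. \<gamma> j (exp (- Ln z / of_nat N))))"
      by (intro branch_of_germ C N mero first goodC)
  qed
  from bchoice[OF this] obtain B where B: "\<And>\<gamma>. \<gamma> \<in> \<Gamma> \<Longrightarrow> good \<gamma> \<Longrightarrow> infinity_branch F (B \<gamma>)"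
    "\<And>\<gamma> z. \<gamma> \<in> \<Gamma> \<Longrightarrow> good \<gamma> \<Longrightarrow> norm z > snd (B \<gamma>) \<Longrightarrow>
      leaf_point (fst (B \<gamma>)) 1 z = (\<chi> j. \<gamma> j (exp (- Ln z / of_nat N)))" by blast
  obtain K where K: "K > 0" "\<And>p. p \<in> ?C \<Longrightarrow> norm p \<le> K * (1 + norm (p $ first_index))"
    using linear_growth[OF C] by blast
  define \<B> where "\<B> = B ` {\<gamma>\<in>\<Gamma>. good \<gamma>}"
  define R0 where "R0 = exp (- real N * ln \<epsilon>) + (\<Sum>\<gamma>\<in>{\<gamma>\<in>\<Gamma>. good \<gamma>}. \<bar>snd (B \<gamma>)\<bar>)"
  show ?thesis
  proof (intro exI[of _ \<B>] exI[of _ "K * (1 + R0)"] conjI ballI impI)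
    show "finite \<B>" using fin by (simp add: \<B>_def)
    show "infinity_branch F b" if "b \<in> \<B>" for b using that B(1) by (auto simp: \<B>_def)
    fix p assume p: "p \<in> ?C" "norm p > K * (1 + R0)"
    define z where "z = p $ first_index"
    have "K * (1 + R0) < K * (1 + norm z)" using p(2) K(2)[OF p(1)] by (simp add: z_def)
    then have zR: "norm z > R0" using K(1) by simp
    have "0 \<le> (\<Sum>\<gamma>\<in>{\<gamma>\<in>\<Gamma>. good \<gamma>}. \<bar>snd (B \<gamma>)\<bar>)" by (intro sum_nonneg) simp
    then have ze: "norm z > exp (- real N * ln \<epsilon>)" using zR unfolding R0_def by linarith
    have z0: "z \<noteq> 0" by (rule norm_exp_Ln_less(1)[OF N \<epsilon>(1) ze])
    define t where "t = exp (- Ln z / of_nat N)"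
    have tN: "inverse t ^ N = z" using power_exp_Ln[OF z0 N] by (simp add: t_def power_inverse)
    have "norm t < \<epsilon>" unfolding t_def by (rule norm_exp_Ln_less(2)[OF N \<epsilon>(1) ze])
    moreover have "t \<noteq> 0" by (simp add: t_def)
    ultimately have "\<exists>\<gamma>\<in>\<Gamma>. good \<gamma> \<and> p = (\<chi> j. \<gamma> j t)"
      using p(1) tN[symmetric] unfolding z_def by (intro \<epsilon>(2))
    then obtain \<gamma> where \<gamma>: "\<gamma> \<in> \<Gamma>" "good \<gamma>" "p = (\<chi> j. \<gamma> j t)" by blast
    have "\<bar>snd (B \<gamma>)\<bar> \<le> (\<Sum>\<gamma>\<in>{\<gamma>\<in>\<Gamma>. good \<gamma>}. \<bar>snd (B \<gamma>)\<bar>)"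
      using \<gamma> fin by (intro member_le_sum) auto
    moreover have "exp (- real N * ln \<epsilon>) > 0" by simp
    ultimately have zB: "norm z > snd (B \<gamma>)" using zR unfolding R0_def by linarith
    show "\<exists>B\<in>\<B>. norm (p $ first_index) > snd B \<and> p = leaf_point (fst B) 1 (p $ first_index)"
    proof (intro bexI conjI)
      show "B \<gamma> \<in> \<B>" using \<gamma> by (simp add: \<B>_def)
      show "norm (p $ first_index) > snd (B \<gamma>)" using zB by (simp add: z_def)
      show "p = leaf_point (fst (B \<gamma>)) 1 (p $ first_index)"
        using B(2)[OF \<gamma>(1,2) zB] unfolding t_def[symmetric] \<gamma>(3)[symmetric] z_def[symmetric] by (rule sym)
    qed
  qed
qed

section \<open>Asymptotics of leaves\<close>

text \<open>
The terms of the leaf whose exponents \<open>1 - k / L\<close> are positive.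
\<close>

definition expansion_part :: "('n::finite \<Rightarrow> rat \<Rightarrow> complex) \<Rightarrow> nat \<Rightarrow> complex \<Rightarrow> 'n \<Rightarrow> complex \<Rightarrow> complex" where
  "expansion_part \<phi> L e j z =
     z * (\<Sum>k<L. \<phi> j (of_nat k / of_nat L) * (e * exp (- Ln z / of_nat L)) ^ k)"

lemma infinity_branch_puiseux: "infinity_branch F B \<Longrightarrow> puiseux_series (fst B j)"
  by (simp add: infinity_branch_def puiseux_solution_def)

lemma norm_root_of_unity:
  fixes e :: complex
  assumes "e ^ L = 1" "L > 0"
  shows "norm e = 1"
proof -
  have "norm e ^ L = 1" using assms(1) by (metis norm_power norm_one)
  then show ?thesis using assms(2) power_eq_imp_eq_base[of "norm e" L 1] by simp
qed

text \<open>
The tail \<open>\<Sum>k\<ge>L. a k * u ^ k\<close> of the power series is at most a constant times \<open>\<bar>u\<bar>\<close> to the power \<open>L\<close>,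
which is \<open>1 / \<bar>z\<bar>\<close>, so the factor \<open>z\<close> leaves a bounded error. The bounds are uniform in the conjugating root \<open>e\<close>.
\<close>

lemma leaf_point_expansion_coord:
  assumes B: "infinity_branch F B" and L: "L = common_ramification (fst B) * m" "m > 0"
  shows "\<exists>K R. \<forall>e z. e ^ L = 1 \<longrightarrow> norm z > R \<longrightarrow>
    norm (leaf_point (fst B) (e ^ m) z $ j - expansion_part (fst B) L e j z) \<le> K"
proof -
  define \<phi> where "\<phi> = fst B"
  define N where "N = common_ramification \<phi>"
  have ps: "puiseux_series (\<phi> j)" for j unfolding \<phi>_def using B by (rule infinity_branch_puiseux)
  have N: "N > 0" unfolding N_def by (rule common_ramification_pos[OF ps])
  have L': "L = N * m" using L by (simp add: N_def \<phi>_def)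
  have Lpos: "L > 0" using L' N L(2) by simp
  define M where "M = snd B"
  have M: "M > 0" using B by (simp add: infinity_branch_def M_def)
  have summ: "summable (leaf_term \<phi> c j z)" if "c ^ N = 1" "norm z > M" for c z
    using B that by (simp add: infinity_branch_def conjugation_roots_def \<phi>_def N_def M_def)
  define a where "a k = \<phi> j (of_nat k / of_nat L)" for k
  have leafs: "(\<lambda>k. a k * (e * exp (- Ln z / of_nat L)) ^ k) sums (leaf_point \<phi> (e ^ m) z $ j / z)"
    if e: "e ^ L = 1" and z: "norm z > M" for e z
  proof -
    have z0: "z \<noteq> 0" using z M by auto
    have "(e ^ m) ^ N = 1" using e by (simp add: L' mult.commute[of N] power_mult)
    then have "leaf_term \<phi> (e ^ m) j z sums (leaf_point \<phi> (e ^ m) z $ j)"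
      using summ[OF _ z] by (simp add: leaf_point_def summable_sums)
    then have "leaf_term \<phi> (e ^ m) j z sums (z * (leaf_point \<phi> (e ^ m) z $ j / z))"
      using z0 by simp
    then show ?thesis
      unfolding a_def leaf_sums[OF ps L'[unfolded N_def] L(2) z0 refl] .
  qed
  \<comment> \<open>Convergence at one point \<open>z0\<close> bounds the coefficients by \<open>A / \<rho>\<^sup>k\<close>.\<close>
  define z0 :: complex where "z0 = of_real (M + 1)"
  have z0: "norm z0 > M" using M by (simp add: z0_def)
  define \<rho> where "\<rho> = norm (exp (- Ln z0 / of_nat L))"
  have \<rho>: "\<rho> > 0" by (simp add: \<rho>_def)
  have "summable (\<lambda>k. a k * (1 * exp (- Ln z0 / of_nat L)) ^ k)"
    using leafs[of 1 z0] z0 by (intro sums_summable) auto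
  then have "bounded (range (\<lambda>k. a k * (1 * exp (- Ln z0 / of_nat L)) ^ k))"
    by (rule summable_imp_bounded)
  then obtain A where A0: "\<And>k. norm (a k * (1 * exp (- Ln z0 / of_nat L)) ^ k) \<le> A"
    unfolding bounded_iff by blast
  have A: "norm (a k) * \<rho> ^ k \<le> A" for k
    using A0[of k] by (simp add: norm_mult norm_power \<rho>_def del: norm_exp_eq_Re)
  have Apos: "A \<ge> 0" using A[of 0] by (rule order_trans[rotated]) simp
  define R where "R = max M (exp (- real L * ln (\<rho> / 2)))"
  have "norm (leaf_point \<phi> (e ^ m) z $ j - expansion_part \<phi> L e j z) \<le> 2 * A / \<rho> ^ L"
    if e: "e ^ L = 1" and zR: "norm z > R" for e z
  proof -
    have z: "norm z > M" "norm z > exp (- real L * ln (\<rho> / 2))" using zR by (auto simp: R_def)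
    define v where "v = exp (- Ln z / of_nat L)"
    define u where "u = e * v"
    have z0: "z \<noteq> 0" using norm_exp_Ln_less(1)[OF Lpos _ z(2)] \<rho> by simp
    have nv: "norm v < \<rho> / 2" using norm_exp_Ln_less(2)[OF Lpos _ z(2)] \<rho> by (simp add: v_def)
    have nu: "norm u = norm v" by (simp add: u_def norm_mult norm_root_of_unity[OF e Lpos])
    have uL: "norm u ^ L = inverse (norm z)"
      unfolding nu norm_power[symmetric] using power_exp_Ln[OF z0 Lpos] by (simp add: v_def norm_inverse)
    have s: "(\<lambda>k. a k * u ^ k) sums (leaf_point \<phi> (e ^ m) z $ j / z)"
      using leafs[OF e z(1)] by (simp add: u_def v_def)
    have tail: "(\<lambda>k. a (k + L) * u ^ (k + L)) sums (leaf_point \<phi> (e ^ m) z $ j / z - (\<Sum>k<L. a k * u ^ k))"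
      using sums_split_initial_segment[OF s, of L] by simp
    have term_le: "norm (a (k + L) * u ^ (k + L)) \<le> A * (norm u ^ L / \<rho> ^ L) * (1 / 2) ^ k" for k
    proof -
      have "norm (a (k + L) * u ^ (k + L)) = (norm (a (k + L)) * \<rho> ^ (k + L)) * (norm u / \<rho>) ^ (k + L)"
        using \<rho> by (simp add: norm_mult norm_power power_divide)
      also have "\<dots> \<le> A * (norm u / \<rho>) ^ (k + L)"
        using A \<rho> by (intro mult_right_mono) auto
      also have "(norm u / \<rho>) ^ (k + L) = (norm u ^ L / \<rho> ^ L) * (norm u / \<rho>) ^ k"
        by (simp add: power_add power_divide mult_ac)
      also have "A * \<dots> \<le> A * ((norm u ^ L / \<rho> ^ L) * (1 / 2) ^ k)"
        using Apos \<rho> nv nu by (intro mult_left_mono power_mono) (auto simp: field_simps)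
      finally show ?thesis by (simp add: mult.assoc)
    qed
    have geo: "(\<lambda>k. A * (norm u ^ L / \<rho> ^ L) * (1 / 2) ^ k) sums (A * (norm u ^ L / \<rho> ^ L) * (1 / (1 - 1 / 2)))"
      by (intro sums_mult geometric_sums) simp
    have "norm (leaf_point \<phi> (e ^ m) z $ j / z - (\<Sum>k<L. a k * u ^ k)) \<le> A * (norm u ^ L / \<rho> ^ L) * (1 / (1 - 1 / 2))"
      using norm_suminf_le[OF term_le sums_summable[OF geo]] sums_unique[OF tail] sums_unique[OF geo] by simp
    then have "norm z * norm (leaf_point \<phi> (e ^ m) z $ j / z - (\<Sum>k<L. a k * u ^ k)) \<le>
        norm z * (A * (norm u ^ L / \<rho> ^ L) * (1 / (1 - 1 / 2)))"
      by (rule mult_left_mono) simp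
    also have "\<dots> = 2 * A / \<rho> ^ L" using z0 by (simp add: uL)
    also have "norm z * norm (leaf_point \<phi> (e ^ m) z $ j / z - (\<Sum>k<L. a k * u ^ k)) =
        norm (leaf_point \<phi> (e ^ m) z $ j - expansion_part \<phi> L e j z)"
      unfolding norm_mult[symmetric] using z0
      by (simp add: expansion_part_def right_diff_distrib a_def u_def v_def)
    finally show ?thesis .
  qed
  then show ?thesis unfolding \<phi>_def by blast
qed

lemma leaf_point_expansion:
  assumes B: "infinity_branch F B" and L: "L = common_ramification (fst B) * m" "m > 0"
  shows "\<exists>K R. \<forall>e z j. e ^ L = 1 \<longrightarrow> norm z > R \<longrightarrow>
    norm (leaf_point (fst B) (e ^ m) z $ j - expansion_part (fst B) L e j z) \<le> K"
proof -
  have "\<forall>j. \<exists>KR. \<forall>e z. e ^ L = 1 \<longrightarrow> norm z > snd KR \<longrightarrow>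
    norm (leaf_point (fst B) (e ^ m) z $ j - expansion_part (fst B) L e j z) \<le> fst KR"
    using leaf_point_expansion_coord[OF B L] by simp
  from choice[OF this] obtain KR where KR: "\<And>j e z. e ^ L = 1 \<Longrightarrow> norm z > snd (KR j) \<Longrightarrow>
    norm (leaf_point (fst B) (e ^ m) z $ j - expansion_part (fst B) L e j z) \<le> fst (KR j)" by blast
  show ?thesis
  proof (rule exI[of _ "Max (range (\<lambda>j. fst (KR j)))"], rule exI[of _ "Max (range (\<lambda>j. snd (KR j)))"], intro allI impI)
    fix e z :: complex and j assume e: "e ^ L = 1" and z: "norm z > Max (range (\<lambda>j. snd (KR j)))"
    have "snd (KR j) \<le> Max (range (\<lambda>j. snd (KR j)))" by (rule Max_ge) auto
    then have "norm (leaf_point (fst B) (e ^ m) z $ j - expansion_part (fst B) L e j z) \<le> fst (KR j)"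
      using z by (intro KR e) simp
    also have "\<dots> \<le> Max (range (\<lambda>j. fst (KR j)))" by (rule Max_ge) auto
    finally show "norm (leaf_point (fst B) (e ^ m) z $ j - expansion_part (fst B) L e j z) \<le> Max (range (\<lambda>j. fst (KR j)))" .
  qed
qed

lemma exp_Ln_tendsto_0:
  assumes "L > 0"
  shows "((\<lambda>z. exp (- Ln z / of_nat L)) \<longlongrightarrow> 0) at_infinity"
proof (rule tendstoI)
  fix \<epsilon> :: real assume \<epsilon>: "\<epsilon> > 0"
  show "\<forall>\<^sub>F z in at_infinity. dist (exp (- Ln z / of_nat L)) 0 < \<epsilon>"
    unfolding eventually_at_infinity
  proof (intro exI[of _ "exp (- real L * ln \<epsilon>) + 1"] allI impI)
    fix z :: complex assume "exp (- real L * ln \<epsilon>) + 1 \<le> norm z"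
    then show "dist (exp (- Ln z / of_nat L)) 0 < \<epsilon>"
      using norm_exp_Ln_less(2)[OF assms \<epsilon>, of z] by simp
  qed
qed

text \<open>
With \<open>v = exp (- Ln z / L)\<close>, which tends to 0, the sum is \<open>z v\<^sup>k\<close> times a polynomial in \<open>v\<close> with constant term
\<open>b k \<noteq> 0\<close>, and \<open>\<bar>z v\<^sup>k\<bar>\<close> is at least \<open>1 / \<bar>v\<bar>\<close> for large \<open>z\<close>.
\<close>

lemma expansion_difference_diverges:
  fixes b :: "nat \<Rightarrow> complex"
  assumes k: "k < L" "b k \<noteq> 0" and zero: "\<And>i. i < k \<Longrightarrow> b i = 0"
  shows "filterlim (\<lambda>z. norm (z * (\<Sum>i<L. b i * exp (- Ln z / of_nat L) ^ i))) at_top at_infinity"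
proof -
  have L: "L > 0" using k by simp
  define v where "v z = exp (- Ln z / of_nat L)" for z :: complex
  have v0: "(v \<longlongrightarrow> 0) at_infinity" unfolding v_def by (rule exp_Ln_tendsto_0[OF L])
  define q where "q x = (\<Sum>i<L - k. b (i + k) * x ^ i)" for x :: complex
  have "((\<lambda>z. q (v z)) \<longlongrightarrow> (\<Sum>i<L - k. b (i + k) * 0 ^ i)) at_infinity"
    unfolding q_def by (intro tendsto_intros v0)
  also have "(\<Sum>i<L - k. b (i + k) * 0 ^ i) = (\<Sum>i<L - k. if i = 0 then b k else 0)"
    by (intro sum.cong) auto
  also have "\<dots> = b k" using k by simp
  finally have "((\<lambda>z. norm (q (v z))) \<longlongrightarrow> norm (b k)) at_infinity" by (rule tendsto_norm)
  moreover have "norm (b k) > 0" using k by simp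
  moreover have "filterlim (\<lambda>z. norm (z * v z ^ k)) at_top at_infinity"
  proof (rule filterlim_at_top_mono)
    have "((\<lambda>z. norm (v z)) \<longlongrightarrow> 0) at_infinity" using v0 by (rule tendsto_norm_zero)
    then show "filterlim (\<lambda>z. inverse (norm (v z))) at_top at_infinity"
      by (rule filterlim_inverse_at_top) (simp add: v_def)
    have "\<forall>\<^sub>F z in at_infinity. dist (v z) 0 < 1" using v0 by (rule tendstoD) simp
    moreover have "\<forall>\<^sub>F z in at_infinity. z \<noteq> (0 :: complex)"
      unfolding eventually_at_infinity by (rule exI[of _ 1]) auto
    ultimately show "\<forall>\<^sub>F z in at_infinity. inverse (norm (v z)) \<le> norm (z * v z ^ k)"
    proof eventually_elim
      case (elim z)
      define x where "x = norm (v z)"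
      have x: "0 < x" "x \<le> 1" using elim by (auto simp: x_def v_def)
      have "v z ^ L = inverse z" unfolding v_def by (rule power_exp_Ln[OF elim(2) L])
      then have "norm (v z ^ L) = inverse (norm z)" by (simp add: norm_inverse)
      then have xL: "norm z = inverse (x ^ L)" by (simp add: norm_power x_def)
      have "x ^ L \<le> x ^ Suc k" using x k by (intro power_decreasing) auto
      then have "inverse (x ^ Suc k) \<le> inverse (x ^ L)" using x by (intro le_imp_inverse_le) auto
      then have "inverse (x ^ Suc k) * x ^ k \<le> inverse (x ^ L) * x ^ k" using x by (intro mult_right_mono) auto
      moreover have ix: "inverse (x ^ Suc k) * x ^ k = inverse x" using x by (simp add: field_simps)
      ultimately have "inverse x \<le> inverse (x ^ L) * x ^ k" by (simp only: ix)
      then show ?case by (simp add: norm_mult norm_power xL x_def[symmetric])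
    qed
  qed
  ultimately have "filterlim (\<lambda>z. norm (q (v z)) * norm (z * v z ^ k)) at_top at_infinity"
    by (rule filterlim_tendsto_pos_mult_at_top)
  moreover have "norm (q (v z)) * norm (z * v z ^ k) = norm (z * (\<Sum>i<L. b i * v z ^ i))" for z
  proof -
    have "(\<Sum>i<L. b i * v z ^ i) = (\<Sum>i\<in>{k..<L}. b i * v z ^ i)"
      using zero k by (intro sum.mono_neutral_right) (auto simp: not_le)
    also have "\<dots> = (\<Sum>i<L - k. b (i + k) * v z ^ (i + k))"
      using sum.shift_bounds_nat_ivl[of "\<lambda>i. b i * v z ^ i" 0 k "L - k"] k by (simp add: atLeast0LessThan)
    also have "\<dots> = v z ^ k * q (v z)" by (simp add: q_def sum_distrib_left power_add mult_ac)
    finally show ?thesis by (simp add: norm_mult)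
  qed
  ultimately show ?thesis by (simp add: v_def)
qed

lemma expansion_part_diff:
  "expansion_part \<phi> L e j z - expansion_part \<phi>' L e' j z =
    z * (\<Sum>k<L. (\<phi> j (of_nat k / of_nat L) * e ^ k - \<phi>' j (of_nat k / of_nat L) * e' ^ k) * exp (- Ln z / of_nat L) ^ k)"
  by (simp add: expansion_part_def right_diff_distrib[symmetric] sum_subtractf[symmetric] power_mult_distrib algebra_simps)

text \<open>
Otherwise the first disagreeing coefficient would dominate the difference of the leaves.
\<close>

lemma nondivergent_leaves_agree:
  assumes B: "infinity_branch F B" and L: "L = common_ramification (fst B) * m" "m > 0"
    and B': "infinity_branch G B'" and L': "L = common_ramification (fst B') * m'" "m' > 0"
    and e: "e ^ L = 1" and e': "e' ^ L = 1"
    and nd: "\<not> leaves_diverge B (e ^ m) B' (e' ^ m')" and k: "k < L"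
  shows "fst B j (of_nat k / of_nat L) * e ^ k = fst B' j (of_nat k / of_nat L) * e' ^ k"
proof (rule ccontr)
  define b where "b j k = fst B j (of_nat k / of_nat L) * e ^ k - fst B' j (of_nat k / of_nat L) * e' ^ k" for j k
  assume "\<not> ?thesis"
  then have "b j k \<noteq> 0" by (simp add: b_def)
  then obtain i where i: "b j i \<noteq> 0" "i \<le> k" "\<And>l. l < i \<Longrightarrow> b j l = 0"
    using exists_least_iff[of "\<lambda>i. b j i \<noteq> 0"] by (metis linorder_not_le not_less_iff_gr_or_eq)
  obtain K1 R1 where 1: "\<And>z. norm z > R1 \<Longrightarrow>
      norm (leaf_point (fst B) (e ^ m) z $ j - expansion_part (fst B) L e j z) \<le> K1"
    using leaf_point_expansion[OF B L] e by blast
  obtain K2 R2 where 2: "\<And>z. norm z > R2 \<Longrightarrow>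
      norm (leaf_point (fst B') (e' ^ m') z $ j - expansion_part (fst B') L e' j z) \<le> K2"
    using leaf_point_expansion[OF B' L'] e' by blast
  let ?d = "\<lambda>z. leaf_point (fst B) (e ^ m) z - leaf_point (fst B') (e' ^ m') z"
  let ?E = "\<lambda>z. norm (z * (\<Sum>i<L. b j i * exp (- Ln z / of_nat L) ^ i))"
  have "filterlim ?E at_top at_infinity"
    by (rule expansion_difference_diverges[of i]) (use i k in auto)
  then have lim: "filterlim (\<lambda>z. - (K1 + K2) + ?E z) at_top at_infinity"
    by (rule filterlim_tendsto_add_at_top[OF tendsto_const])
  have "\<forall>\<^sub>F z in at_infinity. norm z > max R1 R2"
    unfolding eventually_at_infinity by (rule exI[of _ "max R1 R2 + 1"]) auto
  then have "\<forall>\<^sub>F z in at_infinity. - (K1 + K2) + ?E z \<le> norm (?d z)"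
  proof eventually_elim
    case (elim z)
    have eq: "z * (\<Sum>i<L. b j i * exp (- Ln z / of_nat L) ^ i) =
        expansion_part (fst B) L e j z - expansion_part (fst B') L e' j z"
      by (simp add: expansion_part_diff b_def)
    let ?x = "leaf_point (fst B) (e ^ m) z $ j" and ?y = "leaf_point (fst B') (e' ^ m') z $ j"
    let ?p = "expansion_part (fst B) L e j z" and ?q = "expansion_part (fst B') L e' j z"
    have "norm (?p - ?q) = norm ((?x - ?y) - (?x - ?p) + (?y - ?q))" by (simp add: algebra_simps)
    also have "\<dots> \<le> norm (?x - ?y) + norm (?x - ?p) + norm (?y - ?q)"
      by (meson add_right_mono norm_triangle_ineq norm_triangle_ineq4 order_trans)
    also have "\<dots> \<le> norm (?d z) + K1 + K2"
      using 1[of z] 2[of z] elim Finite_Cartesian_Product.norm_nth_le[of "?d z" j] by simp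
    finally show ?case unfolding eq by simp
  qed
  with lim have "filterlim (\<lambda>z. norm (?d z)) at_top at_infinity" by (rule filterlim_at_top_mono)
  with nd show False by (simp add: leaves_diverge_def)
qed

lemma agreeing_leaves_bounded:
  assumes B: "infinity_branch F B" and L: "L = common_ramification (fst B) * m" "m > 0"
    and B': "infinity_branch G B'" and L': "L = common_ramification (fst B') * m'" "m' > 0"
    and e: "e ^ L = 1" and e': "e' ^ L = 1"
    and agree: "\<And>j k. k < L \<Longrightarrow> fst B j (of_nat k / of_nat L) * e ^ k = fst B' j (of_nat k / of_nat L) * e' ^ k"
  shows "\<exists>K R. \<forall>z. norm z > R \<longrightarrow> dist (leaf_point (fst B) (e ^ m) z) (leaf_point (fst B') (e' ^ m') z) \<le> K"
proof -
  obtain K1 R1 where 1: "\<And>z j. norm z > R1 \<Longrightarrow>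
      norm (leaf_point (fst B) (e ^ m) z $ j - expansion_part (fst B) L e j z) \<le> K1"
    using leaf_point_expansion[OF B L] e by blast
  obtain K2 R2 where 2: "\<And>z j. norm z > R2 \<Longrightarrow>
      norm (leaf_point (fst B') (e' ^ m') z $ j - expansion_part (fst B') L e' j z) \<le> K2"
    using leaf_point_expansion[OF B' L'] e' by blast
  show ?thesis
  proof (rule exI[of _ "\<Sum>j\<in>(UNIV :: 'a set). K1 + K2"], rule exI[of _ "max R1 R2"], intro allI impI)
    fix z :: complex assume z: "norm z > max R1 R2"
    let ?d = "leaf_point (fst B) (e ^ m) z - leaf_point (fst B') (e' ^ m') z"
    have "norm (?d $ j) \<le> K1 + K2" for j
    proof -
      have "expansion_part (fst B) L e j z - expansion_part (fst B') L e' j z = 0"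
        unfolding expansion_part_diff by (simp add: agree)
      then have "?d $ j = (leaf_point (fst B) (e ^ m) z $ j - expansion_part (fst B) L e j z) -
          (leaf_point (fst B') (e' ^ m') z $ j - expansion_part (fst B') L e' j z)" by simp
      then have "norm (?d $ j) \<le> norm (leaf_point (fst B) (e ^ m) z $ j - expansion_part (fst B) L e j z) +
          norm (leaf_point (fst B') (e' ^ m') z $ j - expansion_part (fst B') L e' j z)"
        by (metis norm_triangle_ineq4)
      then show ?thesis using 1[of z j] 2[of z j] z by simp
    qed
    then have "(\<Sum>j\<in>UNIV. norm (?d $ j)) \<le> (\<Sum>j\<in>(UNIV :: 'a set). K1 + K2)" by (intro sum_mono)
    moreover have "norm ?d \<le> (\<Sum>j\<in>UNIV. norm (?d $ j))"
      unfolding norm_vec_def by (rule L2_set_le_sum) simp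
    ultimately show "dist (leaf_point (fst B) (e ^ m) z) (leaf_point (fst B') (e' ^ m') z) \<le> (\<Sum>j\<in>(UNIV :: 'a set). K1 + K2)"
      by (simp add: dist_norm)
  qed
qed

text \<open>
The derivative of \<open>z\<close> to the power \<open>1 - q\<close> has norm at most 1 on \<open>Re z \<ge> 1\<close>, if \<open>0 \<le> q \<le> 1\<close>.
\<close>

lemma fractional_power_lipschitz:
  assumes z: "Re z \<ge> 1" "Re w \<ge> 1" and L: "L > 0" and k: "k < L"
  shows "norm (z * exp (- Ln z / of_nat L) ^ k - w * exp (- Ln w / of_nat L) ^ k) \<le> norm (z - w)"
proof -
  define S where "S = {z. Re z \<ge> 1}"
  define q :: real where "q = k / L"
  define f where "f z = z * exp (- Ln z / of_nat L) ^ k" for z :: complex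
  have q: "0 \<le> q" "q \<le> 1" using k by (auto simp: q_def)
  have S: "z \<notin> \<real>\<^sub>\<le>\<^sub>0" "z \<noteq> 0" "norm z \<ge> 1" if "z \<in> S" for z
    using that complex_Re_le_cmod[of z] by (auto simp: S_def complex_nonpos_Reals_iff)
  have f_eq: "f z = exp (of_real (1 - q) * Ln z)" if "z \<in> S" for z
  proof -
    have "f z = exp (Ln z) * exp (of_nat k * (- Ln z / of_nat L))"
      unfolding exp_of_nat_mult using S(2)[OF that] by (simp add: f_def)
    also have "\<dots> = exp (Ln z + of_nat k * (- Ln z / of_nat L))" by (rule exp_add[symmetric])
    also have "Ln z + of_nat k * (- Ln z / of_nat L) = of_real (1 - q) * Ln z"
      by (simp add: q_def algebra_simps)
    finally show ?thesis .
  qed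
  have "norm (f z - f w) \<le> 1 * norm (z - w)"
  proof (rule field_differentiable_bound)
    show "convex S" unfolding S_def by (rule convex_halfspace_Re_ge)
    show "z \<in> S" "w \<in> S" using z by (simp_all add: S_def)
    fix x assume x: "x \<in> S"
    let ?f' = "exp (of_real (1 - q) * Ln x) * (of_real (1 - q) * inverse x)"
    have "((\<lambda>z. exp (of_real (1 - q) * Ln z)) has_field_derivative ?f') (at x within S)"
      using S[OF x] by (auto intro!: derivative_eq_intros)
    then show "(f has_field_derivative ?f') (at x within S)"
      by (rule has_field_derivative_transform_within[OF _ zero_less_one x]) (simp add: f_eq)
    have "exp (of_real (1 - q) * Ln x) = x * exp (- of_real q * Ln x)"
      using S(2)[OF x] by (simp add: algebra_simps exp_diff exp_minus field_simps)
    then have f': "?f' = of_real (1 - q) * exp (- of_real q * Ln x)" using S(2)[OF x] by simp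
    have "norm (exp (- of_real q * Ln x)) \<le> 1" using q S[OF x] by simp
    then show "norm ?f' \<le> 1" unfolding f' norm_mult norm_of_real using q by (intro mult_le_one) auto
  qed
  then show ?thesis by (simp add: f_def)
qed

text \<open>
Parameters are restricted to a right half-plane, which avoids the cut of the logarithm, where a leaf may jump.
\<close>

lemma leaf_point_near:
  assumes B: "infinity_branch F B"
  shows "\<exists>K R. \<forall>z w. Re z > R \<longrightarrow> Re w > R \<longrightarrow>
    dist (leaf_point (fst B) 1 z) (leaf_point (fst B) 1 w) \<le> K * (1 + norm (z - w))"
proof -
  define L where "L = common_ramification (fst B)"
  have L: "L > 0" unfolding L_def by (rule common_ramification_pos[OF infinity_branch_puiseux[OF B]])
  obtain K R where K': "\<And>e z j. e ^ L = 1 \<Longrightarrow> norm z > R \<Longrightarrow>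
      norm (leaf_point (fst B) (e ^ 1) z $ j - expansion_part (fst B) L e j z) \<le> K"
    using leaf_point_expansion[OF B, of L 1] unfolding L_def by (metis mult_1_right zero_less_one)
  have K: "norm (leaf_point (fst B) 1 z $ j - expansion_part (fst B) L 1 j z) \<le> K" if "norm z > R" for z j
    using K'[of 1 z j] that by simp
  define S where "S j = (\<Sum>k<L. norm (fst B j (of_nat k / of_nat L)))" for j
  have S: "S j \<ge> 0" for j unfolding S_def by (intro sum_nonneg) simp
  have "norm (of_real (\<bar>R\<bar> + 1) :: complex) > R" by simp
  from K[OF this, of undefined] have K0: "K \<ge> 0" by (rule order_trans[rotated]) simp
  show ?thesis
  proof (rule exI[of _ "\<Sum>j\<in>(UNIV :: 'a set). 2 * K + S j"], rule exI[of _ "max R 1"], intro allI impI)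
    fix z w :: complex assume zw: "Re z > max R 1" "Re w > max R 1"
    have nzw: "norm z > R" "norm w > R" using zw complex_Re_le_cmod[of z] complex_Re_le_cmod[of w] by auto
    let ?d = "leaf_point (fst B) 1 z - leaf_point (fst B) 1 w"
    have "norm (?d $ j) \<le> (2 * K + S j) * (1 + norm (z - w))" for j
    proof -
      let ?p = "expansion_part (fst B) L 1 j"
      have "?p z - ?p w = (\<Sum>k<L. fst B j (of_nat k / of_nat L) *
          (z * exp (- Ln z / of_nat L) ^ k - w * exp (- Ln w / of_nat L) ^ k))"
        by (simp add: expansion_part_def sum_distrib_left sum_subtractf[symmetric] algebra_simps)
      also have "norm \<dots> \<le> (\<Sum>k<L. norm (fst B j (of_nat k / of_nat L)) * norm (z - w))"
      proof (rule sum_norm_le)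
        fix k assume "k \<in> {..<L}"
        then have "norm (z * exp (- Ln z / of_nat L) ^ k - w * exp (- Ln w / of_nat L) ^ k) \<le> norm (z - w)"
          using zw L by (intro fractional_power_lipschitz) auto
        then show "norm (fst B j (of_nat k / of_nat L) * (z * exp (- Ln z / of_nat L) ^ k - w * exp (- Ln w / of_nat L) ^ k))
            \<le> norm (fst B j (of_nat k / of_nat L)) * norm (z - w)"
          unfolding norm_mult by (rule mult_left_mono) simp
      qed
      also have "\<dots> = S j * norm (z - w)" by (simp add: S_def sum_distrib_right)
      finally have p: "norm (?p z - ?p w) \<le> S j * norm (z - w)" .
      have "?d $ j = (leaf_point (fst B) 1 z $ j - ?p z) - (leaf_point (fst B) 1 w $ j - ?p w) + (?p z - ?p w)" by simp
      also have "norm \<dots> \<le> norm (leaf_point (fst B) 1 z $ j - ?p z) + norm (leaf_point (fst B) 1 w $ j - ?p w) + norm (?p z - ?p w)"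
        by (meson add_right_mono norm_triangle_ineq norm_triangle_ineq4 order_trans)
      also have "\<dots> \<le> K + K + S j * norm (z - w)" using K[OF nzw(1)] K[OF nzw(2)] p by (intro add_mono)
      also have "\<dots> \<le> (2 * K + S j) * (1 + norm (z - w))" using K0 S[of j] by (simp add: algebra_simps)
      finally show ?thesis .
    qed
    then have "(\<Sum>j\<in>UNIV. norm (?d $ j)) \<le> (\<Sum>j\<in>(UNIV :: 'a set). (2 * K + S j) * (1 + norm (z - w)))" by (intro sum_mono)
    moreover have "norm ?d \<le> (\<Sum>j\<in>UNIV. norm (?d $ j))"
      unfolding norm_vec_def by (rule L2_set_le_sum) simp
    ultimately show "dist (leaf_point (fst B) 1 z) (leaf_point (fst B) 1 w) \<le> (\<Sum>j\<in>(UNIV :: 'a set). 2 * K + S j) * (1 + norm (z - w))"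
      unfolding sum_distrib_right by (simp add: dist_norm)
  qed
qed

lemma leaf_point_first:
  assumes B: "infinity_branch F B" and z: "z \<noteq> 0"
  shows "leaf_point (fst B) c z $ first_index = z"
proof -
  have f: "fst B first_index = (\<lambda>q. if q = 0 then 1 else 0)"
    using B by (simp add: infinity_branch_def puiseux_solution_def)
  have N: "common_ramification (fst B) > 0" by (rule common_ramification_pos[OF infinity_branch_puiseux[OF B]])
  have "leaf_term (fst B) c first_index z = (\<lambda>k. if k = 0 then z else 0)"
    using N z by (auto simp: leaf_term_def Let_def f fun_eq_iff)
  then show ?thesis using sums_unique[OF sums_single[of 0 "\<lambda>_. z"]] by (simp add: leaf_point_def)
qed

lemma one_in_conjugation_roots: "1 \<in> conjugation_roots \<phi>"
  by (simp add: conjugation_roots_def)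

lemma leaf_point_in_curve:
  assumes "infinity_branch F B" "c \<in> conjugation_roots (fst B)" "norm z > snd B"
  shows "leaf_point (fst B) c z \<in> zero_locus F"
  using assms unfolding infinity_branch_def branch_points_def leaf_def by blast

section \<open>Similar asymptotic behavior and Hausdorff distance\<close>

text \<open>
Some leaves of the two branches, conjugated by \<open>e\<close> and \<open>e'\<close>, have the same coefficients for positive exponents. Dividing by
\<open>e\<close> turns the first into the leaf of the root of unity 1 and the second into the leaf of \<open>e' / e\<close>.
\<close>

lemma nondivergent_branch_stays_near:
  assumes B: "infinity_branch F B" and B': "infinity_branch G B'" and nd: "\<not> branches_diverge B B'"
  shows "\<exists>K R. \<forall>z. norm z > R \<longrightarrow> infdist (leaf_point (fst B) 1 z) (zero_locus G) \<le> K"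
proof -
  define N where "N = common_ramification (fst B)"
  define N' where "N' = common_ramification (fst B')"
  have N: "N > 0" unfolding N_def by (rule common_ramification_pos[OF infinity_branch_puiseux[OF B]])
  have N': "N' > 0" unfolding N'_def by (rule common_ramification_pos[OF infinity_branch_puiseux[OF B']])
  define L where "L = N * N'"
  have L: "L = common_ramification (fst B) * N'" and L': "L = common_ramification (fst B') * N"
    by (simp_all add: L_def N_def N'_def)
  obtain c c' where c: "c ^ N = 1" and c': "c' ^ N' = 1" and ndl: "\<not> leaves_diverge B c B' c'"
    using nd by (auto simp: branches_diverge_def conjugation_roots_def N_def N'_def)
  obtain e where e: "e ^ N' = c" by (rule nth_root_exists[OF N'])
  obtain e' where e': "e' ^ N = c'" by (rule nth_root_exists[OF N])
  have eL: "e ^ L = 1" using c e by (simp add: L_def mult.commute[of N] power_mult)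
  have eL': "e' ^ L = 1" using c' e' by (simp add: L_def power_mult)
  have e0: "e \<noteq> 0" using eL L_def N N' by (auto simp: zero_power)
  define x where "x = e' / e"
  have xL: "x ^ L = 1" using eL eL' by (simp add: x_def power_divide)
  have "fst B j (of_nat k / of_nat L) * 1 ^ k = fst B' j (of_nat k / of_nat L) * x ^ k" if "k < L" for j k
  proof -
    have "fst B j (of_nat k / of_nat L) * e ^ k = fst B' j (of_nat k / of_nat L) * e' ^ k"
      using ndl unfolding e[symmetric] e'[symmetric]
      by (rule nondivergent_leaves_agree[OF B L N' B' L' N eL eL' _ that])
    then show ?thesis using e0 by (simp add: x_def power_divide field_simps)
  qed
  from agreeing_leaves_bounded[OF B L N' B' L' N _ xL this]
  obtain K R where K: "\<And>z. norm z > R \<Longrightarrow> dist (leaf_point (fst B) 1 z) (leaf_point (fst B') (x ^ N) z) \<le> K"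
    by auto
  show ?thesis
  proof (rule exI[of _ K], rule exI[of _ "max R (snd B')"], intro allI impI)
    fix z :: complex assume z: "norm z > max R (snd B')"
    have "(x ^ N) ^ N' = 1" using xL by (simp add: L_def power_mult)
    then have "x ^ N \<in> conjugation_roots (fst B')" by (simp add: conjugation_roots_def N'_def)
    then have "leaf_point (fst B') (x ^ N) z \<in> zero_locus G" using z by (intro leaf_point_in_curve[OF B']) auto
    then show "infdist (leaf_point (fst B) 1 z) (zero_locus G) \<le> K"
      using K[of z] z by (intro infdist_le2) auto
  qed
qed

text \<open>
Far points lie on one of finitely many leaves, each of which stays near the other curve; the remaining
points form a bounded set.
\<close>

lemma similar_imp_bounded_distance:
  assumes F: "finite F" and C: "no_infinity_point_with_x1_zero (zero_locus F)" and ne: "zero_locus G \<noteq> {}"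
    and sim: "\<And>B. infinity_branch F B \<Longrightarrow> \<exists>B'. infinity_branch G B' \<and> \<not> branches_diverge B B'"
  shows "\<exists>K. \<forall>p\<in>zero_locus F. infdist p (zero_locus G) \<le> K"
proof -
  obtain \<B> R where \<B>: "finite \<B>" "\<And>B. B \<in> \<B> \<Longrightarrow> infinity_branch F B"
    and cover: "\<And>p. p \<in> zero_locus F \<Longrightarrow> norm p > R \<Longrightarrow>
       \<exists>B\<in>\<B>. norm (p $ first_index) > snd B \<and> p = leaf_point (fst B) 1 (p $ first_index)"
    using finitely_many_branches_cover[OF F C] by blast
  have "\<forall>B\<in>\<B>. \<exists>KR. \<forall>z. norm z > snd KR \<longrightarrow> infdist (leaf_point (fst B) 1 z) (zero_locus G) \<le> fst KR"
  proof
    fix B assume "B \<in> \<B>"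
    then have B: "infinity_branch F B" by (rule \<B>(2))
    then obtain B' where "infinity_branch G B'" "\<not> branches_diverge B B'" using sim by blast
    from nondivergent_branch_stays_near[OF B this]
    show "\<exists>KR. \<forall>z. norm z > snd KR \<longrightarrow> infdist (leaf_point (fst B) 1 z) (zero_locus G) \<le> fst KR" by simp
  qed
  from bchoice[OF this] obtain KR where KR: "\<And>B z. B \<in> \<B> \<Longrightarrow> norm z > snd (KR B) \<Longrightarrow>
      infdist (leaf_point (fst B) 1 z) (zero_locus G) \<le> fst (KR B)" by blast
  obtain K0 where K0: "K0 > 0" "\<And>p. p \<in> zero_locus F \<Longrightarrow> norm p \<le> K0 * (1 + norm (p $ first_index))"
    using linear_growth[OF C] by blast
  define R1 where "R1 = (\<Sum>B\<in>\<B>. \<bar>snd (KR B)\<bar>)"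
  define R2 where "R2 = max R (K0 * (1 + R1))"
  obtain d where d: "d \<in> zero_locus G" using ne by blast
  have "infdist p (zero_locus G) \<le> max (R2 + norm d) (\<Sum>B\<in>\<B>. \<bar>fst (KR B)\<bar>)" if p: "p \<in> zero_locus F" for p
  proof (cases "norm p > R2")
    case False
    have "dist p d \<le> norm p + norm d" by (metis dist_norm norm_triangle_ineq4)
    then have "infdist p (zero_locus G) \<le> R2 + norm d" using False by (intro infdist_le2[OF d]) simp
    then show ?thesis by simp
  next
    case True
    then obtain B where B: "B \<in> \<B>" "p = leaf_point (fst B) 1 (p $ first_index)"
      using cover[OF p] by (auto simp: R2_def)
    have "K0 * (1 + R1) < K0 * (1 + norm (p $ first_index))" using True K0(2)[OF p] by (simp add: R2_def)
    then have "norm (p $ first_index) > R1" using K0(1) by simp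
    moreover have "\<bar>snd (KR B)\<bar> \<le> R1" unfolding R1_def using \<B>(1) B(1) by (intro member_le_sum) auto
    ultimately have "norm (p $ first_index) > snd (KR B)" by linarith
    from KR[OF B(1) this] have "infdist p (zero_locus G) \<le> fst (KR B)" using B(2) by simp
    also have "\<dots> \<le> \<bar>fst (KR B)\<bar>" by simp
    also have "\<dots> \<le> (\<Sum>B\<in>\<B>. \<bar>fst (KR B)\<bar>)" using \<B>(1) B(1) by (intro member_le_sum) auto
    finally show ?thesis by simp
  qed
  then show ?thesis by blast
qed

text \<open>
The leaf is followed along the points \<open>p n\<close> with the integer parameters \<open>n\<close>, and a point \<open>q n\<close> of
the other curve is chosen near \<open>p n\<close>. By the pigeonhole principle infinitely many \<open>q n\<close> lie on the same leaf, at parameters near \<open>n\<close>.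
\<close>

lemma bounded_distance_imp_similar:
  fixes F G :: "('n::{finite,linorder}, real) mpoly set"
  assumes G: "finite G" and D: "no_infinity_point_with_x1_zero (zero_locus G)" and ne: "zero_locus G \<noteq> {}"
    and K: "\<And>p. p \<in> zero_locus F \<Longrightarrow> infdist p (zero_locus G) \<le> K" and B: "infinity_branch F B"
  shows "\<exists>B'. infinity_branch G B' \<and> \<not> branches_diverge B B'"
proof -
  obtain \<B> R where \<B>: "finite \<B>" "\<And>B. B \<in> \<B> \<Longrightarrow> infinity_branch G B"
    and cover: "\<And>p. p \<in> zero_locus G \<Longrightarrow> norm p > R \<Longrightarrow>
       \<exists>B\<in>\<B>. norm (p $ first_index) > snd B \<and> p = leaf_point (fst B) 1 (p $ first_index)"
    using finitely_many_branches_cover[OF G D] by blast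
  define p where "p n = leaf_point (fst B) 1 (of_nat n)" for n :: nat
  have "\<exists>q\<in>zero_locus G. dist (p n) q < \<bar>K\<bar> + 1" if n: "real n > snd B" for n
  proof -
    have "p n \<in> zero_locus F"
      unfolding p_def using n by (intro leaf_point_in_curve[OF B]) (auto simp: one_in_conjugation_roots)
    then have "infdist (p n) (zero_locus G) < \<bar>K\<bar> + 1" using K[of "p n"] by linarith
    then show ?thesis
      using ne by (auto simp: infdist_def cINF_less_iff bdd_below_image_dist split: if_splits)
  qed
  then obtain q where q: "\<And>n. real n > snd B \<Longrightarrow> q n \<in> zero_locus G"
    "\<And>n. real n > snd B \<Longrightarrow> dist (p n) (q n) < \<bar>K\<bar> + 1" by metis
  define n0 where "n0 = nat \<lceil>max (max (snd B) 1) (R + \<bar>K\<bar> + 1)\<rceil> + 1"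
  have n0: "real n > snd B" "n > 0" "real n > R + \<bar>K\<bar> + 1" if "n \<ge> n0" for n
  proof -
    have "max (max (snd B) 1) (R + \<bar>K\<bar> + 1) < real n" using that unfolding n0_def by linarith
    then show "real n > snd B" "n > 0" "real n > R + \<bar>K\<bar> + 1" by auto
  qed
  define z where "z n = q n $ first_index" for n
  have zn: "norm (z n - of_nat n) < \<bar>K\<bar> + 1" if n: "n \<ge> n0" for n
  proof -
    have "p n $ first_index = of_nat n" unfolding p_def using n0(2)[OF n] by (intro leaf_point_first[OF B]) simp
    then have "norm (z n - of_nat n) = norm ((p n - q n) $ first_index)" by (simp add: z_def norm_minus_commute)
    also have "\<dots> \<le> dist (p n) (q n)" unfolding dist_norm by (rule Finite_Cartesian_Product.norm_nth_le)
    finally show ?thesis using q(2)[OF n0(1)[OF n]] by linarith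
  qed
  have "\<exists>b\<in>\<B>. q n = leaf_point (fst b) 1 (z n)" if n: "n \<ge> n0" for n
  proof -
    have "norm (of_nat n :: complex) \<le> norm (z n) + norm (z n - of_nat n)"
      by (metis norm_minus_commute norm_triangle_sub)
    moreover have "norm (z n) \<le> norm (q n)" unfolding z_def by (rule Finite_Cartesian_Product.norm_nth_le)
    ultimately have "norm (q n) > R" using zn[OF n] n0(3)[OF n] by simp
    from cover[OF q(1)[OF n0(1)[OF n]] this] show ?thesis by (auto simp: z_def)
  qed
  then obtain b where b: "\<And>n. n \<ge> n0 \<Longrightarrow> b n \<in> \<B>" "\<And>n. n \<ge> n0 \<Longrightarrow> q n = leaf_point (fst (b n)) 1 (z n)" by metis
  have "\<exists>B'\<in>\<B>. infinite {n \<in> {n0..}. b n = B'}"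
  proof (rule pigeonhole_infinite_rel)
    show "infinite {n0..}" by (rule infinite_Ici)
    show "\<forall>n\<in>{n0..}. \<exists>B'\<in>\<B>. b n = B'" using b(1) by auto
  qed (rule \<B>(1))
  then obtain B' where B'\<B>: "B' \<in> \<B>" and inf: "infinite {n \<in> {n0..}. b n = B'}" by blast
  have B': "infinity_branch G B'" by (rule \<B>(2)[OF B'\<B>])
  obtain K1 R1 where K1: "\<And>z w. Re z > R1 \<Longrightarrow> Re w > R1 \<Longrightarrow>
    dist (leaf_point (fst B') 1 z) (leaf_point (fst B') 1 w) \<le> K1 * (1 + norm (z - w))"
    using leaf_point_near[OF B'] by blast
  have "\<not> leaves_diverge B 1 B' 1"
  proof
    assume "leaves_diverge B 1 B' 1"
    then have lim: "filterlim (\<lambda>z. norm (leaf_point (fst B) 1 z - leaf_point (fst B') 1 z)) at_top at_infinity"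
      by (simp add: leaves_diverge_def)
    have "filterlim (\<lambda>n. norm (p n - leaf_point (fst B') 1 (of_nat n))) at_top sequentially"
      unfolding p_def by (rule filterlim_compose[OF lim tendsto_of_nat])
    then have "\<forall>\<^sub>F n in sequentially. norm (p n - leaf_point (fst B') 1 (of_nat n)) > \<bar>K\<bar> + 1 + \<bar>K1\<bar> * (\<bar>K\<bar> + 2)"
      by (simp add: filterlim_at_top_dense)
    then obtain m where m: "\<And>n. n \<ge> m \<Longrightarrow> norm (p n - leaf_point (fst B') 1 (of_nat n)) > \<bar>K\<bar> + 1 + \<bar>K1\<bar> * (\<bar>K\<bar> + 2)"
      unfolding eventually_sequentially by blast
    define m' where "m' = max m (nat \<lceil>R1 + \<bar>K\<bar> + 1\<rceil> + 1)"
    obtain n where n: "n \<ge> m'" "n \<ge> n0" "b n = B'"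
      using inf unfolding infinite_nat_iff_unbounded_le by auto
    have nR: "real n > R1 + \<bar>K\<bar> + 1" using n(1) unfolding m'_def by linarith
    have "\<bar>Re (z n - of_nat n)\<bar> < \<bar>K\<bar> + 1" using zn[OF n(2)] abs_Re_le_cmod[of "z n - of_nat n"] by linarith
    then have "Re (z n) > R1" using nR by simp
    moreover have "Re (of_nat n) > R1" using nR by simp
    ultimately have "dist (leaf_point (fst B') 1 (z n)) (leaf_point (fst B') 1 (of_nat n)) \<le> K1 * (1 + norm (z n - of_nat n))"
      by (rule K1)
    also have "\<dots> \<le> \<bar>K1\<bar> * (1 + norm (z n - of_nat n))" by (intro mult_right_mono) auto
    also have "\<dots> \<le> \<bar>K1\<bar> * (\<bar>K\<bar> + 2)" using zn[OF n(2)] by (intro mult_left_mono) auto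
    finally have "dist (q n) (leaf_point (fst B') 1 (of_nat n)) \<le> \<bar>K1\<bar> * (\<bar>K\<bar> + 2)" using b(2)[OF n(2)] n(3) by simp
    moreover have "dist (p n) (q n) < \<bar>K\<bar> + 1" by (rule q(2)[OF n0(1)[OF n(2)]])
    moreover have "dist (p n) (leaf_point (fst B') 1 (of_nat n)) \<le> dist (p n) (q n) + dist (q n) (leaf_point (fst B') 1 (of_nat n))"
      by (rule dist_triangle)
    ultimately have "norm (p n - leaf_point (fst B') 1 (of_nat n)) < \<bar>K\<bar> + 1 + \<bar>K1\<bar> * (\<bar>K\<bar> + 2)"
      by (simp add: dist_norm)
    moreover have "n \<ge> m" using n(1) by (simp add: m'_def)
    ultimately show False using m[of n] by simp
  qed
  then have "\<not> branches_diverge B B'"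
    using one_in_conjugation_roots unfolding branches_diverge_def by blast
  with B' show ?thesis by blast
qed

lemma space_curve_nonempty:
  assumes "defines_space_curve F"
  shows "zero_locus F \<noteq> {}"
proof
  assume empty: "zero_locus F = {}"
  have "{Zs. Zs \<noteq> [] \<and> sorted_wrt (\<subset>) Zs \<and> (\<forall>Z\<in>set Zs. irreducible_algebraic_set Z \<and> Z \<subseteq> zero_locus F)} = {}"
    unfolding empty by (auto simp: irreducible_algebraic_set_def neq_Nil_conv)
  then have "algebraic_dimension (zero_locus F) = Sup {}" unfolding algebraic_dimension_def by (simp only: image_empty)
  also have "\<dots> = 0" by (simp add: Sup_enat_def)
  finally show False using assms by (simp add: defines_space_curve_def)
qed

lemma bounded_iff_SUP_finite:
  "(\<exists>K. \<forall>p\<in>A. infdist p D \<le> K) \<longleftrightarrow> (SUP p\<in>A. ennreal (infdist p D)) < \<infinity>"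
proof
  assume "\<exists>K. \<forall>p\<in>A. infdist p D \<le> K"
  then obtain K where "\<And>p. p \<in> A \<Longrightarrow> infdist p D \<le> K" by blast
  then have "(SUP p\<in>A. ennreal (infdist p D)) \<le> ennreal K" by (intro SUP_least ennreal_leI)
  then show "(SUP p\<in>A. ennreal (infdist p D)) < \<infinity>" by (rule le_less_trans) simp
next
  assume fin: "(SUP p\<in>A. ennreal (infdist p D)) < \<infinity>"
  show "\<exists>K. \<forall>p\<in>A. infdist p D \<le> K"
  proof (intro exI ballI)
    fix p assume "p \<in> A"
    then have "ennreal (infdist p D) \<le> (SUP p\<in>A. ennreal (infdist p D))" by (rule SUP_upper)
    also have "\<dots> = ennreal (enn2real (SUP p\<in>A. ennreal (infdist p D)))" using fin by simp
    finally show "infdist p D \<le> enn2real (SUP p\<in>A. ennreal (infdist p D))" by (simp add: ennreal_le_iff)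
  qed
qed

theorem theorem3p5:
  fixes F G :: "('n::{finite,linorder}, real) mpoly set"
    and C D :: "(complex ^ 'n::{finite,linorder}) set"
  assumes "CARD('n) \<ge> 2"
    and "defines_space_curve F" and "C = zero_locus F"
    and "defines_space_curve G" and "D = zero_locus G"
    and "no_infinity_point_with_x1_zero C" and "no_infinity_point_with_x1_zero D"
  shows "similar_asymptotic_behavior F G \<longleftrightarrow> hausdorff_distance C D < \<infinity>"
proof -
  have fin: "finite F" "finite G" using assms(2,4) by (simp_all add: defines_space_curve_def)
  have ne: "zero_locus F \<noteq> {}" "zero_locus G \<noteq> {}" using assms(2,4) space_curve_nonempty by blast+
  have C: "no_infinity_point_with_x1_zero (zero_locus F)" and D: "no_infinity_point_with_x1_zero (zero_locus G)"
    using assms(3,5,6,7) by simp_all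
  have FG: "(\<forall>B. infinity_branch F B \<longrightarrow> (\<exists>B'. infinity_branch G B' \<and> \<not> branches_diverge B B')) \<longleftrightarrow>
      (\<exists>K. \<forall>p\<in>zero_locus F. infdist p (zero_locus G) \<le> K)"
    using similar_imp_bounded_distance[OF fin(1) C ne(2)] bounded_distance_imp_similar[OF fin(2) D ne(2)] by metis
  have GF: "(\<forall>B. infinity_branch G B \<longrightarrow> (\<exists>B'. infinity_branch F B' \<and> \<not> branches_diverge B B')) \<longleftrightarrow>
      (\<exists>K. \<forall>p\<in>zero_locus G. infdist p (zero_locus F) \<le> K)"
    using similar_imp_bounded_distance[OF fin(2) D ne(1)] bounded_distance_imp_similar[OF fin(1) C ne(1)] by metis
  show ?thesis
    unfolding similar_asymptotic_behavior_def FG GF bounded_iff_SUP_finite hausdorff_distance_def assms(3,5)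
    by simp
qed

end
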